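(* Let $R$ be a graded local ring, let $a\in\mathbb{Z}$, and let $D$ be a degree $a$ differential $R$-module. (a) If $D$ admits a free flag resolution $F\to D$ such that $F$ is finitely generated, then $D$ admits a minimal free resolution $M\to D$ that is unique up to isomorphism of differential modules, and where $M$ is finitely generated. (b) If $R_0$ is a field, and $D$ admits a free flag resolution $F=\bigoplus_{i\ge 0}F_i$ with $F_i$ finitely generated for all $i$ and such that (i) each graded component $(F)_j$ (the internal degree $j$ part of $F$) is finite dimensional over $R_0$, and (ii) the graded components $(F)_j$ vanish for $j\ll 0$, then $D$ admits a minimal free resolution that is unique up to isomorphism of differential modules.
   Context: A graded local ring is an $\mathbb{N}$-graded Noetherian (not necessarily commutative) ring $R=\bigoplus_{i\ge 0}R_i$ with $R_0$ a (not necessarily commutative) local ring; $\mathfrak{m}$ denotes its maximal ideal, the sum of the maximal ideal of $R_0$ and $R_+=\bigoplus_{i>0}R_i$. All modules are graded left $R$-modules and all maps are graded (homogeneous); $D(a)$ denotes the twist with $D(a)_j=D_{a+j}$. For $a\in\mathbb{Z}$, a degree $a$ differential $R$-module is a pair $(D,\partial)$ with $D$ an $R$-module and $\partial\colon D\to D(a)$ a homogeneous $R$-linear map with $\partial^2=0$. A morphism $D\to D'$ is a homogeneous (degree-preserving) $R$-linear map $f$ with $f\partial=\partial' f$. The homology of $D$ is $H(D)=\ker(\partial\colon D\to D(a))/\operatorname{im}(\partial\colon D(-a)\to D)$. A quasi-isomorphism is a morphism inducing an isomorphism on homology. A differential module is free if its underlying module is a free (graded) $R$-module. A free flag is a differential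 module of the form $F=\bigoplus_{i\ge 0}F_i$ where each $F_i$ is a free $R$-module and $\partial_F(F_i)\subseteq\bigoplus_{j<i}F_j$ (up to the twist by $a$) for all $i$. A free flag resolution of $D$ is a quasi-isomorphism $F\to D$ with $F$ a free flag. A free resolution of $D$ is a quasi-isomorphism $\epsilon\colon F\to D$ such that $F$ is a free differential module and $\epsilon$ factors as $F\to\widetilde F\to D$, where $\widetilde F\to D$ is a free flag resolution and $F\to\widetilde F$ is a split injection of differential modules. It is a minimal free resolution if moreover $\partial_F(F)\subseteq\mathfrak{m}F$. *)

theory Defs
  imports "HOL.Hull" "HOL-Algebra.Module" "HOL-Algebra.AbelCoset"
begin

section \<open>Graded local rings\<close>

text \<open>\<open>M\<close> is the internal direct sum of the family \<open>A\<close> of additive subgroups (over the whole index type).\<close>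

definition internal_direct_sum :: "('m, 'x) ring_scheme \<Rightarrow> ('i \<Rightarrow> 'm set) \<Rightarrow> bool" where
  "internal_direct_sum M A \<longleftrightarrow>
     (\<forall>i. additive_subgroup (A i) M) \<and>
     (\<forall>x \<in> carrier M. \<exists>!f. (\<forall>i. f i \<in> A i) \<and> finite {i. f i \<noteq> \<zero>\<^bsub>M\<^esub>} \<and>
        x = (\<Oplus>\<^bsub>M\<^esub>i\<in>{i. f i \<noteq> \<zero>\<^bsub>M\<^esub>}. f i))"

record 'a gr_ring = "'a ring" +
  rpart :: "nat \<Rightarrow> 'a set"

locale graded_ring = ring R for R :: "('a, 'x) gr_ring_scheme" (structure) +
  assumes rpart_direct_sum: "internal_direct_sum R (rpart R)"
    and one_rpart: "\<one> \<in> rpart R 0"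
    and mult_rpart: "x \<in> rpart R i \<Longrightarrow> y \<in> rpart R j \<Longrightarrow> x \<otimes> y \<in> rpart R (i + j)"

definition deg_zero :: "('a, 'x) gr_ring_scheme \<Rightarrow> ('a, 'x) gr_ring_scheme" where
  "deg_zero R = R\<lparr>carrier := rpart R 0\<rparr>"

definition left_ideal :: "('a, 'x) ring_scheme \<Rightarrow> 'a set \<Rightarrow> bool" where
  "left_ideal R I \<longleftrightarrow>
     additive_subgroup I R \<and> (\<forall>r \<in> carrier R. \<forall>x \<in> I. r \<otimes>\<^bsub>R\<^esub> x \<in> I)"

definition right_ideal :: "('a, 'x) ring_scheme \<Rightarrow> 'a set \<Rightarrow> bool" where
  "right_ideal R I \<longleftrightarrow>
     additive_subgroup I R \<and> (\<forall>r \<in> carrier R. \<forall>x \<in> I. x \<otimes>\<^bsub>R\<^esub> r \<in> I)"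

text \<open>The library's \<open>noetherian_ring\<close> only constrains two-sided ideals; for a noncommutative ring
  Noetherian means both left and right Noetherian.\<close>

definition noetherian :: "('a, 'x) ring_scheme \<Rightarrow> bool" where
  "noetherian R \<longleftrightarrow>
     (\<forall>I. left_ideal R I \<longrightarrow> (\<exists>S \<subseteq> carrier R. finite S \<and> I = left_ideal R hull S)) \<and>
     (\<forall>I. right_ideal R I \<longrightarrow> (\<exists>S \<subseteq> carrier R. finite S \<and> I = right_ideal R hull S))"

definition maximal_left_ideal :: "('a, 'x) ring_scheme \<Rightarrow> 'a set \<Rightarrow> bool" where
  "maximal_left_ideal R I \<longleftrightarrow> left_ideal R I \<and> I \<noteq> carrier R \<and>
     (\<forall>J. left_ideal R J \<longrightarrow> I \<subseteq> J \<longrightarrow> J = I \<or> J = carrier R)"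

definition local_ring :: "('a, 'x) ring_scheme \<Rightarrow> bool" where
  "local_ring R \<longleftrightarrow> ring R \<and> (\<exists>!I. maximal_left_ideal R I)"

definition local_max_ideal :: "('a, 'x) ring_scheme \<Rightarrow> 'a set" where
  "local_max_ideal R = (THE I. maximal_left_ideal R I)"

definition graded_local_ring :: "('a, 'x) gr_ring_scheme \<Rightarrow> bool" where
  "graded_local_ring R \<longleftrightarrow> graded_ring R \<and> noetherian R \<and> local_ring (deg_zero R)"

definition positive_part :: "('a, 'x) gr_ring_scheme \<Rightarrow> 'a set" where
  "positive_part R = (\<lambda>H. additive_subgroup H R) hull (\<Union>i\<in>{0<..}. rpart R i)"

definition graded_max_ideal :: "('a, 'x) gr_ring_scheme \<Rightarrow> 'a set" where
  "graded_max_ideal R = local_max_ideal (deg_zero R) <+>\<^bsub>R\<^esub> positive_part R"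


section \<open>Graded left modules\<close>

text \<open>The library's locale \<open>module\<close> requires a commutative base ring; its record type is reused, so
  the \<open>mult\<close> and \<open>one\<close> fields of a module carry no meaning, as in the library.\<close>

locale left_module = R?: ring R + M?: abelian_group M
  for R :: "('a, 'x) ring_scheme" (structure) and M :: "('a, 'b, 'y) module_scheme" (structure) +
  assumes smult_closed [simp, intro]:
      "\<lbrakk>r \<in> carrier R; x \<in> carrier M\<rbrakk> \<Longrightarrow> r \<odot>\<^bsub>M\<^esub> x \<in> carrier M"
    and smult_l_distr:
      "\<lbrakk>r \<in> carrier R; s \<in> carrier R; x \<in> carrier M\<rbrakk> \<Longrightarrow>
        (r \<oplus>\<^bsub>R\<^esub> s) \<odot>\<^bsub>M\<^esub> x = r \<odot>\<^bsub>M\<^esub> x \<oplus>\<^bsub>M\<^esub> s \<odot>\<^bsub>M\<^esub> x"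
    and smult_r_distr:
      "\<lbrakk>r \<in> carrier R; x \<in> carrier M; y \<in> carrier M\<rbrakk> \<Longrightarrow>
        r \<odot>\<^bsub>M\<^esub> (x \<oplus>\<^bsub>M\<^esub> y) = r \<odot>\<^bsub>M\<^esub> x \<oplus>\<^bsub>M\<^esub> r \<odot>\<^bsub>M\<^esub> y"
    and smult_assoc:
      "\<lbrakk>r \<in> carrier R; s \<in> carrier R; x \<in> carrier M\<rbrakk> \<Longrightarrow>
        (r \<otimes>\<^bsub>R\<^esub> s) \<odot>\<^bsub>M\<^esub> x = r \<odot>\<^bsub>M\<^esub> (s \<odot>\<^bsub>M\<^esub> x)"
    and smult_one [simp]: "x \<in> carrier M \<Longrightarrow> \<one>\<^bsub>R\<^esub> \<odot>\<^bsub>M\<^esub> x = x"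

definition submodule_span ::
    "('a, 'x) ring_scheme \<Rightarrow> ('a, 'b, 'y) module_scheme \<Rightarrow> 'b set \<Rightarrow> 'b set" where
  "submodule_span R M S = (\<lambda>N. submodule N R M) hull S"

definition finitely_generated ::
    "('a, 'x) ring_scheme \<Rightarrow> ('a, 'b, 'y) module_scheme \<Rightarrow> bool" where
  "finitely_generated R M \<longleftrightarrow>
     (\<exists>S \<subseteq> carrier M. finite S \<and> carrier M = submodule_span R M S)"

text \<open>Coefficient functions are extensional (\<open>\<rightarrow>\<^sub>E\<close>), so that \<open>\<exists>!\<close> expresses uniqueness of
  coordinates.\<close>

definition module_basis ::
    "('a, 'x) ring_scheme \<Rightarrow> ('a, 'b, 'y) module_scheme \<Rightarrow> 'b set \<Rightarrow> bool" where
  "module_basis R M B \<longleftrightarrow> B \<subseteq> carrier M \<and>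
     (\<forall>x \<in> carrier M. \<exists>!c. c \<in> B \<rightarrow>\<^sub>E carrier R \<and> finite {b \<in> B. c b \<noteq> \<zero>\<^bsub>R\<^esub>} \<and>
        x = (\<Oplus>\<^bsub>M\<^esub>b\<in>{b \<in> B. c b \<noteq> \<zero>\<^bsub>R\<^esub>}. c b \<odot>\<^bsub>M\<^esub> b))"

definition finite_dimensional ::
    "('a, 'x) ring_scheme \<Rightarrow> ('a, 'b, 'y) module_scheme \<Rightarrow> bool" where
  "finite_dimensional K V \<longleftrightarrow> left_module K V \<and> (\<exists>B. finite B \<and> module_basis K V B)"

record ('a, 'b) gr_module = "('a, 'b) module" +
  mpart :: "int \<Rightarrow> 'b set"

locale graded_module = R?: graded_ring R + left_module R M
  for R :: "('a, 'x) gr_ring_scheme" (structure)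
    and M :: "('a, 'b, 'y) gr_module_scheme" (structure) +
  assumes mpart_direct_sum: "internal_direct_sum M (mpart M)"
    and smult_mpart:
      "r \<in> rpart R i \<Longrightarrow> x \<in> mpart M j \<Longrightarrow> r \<odot>\<^bsub>M\<^esub> x \<in> mpart M (int i + j)"

definition twist :: "int \<Rightarrow> ('a, 'b, 'y) gr_module_scheme \<Rightarrow> ('a, 'b, 'y) gr_module_scheme" where
  "twist a M = M\<lparr>mpart := \<lambda>j. mpart M (a + j)\<rparr>"

definition restrict_module ::
    "('a, 'b, 'y) gr_module_scheme \<Rightarrow> 'b set \<Rightarrow> ('a, 'b, 'y) gr_module_scheme" where
  "restrict_module M N = M\<lparr>carrier := N, mpart := \<lambda>j. mpart M j \<inter> N\<rparr>"

definition graded_hom ::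
    "('a, 'x) gr_ring_scheme \<Rightarrow> ('a, 'b, 'y) gr_module_scheme \<Rightarrow>
     ('a, 'c, 'z) gr_module_scheme \<Rightarrow> ('b \<Rightarrow> 'c) set" where
  "graded_hom R M N = {f. f \<in> carrier M \<rightarrow> carrier N \<and>
     (\<forall>x \<in> carrier M. \<forall>y \<in> carrier M. f (x \<oplus>\<^bsub>M\<^esub> y) = f x \<oplus>\<^bsub>N\<^esub> f y) \<and>
     (\<forall>r \<in> carrier R. \<forall>x \<in> carrier M. f (r \<odot>\<^bsub>M\<^esub> x) = r \<odot>\<^bsub>N\<^esub> f x) \<and>
     (\<forall>j. f ` mpart M j \<subseteq> mpart N j)}"

definition graded_iso ::
    "('a, 'x) gr_ring_scheme \<Rightarrow> ('a, 'b, 'y) gr_module_scheme \<Rightarrow>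
     ('a, 'c, 'z) gr_module_scheme \<Rightarrow> ('b \<Rightarrow> 'c) set" where
  "graded_iso R M N = {f \<in> graded_hom R M N. bij_betw f (carrier M) (carrier N)}"

text \<open>Free in the category of graded modules: a direct sum of twists of \<open>R\<close>, that is, there is a
  basis of homogeneous elements.\<close>

definition free_graded_module ::
    "('a, 'x) gr_ring_scheme \<Rightarrow> ('a, 'b, 'y) gr_module_scheme \<Rightarrow> bool" where
  "free_graded_module R M \<longleftrightarrow> graded_module R M \<and>
     (\<exists>B. B \<subseteq> (\<Union>j. mpart M j) \<and> module_basis R M B)"

text \<open>The submodule \<open>mM\<close>.\<close>

definition max_ideal_times ::
    "('a, 'x) gr_ring_scheme \<Rightarrow> ('a, 'b, 'y) gr_module_scheme \<Rightarrow> 'b set" where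
  "max_ideal_times R M =
     submodule_span R M {r \<odot>\<^bsub>M\<^esub> x | r x. r \<in> graded_max_ideal R \<and> x \<in> carrier M}"


section \<open>Differential modules\<close>

record ('a, 'b) diff_module = "('a, 'b) gr_module" +
  differential :: "'b \<Rightarrow> 'b"

definition differential_module ::
    "'a gr_ring \<Rightarrow> int \<Rightarrow> ('a, 'b) diff_module \<Rightarrow> bool" where
  "differential_module R a D \<longleftrightarrow> graded_module R D \<and>
     differential D \<in> graded_hom R D (twist a D) \<and>
     (\<forall>x \<in> carrier D. differential D (differential D x) = \<zero>\<^bsub>D\<^esub>)"

definition diff_morphism ::
    "'a gr_ring \<Rightarrow> ('a, 'b) diff_module \<Rightarrow> ('a, 'c) diff_module \<Rightarrow> ('b \<Rightarrow> 'c) set" where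
  "diff_morphism R D E =
     {f \<in> graded_hom R D E. \<forall>x \<in> carrier D. f (differential D x) = differential E (f x)}"

definition diff_isomorphic ::
    "'a gr_ring \<Rightarrow> ('a, 'b) diff_module \<Rightarrow> ('a, 'c) diff_module \<Rightarrow> bool" where
  "diff_isomorphic R D E \<longleftrightarrow>
     (\<exists>f \<in> diff_morphism R D E. bij_betw f (carrier D) (carrier E))"

definition cycles :: "('a, 'b) diff_module \<Rightarrow> 'b set" where
  "cycles D = {x \<in> carrier D. differential D x = \<zero>\<^bsub>D\<^esub>}"

definition boundaries :: "('a, 'b) diff_module \<Rightarrow> 'b set" where
  "boundaries D = differential D ` carrier D"

text \<open>Homology as a graded module whose elements are the cosets of the boundaries.\<close>

definition homology :: "('a, 'b) diff_module \<Rightarrow> ('a, 'b set) gr_module" where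
  "homology D =
     \<lparr>carrier = (\<lambda>z. boundaries D +>\<^bsub>D\<^esub> z) ` cycles D,
      mult = undefined, one = undefined,
      zero = boundaries D,
      add = (\<lambda>X Y. X <+>\<^bsub>D\<^esub> Y),
      smult = (\<lambda>r X. \<Union>x\<in>X. boundaries D +>\<^bsub>D\<^esub> (r \<odot>\<^bsub>D\<^esub> x)),
      mpart = (\<lambda>j. (\<lambda>z. boundaries D +>\<^bsub>D\<^esub> z) ` (cycles D \<inter> mpart D j))\<rparr>"

definition homology_map :: "('a, 'c) diff_module \<Rightarrow> ('b \<Rightarrow> 'c) \<Rightarrow> 'b set \<Rightarrow> 'c set" where
  "homology_map E f X = (\<Union>x\<in>X. boundaries E +>\<^bsub>E\<^esub> f x)"

definition quasi_isomorphism ::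
    "'a gr_ring \<Rightarrow> ('a, 'b) diff_module \<Rightarrow> ('a, 'c) diff_module \<Rightarrow> ('b \<Rightarrow> 'c) \<Rightarrow> bool" where
  "quasi_isomorphism R D E f \<longleftrightarrow> f \<in> diff_morphism R D E \<and>
     homology_map E f \<in> graded_iso R (homology D) (homology E)"

definition split_injection ::
    "'a gr_ring \<Rightarrow> ('a, 'b) diff_module \<Rightarrow> ('a, 'c) diff_module \<Rightarrow> ('b \<Rightarrow> 'c) \<Rightarrow> bool" where
  "split_injection R D E i \<longleftrightarrow> i \<in> diff_morphism R D E \<and>
     (\<exists>p \<in> diff_morphism R E D. \<forall>x \<in> carrier D. p (i x) = x)"


section \<open>Free flags and resolutions\<close>

definition free_flag ::
    "'a gr_ring \<Rightarrow> int \<Rightarrow> ('a, 'f) diff_module \<Rightarrow> (nat \<Rightarrow> 'f set) \<Rightarrow> bool" where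
  "free_flag R a F \<Phi> \<longleftrightarrow> differential_module R a F \<and>
     internal_direct_sum F \<Phi> \<and>
     (\<forall>i. free_graded_module R (restrict_module F (\<Phi> i))) \<and>
     (\<forall>i. differential F ` \<Phi> i \<subseteq>
        {(\<Oplus>\<^bsub>F\<^esub>j\<in>{..<i}. f j) | f. \<forall>j<i. f j \<in> \<Phi> j})"

definition free_flag_resolution ::
    "'a gr_ring \<Rightarrow> int \<Rightarrow> ('a, 'd) diff_module \<Rightarrow>
     ('a, 'f) diff_module \<Rightarrow> (nat \<Rightarrow> 'f set) \<Rightarrow> ('f \<Rightarrow> 'd) \<Rightarrow> bool" where
  "free_flag_resolution R a D F \<Phi> \<epsilon> \<longleftrightarrow>
     free_flag R a F \<Phi> \<and> quasi_isomorphism R F D \<epsilon>"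

text \<open>The type argument is the type carrying the elements of the free flag through which the
  resolution factors.\<close>

definition free_resolution ::
    "'t itself \<Rightarrow> 'a gr_ring \<Rightarrow> int \<Rightarrow> ('a, 'd) diff_module \<Rightarrow>
     ('a, 'f) diff_module \<Rightarrow> ('f \<Rightarrow> 'd) \<Rightarrow> bool" where
  "free_resolution (T :: 't itself) R a D F \<epsilon> \<longleftrightarrow>
     differential_module R a F \<and> free_graded_module R F \<and> quasi_isomorphism R F D \<epsilon> \<and>
     (\<exists>(G :: ('a, 't) diff_module) \<Phi> \<eta> \<iota>. free_flag_resolution R a D G \<Phi> \<eta> \<and>
        split_injection R F G \<iota> \<and> (\<forall>x \<in> carrier F. \<epsilon> x = \<eta> (\<iota> x)))"

definition minimal_free_resolution ::
    "'t itself \<Rightarrow> 'a gr_ring \<Rightarrow> int \<Rightarrow> ('a, 'd) diff_module \<Rightarrow>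
     ('a, 'f) diff_module \<Rightarrow> ('f \<Rightarrow> 'd) \<Rightarrow> bool" where
  "minimal_free_resolution T R a D F \<epsilon> \<longleftrightarrow> free_resolution T R a D F \<epsilon> \<and>
     differential F ` carrier F \<subseteq> max_ideal_times R F"

end

theory Submission
  imports Defs
begin

text \<open>
  Both parts follow from one finiteness condition on the flag \<open>F\<close>: it has homogeneous generators that
  are finite in number in each degree and whose degrees are bounded below
  (\<open>locally_finite_generators\<close>). For such modules the graded lemma of Nakayama holds
  (\<open>graded_nakayama\<close>): a graded submodule \<open>N\<close> with \<open>M = N + \<mm>M\<close> is all of \<open>M\<close>. Consequently a split
  surjection with kernel in \<open>\<mm>M\<close> is bijective (\<open>split_surjection_bijective\<close>), which replaces every
  count of dimensions.

  Existence. Modulo \<open>\<mm>\<close> the differential of \<open>F\<close> becomes a linear map over the division ring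
  \<open>R\<^sub>0/\<mm>\<^sub>0\<close>, and the part on which it does not vanish can be contracted. A contraction
  lifts to a map \<open>s\<close> on \<open>F\<close> with \<open>s\<partial>s = s\<close>, \<open>s\<^sup>2 = 0\<close> and \<open>\<partial> - \<partial>s\<partial>\<close> with values in \<open>\<mm>F\<close>
  (\<open>contraction\<close>). Then \<open>e = 1 - \<partial>s - s\<partial>\<close> is an idempotent chain map homotopic to the identity, so its
  image \<open>M\<close> is a summand of \<open>F\<close> with the same homology; it is minimal and free (\<open>minimal_summand\<close>).
  The linear algebra over the division ring is carried out with submodules containing \<open>\<mm>F\<close>, through
  maximal subsets of a basis (\<open>basis_selection\<close>).

  Uniqueness. Maps from a free flag lift along quasi-isomorphisms up to homotopy, and lifts of zero are
  null-homotopic; both are the statement that a map from a free flag into an acyclic mapping cone is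
  null-homotopic, proved layer by layer (locale \<open>lifting_problem\<close>). Summands of flags inherit this.
  Hence two resolutions are homotopy equivalent, and on a minimal module a null-homotopic map has
  values in \<open>\<mm>M\<close>, so the two comparison maps are mutually inverse modulo \<open>\<mm>\<close> (\<open>comparison\<close>).
  A minimal resolution is not assumed to be of finite type, but comparing it with \<open>F\<close> shows that
  its basis is locally finite (\<open>locally_finite_basis\<close>), and the lemma of Nakayama makes the comparison
  maps bijective.
\<close>

section \<open>Sums and direct sums of abelian groups\<close>

lemma (in abelian_monoid) finsum_superset:
  assumes "finite B" and "A \<subseteq> B" and "\<And>i. i \<in> B - A \<Longrightarrow> f i = \<zero>" and "f \<in> A \<rightarrow> carrier G"
  shows "finsum G f A = finsum G f B"
  using assms by (intro add.finprod_mono_neutral_cong_left) auto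

lemma (in abelian_monoid) finsum_closed_under:
  assumes "P \<zero>" and "\<And>x y. \<lbrakk>x \<in> carrier G; y \<in> carrier G; P x; P y\<rbrakk> \<Longrightarrow> P (x \<oplus> y)"
    and "\<And>i. i \<in> A \<Longrightarrow> f i \<in> carrier G" and "\<And>i. i \<in> A \<Longrightarrow> P (f i)"
  shows "P (finsum G f A)"
proof (cases "finite A")
  case True
  then have "(\<forall>i \<in> A. f i \<in> carrier G \<and> P (f i)) \<Longrightarrow> P (finsum G f A)"
  proof (induction A)
    case empty
    then show ?case using assms(1) by simp
  next
    case (insert x F)
    then have "f \<in> F \<rightarrow> carrier G" by auto
    then have "finsum G f (insert x F) = f x \<oplus> finsum G f F" "finsum G f F \<in> carrier G"
      using insert by (auto intro!: finsum_closed)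
    then show ?case using insert assms(2) by auto
  qed
  then show ?thesis using assms by auto
next
  case False
  then show ?thesis using assms(1) finsum_infinite by simp
qed

lemma additive_map_hom:
  assumes "abelian_group G" and "abelian_group H" and "h \<in> carrier G \<rightarrow> carrier H"
    and "\<And>x y. \<lbrakk>x \<in> carrier G; y \<in> carrier G\<rbrakk> \<Longrightarrow> h (x \<oplus>\<^bsub>G\<^esub> y) = h x \<oplus>\<^bsub>H\<^esub> h y"
  shows "abelian_group_hom G H h"
  using assms
  by (intro abelian_group_homI group_hom.intro)
    (auto simp: group_hom_axioms_def hom_def abelian_group.a_group)

lemma (in abelian_group_hom) hom_finsum:
  assumes "f \<in> A \<rightarrow> carrier G"
  shows "h (finsum G f A) = finsum H (\<lambda>i. h (f i)) A"
proof (cases "finite A")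
  case True
  then show ?thesis using assms
  proof (induction A)
    case empty
    then show ?case by simp
  next
    case (insert x F)
    then have "f \<in> F \<rightarrow> carrier G" "f x \<in> carrier G" by auto
    with insert show ?case by (simp add: Pi_def)
  qed
next
  case False
  then show ?thesis by (simp add: G.finsum_infinite H.finsum_infinite)
qed

lemma (in abelian_group_hom) hom_minus:
  assumes "x \<in> carrier G" and "y \<in> carrier G"
  shows "h (x \<ominus>\<^bsub>G\<^esub> y) = h x \<ominus>\<^bsub>H\<^esub> h y"
  using assms by (simp add: a_minus_def)

lemma (in abelian_group) add_minus_cancel:
  assumes "x \<in> carrier G" and "y \<in> carrier G"
  shows "y \<oplus> (x \<ominus> y) = x" and "(x \<ominus> y) \<oplus> y = x" and "x \<ominus> (x \<ominus> y) = y"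
proof -
  show xy: "(x \<ominus> y) \<oplus> y = x" using assms by (simp add: a_minus_def a_assoc l_neg)
  then show "y \<oplus> (x \<ominus> y) = x" using assms by (simp add: a_comm)
  show "x \<ominus> (x \<ominus> y) = y" using assms by (simp add: a_minus_def minus_add a_assoc[symmetric] r_neg)
qed

lemma (in abelian_group) neg_zero [simp]: "\<ominus> \<zero> = \<zero>"
  by (rule minus_equality) auto

lemma (in abelian_group) minus_zero_right [simp]: "x \<in> carrier G \<Longrightarrow> x \<ominus> \<zero> = x"
  by (simp add: a_minus_def)

lemma (in abelian_group) minus_self [simp]: "x \<in> carrier G \<Longrightarrow> x \<ominus> x = \<zero>"
  by (simp add: a_minus_def r_neg)

lemma (in abelian_group) add_diff_cancel:
  assumes "x \<in> carrier G" and "y \<in> carrier G"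
  shows "(x \<oplus> y) \<ominus> y = x" and "(y \<oplus> x) \<ominus> y = x"
proof -
  show "(x \<oplus> y) \<ominus> y = x" using assms by (simp add: a_minus_def a_assoc r_neg)
  then show "(y \<oplus> x) \<ominus> y = x" using assms by (simp add: a_comm)
qed

lemma (in abelian_group) add_minus_add:
  assumes "x \<in> carrier G" and "y \<in> carrier G" and "z \<in> carrier G"
  shows "(x \<oplus> y) \<ominus> (x \<oplus> z) = y \<ominus> z"
  using assms add_diff_cancel(2)[of y x] by (simp add: a_minus_def minus_add a_assoc[symmetric])

text \<open>Restricting a module changes the carrier, through which finite sums are defined; their values
  nevertheless agree with those in the ambient group.\<close>

lemma finsum_in_subgroup:
  assumes "abelian_monoid M" and "abelian_monoid N"
    and "carrier N \<subseteq> carrier M" and "\<zero>\<^bsub>N\<^esub> = \<zero>\<^bsub>M\<^esub>" and "add N = add M"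
    and "f \<in> A \<rightarrow> carrier N"
  shows "finsum N f A = finsum M f A"
proof -
  interpret M: abelian_monoid M by fact
  interpret N: abelian_monoid N by fact
  show ?thesis
  proof (cases "finite A")
    case True
    then show ?thesis using assms(6)
    proof (induction A)
      case empty
      then show ?case using assms(4) by simp
    next
      case (insert x F)
      then have "f \<in> F \<rightarrow> carrier N" "f x \<in> carrier N" by auto
      moreover from this have "f \<in> F \<rightarrow> carrier M" "f x \<in> carrier M" using assms(3) by auto
      ultimately show ?case using insert assms(5) by simp
    qed
  next
    case False
    then show ?thesis using assms(4) by (simp add: M.finsum_infinite N.finsum_infinite)
  qed
qed

lemma (in abelian_group) additive_subgroup_iff:
  "additive_subgroup H G \<longleftrightarrow> H \<subseteq> carrier G \<and> \<zero> \<in> H \<and> (\<forall>x\<in>H. \<forall>y\<in>H. x \<oplus> y \<in> H) \<and> (\<forall>x\<in>H. \<ominus> x \<in> H)"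
proof
  assume "additive_subgroup H G"
  then interpret additive_subgroup H G .
  show "H \<subseteq> carrier G \<and> \<zero> \<in> H \<and> (\<forall>x\<in>H. \<forall>y\<in>H. x \<oplus> y \<in> H) \<and> (\<forall>x\<in>H. \<ominus> x \<in> H)"
    using a_subset abelian_group_axioms by (auto simp: additive_subgroup.a_inv_closed[OF additive_subgroup_axioms])
next
  assume "H \<subseteq> carrier G \<and> \<zero> \<in> H \<and> (\<forall>x\<in>H. \<forall>y\<in>H. x \<oplus> y \<in> H) \<and> (\<forall>x\<in>H. \<ominus> x \<in> H)"
  then show "additive_subgroup H G"
    by (intro additive_subgroupI add.subgroupI) (auto simp: a_inv_def)
qed

definition component :: "('m, 'x) ring_scheme \<Rightarrow> ('i \<Rightarrow> 'm set) \<Rightarrow> 'i \<Rightarrow> 'm \<Rightarrow> 'm" where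
  "component M A i x = (THE f. (\<forall>i. f i \<in> A i) \<and> finite {i. f i \<noteq> \<zero>\<^bsub>M\<^esub>} \<and>
        x = (\<Oplus>\<^bsub>M\<^esub>i\<in>{i. f i \<noteq> \<zero>\<^bsub>M\<^esub>}. f i)) i"

locale decomposed_group = abelian_group M for M :: "('m, 'x) ring_scheme" (structure) +
  fixes A :: "'i \<Rightarrow> 'm set"
  assumes decomposition: "internal_direct_sum M A"
begin

lemma part_subgroup: "additive_subgroup (A i) M"
  using decomposition by (simp add: internal_direct_sum_def)

lemma part_carrier: "x \<in> A i \<Longrightarrow> x \<in> carrier M"
  and part_zero [simp]: "\<zero> \<in> A i"
  and part_add: "x \<in> A i \<Longrightarrow> y \<in> A i \<Longrightarrow> x \<oplus> y \<in> A i"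
  and part_neg: "x \<in> A i \<Longrightarrow> \<ominus> x \<in> A i"
  using part_subgroup[of i] by (auto simp: additive_subgroup_iff)

lemma component_props:
  assumes "x \<in> carrier M"
  shows "component M A i x \<in> A i" and "finite {i. component M A i x \<noteq> \<zero>}"
    and "x = (\<Oplus>i\<in>{i. component M A i x \<noteq> \<zero>}. component M A i x)"
proof -
  let ?P = "\<lambda>f. (\<forall>i. f i \<in> A i) \<and> finite {i. f i \<noteq> \<zero>} \<and> x = (\<Oplus>i\<in>{i. f i \<noteq> \<zero>}. f i)"
  have "\<exists>!f. ?P f" using assms decomposition unfolding internal_direct_sum_def by blast
  from theI'[OF this] have "?P (\<lambda>i. component M A i x)" unfolding component_def .
  then show "component M A i x \<in> A i" and "finite {i. component M A i x \<noteq> \<zero>}"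
    and "x = (\<Oplus>i\<in>{i. component M A i x \<noteq> \<zero>}. component M A i x)" by blast+
qed

lemma component_closed [simp, intro]: "x \<in> carrier M \<Longrightarrow> component M A i x \<in> carrier M"
  using component_props(1) part_carrier by blast

lemma component_unique:
  assumes "\<And>i. f i \<in> A i" and "finite J" and "\<And>i. i \<notin> J \<Longrightarrow> f i = \<zero>" and "x = (\<Oplus>i\<in>J. f i)"
  shows "component M A i x = f i"
proof -
  let ?P = "\<lambda>f. (\<forall>i. f i \<in> A i) \<and> finite {i. f i \<noteq> \<zero>} \<and> x = (\<Oplus>i\<in>{i. f i \<noteq> \<zero>}. f i)"
  have fc: "\<And>i. f i \<in> carrier M" using assms(1) part_carrier by blast
  have fin: "finite {i. f i \<noteq> \<zero>}" by (rule finite_subset[OF _ assms(2)]) (use assms(3) in auto)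
  have "finsum M f {i. f i \<noteq> \<zero>} = finsum M f J"
    by (rule finsum_superset) (use assms fc in auto)
  then have P: "?P f" using assms fin by simp
  have "x \<in> carrier M" using assms(4) fc by (simp add: Pi_def)
  then have "\<exists>!f. ?P f" using decomposition unfolding internal_direct_sum_def by blast
  from the1_equality[of ?P f, OF this P] show ?thesis unfolding component_def by simp
qed

lemma component_homogeneous:
  assumes "x \<in> A j"
  shows "component M A i x = (if i = j then x else \<zero>)"
  by (rule component_unique[where J = "{j}"]) (use assms part_carrier in auto)

lemma component_zero [simp]: "component M A i \<zero> = \<zero>"
  using component_homogeneous[of \<zero> i i] by simp

lemma component_add:
  assumes "x \<in> carrier M" and "y \<in> carrier M"
  shows "component M A i (x \<oplus> y) = component M A i x \<oplus> component M A i y"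
proof (rule component_unique)
  let ?c = "\<lambda>z i. component M A i z"
  let ?J = "{i. ?c x i \<noteq> \<zero>} \<union> {i. ?c y i \<noteq> \<zero>}"
  show "finite ?J" using assms component_props by blast
  have "x = finsum M (?c x) ?J" "y = finsum M (?c y) ?J"
    by (subst component_props(3), use assms in blast,
        rule finsum_superset, use assms component_props in auto)+
  then show "x \<oplus> y = (\<Oplus>i\<in>?J. ?c x i \<oplus> ?c y i)"
    using assms by (simp add: finsum_addf)
qed (use assms component_props part_add in auto)

lemma component_hom: "abelian_group_hom M M (component M A i)"
  by (rule additive_map_hom) (auto simp: component_add intro: abelian_group_axioms)

lemma component_neg: "x \<in> carrier M \<Longrightarrow> component M A i (\<ominus> x) = \<ominus> component M A i x"
  using abelian_group_hom.hom_a_inv[OF component_hom] by blast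

lemma component_minus:
  "x \<in> carrier M \<Longrightarrow> y \<in> carrier M \<Longrightarrow> component M A i (x \<ominus> y) = component M A i x \<ominus> component M A i y"
  using abelian_group_hom.hom_minus[OF component_hom] by blast

lemma component_component:
  "x \<in> carrier M \<Longrightarrow> component M A i (component M A j x) = (if i = j then component M A i x else \<zero>)"
  by (simp add: component_homogeneous[OF component_props(1)])

lemma homogeneous_induct [consumes 1, case_names zero add part]:
  assumes "x \<in> carrier M" and "P \<zero>"
    and "\<And>x y. \<lbrakk>x \<in> carrier M; y \<in> carrier M; P x; P y\<rbrakk> \<Longrightarrow> P (x \<oplus> y)"
    and "\<And>i x. x \<in> A i \<Longrightarrow> P x"
  shows "P x"
proof -
  have "P (\<Oplus>i\<in>{i. component M A i x \<noteq> \<zero>}. component M A i x)"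
    by (rule finsum_closed_under) (use assms component_props in blast)+
  then show ?thesis using component_props(3)[OF assms(1)] by simp
qed

lemma additive_in_subgroup:
  assumes "x \<in> carrier M" and "additive_subgroup H M" and "\<And>i. component M A i x \<in> H"
  shows "x \<in> H"
proof -
  have "(\<Oplus>i\<in>{i. component M A i x \<noteq> \<zero>}. component M A i x) \<in> H"
    by (rule finsum_closed_under) (use assms additive_subgroup_iff in auto)
  then show ?thesis using component_props(3)[OF assms(1)] by simp
qed

end

text \<open>Uniqueness of decompositions is witnessed by projections \<open>p i\<close>: applied to \<open>x\<close> they return the
  \<open>i\<close>-th entry of any decomposition of \<open>x\<close>.\<close>

lemma internal_direct_sumI:
  assumes "abelian_group M" and "\<And>i. additive_subgroup (A i) M"
    and c: "\<And>x i. x \<in> carrier M \<Longrightarrow> c x i \<in> A i"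
      "\<And>x. x \<in> carrier M \<Longrightarrow> finite {i. c x i \<noteq> \<zero>\<^bsub>M\<^esub>}"
      "\<And>x. x \<in> carrier M \<Longrightarrow> x = (\<Oplus>\<^bsub>M\<^esub>i\<in>{i. c x i \<noteq> \<zero>\<^bsub>M\<^esub>}. c x i)"
    and hom: "\<And>i. abelian_group_hom M M (p i)"
    and p: "\<And>i j x. x \<in> A j \<Longrightarrow> p i x = (if i = j then x else \<zero>\<^bsub>M\<^esub>)"
  shows "internal_direct_sum M A"
  unfolding internal_direct_sum_def
proof (intro conjI allI ballI ex_ex1I)
  interpret abelian_group M by fact
  show "additive_subgroup (A i) M" for i by fact
  fix x assume x: "x \<in> carrier M"
  show "\<exists>f. (\<forall>i. f i \<in> A i) \<and> finite {i. f i \<noteq> \<zero>\<^bsub>M\<^esub>} \<and> x = (\<Oplus>\<^bsub>M\<^esub>i\<in>{i. f i \<noteq> \<zero>\<^bsub>M\<^esub>}. f i)"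
    proof (intro exI conjI allI)
    show "c x i \<in> A i" for i by (rule c(1)[OF x])
    show "finite {i. c x i \<noteq> \<zero>\<^bsub>M\<^esub>}" by (rule c(2)[OF x])
    show "x = (\<Oplus>\<^bsub>M\<^esub>i\<in>{i. c x i \<noteq> \<zero>\<^bsub>M\<^esub>}. c x i)" by (rule c(3)[OF x])
  qed
  have Asub: "y \<in> A i \<Longrightarrow> y \<in> carrier M" for y i
    using assms(2)[of i] by (auto simp: additive_subgroup_iff)
  have *: "f i = p i x" if f: "(\<forall>i. f i \<in> A i) \<and> finite {i. f i \<noteq> \<zero>\<^bsub>M\<^esub>} \<and> x = (\<Oplus>\<^bsub>M\<^esub>i\<in>{i. f i \<noteq> \<zero>\<^bsub>M\<^esub>}. f i)"
    for f i
  proof -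
    let ?J = "{i. f i \<noteq> \<zero>\<^bsub>M\<^esub>}"
    have fc: "f \<in> X \<rightarrow> carrier M" for X using f Asub by blast
    have "p i x = p i (finsum M f ?J)" using f by simp
    also have "\<dots> = (\<Oplus>\<^bsub>M\<^esub>j\<in>?J. p i (f j))" by (rule abelian_group_hom.hom_finsum[OF hom fc])
    also have "\<dots> = (\<Oplus>\<^bsub>M\<^esub>j\<in>?J. if i = j then f j else \<zero>\<^bsub>M\<^esub>)"
    proof -
      have "p i (f j) = (if i = j then f j else \<zero>\<^bsub>M\<^esub>)" for j using f p[of "f j" j i] by auto
      then show ?thesis by presburger
    qed
    also have "\<dots> = f i"
    proof (cases "i \<in> ?J")
      case True
      then show ?thesis using f fc[of UNIV] by (subst add.finprod_singleton) auto
    next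
      case False
      then have "(\<Oplus>\<^bsub>M\<^esub>j\<in>?J. if i = j then f j else \<zero>\<^bsub>M\<^esub>) = (\<Oplus>\<^bsub>M\<^esub>j\<in>?J. \<zero>\<^bsub>M\<^esub>)"
        by (intro finsum_cong) (auto simp: simp_implies_def)
      then show ?thesis using False by simp
    qed
    finally show ?thesis by simp
  qed
  fix f g
  assume "(\<forall>i. f i \<in> A i) \<and> finite {i. f i \<noteq> \<zero>\<^bsub>M\<^esub>} \<and> x = (\<Oplus>\<^bsub>M\<^esub>i\<in>{i. f i \<noteq> \<zero>\<^bsub>M\<^esub>}. f i)"
    and "(\<forall>i. g i \<in> A i) \<and> finite {i. g i \<noteq> \<zero>\<^bsub>M\<^esub>} \<and> x = (\<Oplus>\<^bsub>M\<^esub>i\<in>{i. g i \<noteq> \<zero>\<^bsub>M\<^esub>}. g i)"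
  from *[OF this(1)] *[OF this(2)] show "f = g" by (intro ext) metis
qed

section \<open>Noncommutative local rings\<close>

locale noncommutative_local_ring = ring S for S :: "('a, 'x) ring_scheme" (structure) +
  assumes local: "local_ring S"
begin

abbreviation "J \<equiv> local_max_ideal S"

lemma left_idealD:
  assumes "left_ideal S I"
  shows "I \<subseteq> carrier S" and "\<zero> \<in> I" and "x \<in> I \<Longrightarrow> y \<in> I \<Longrightarrow> x \<oplus> y \<in> I"
    and "x \<in> I \<Longrightarrow> \<ominus> x \<in> I" and "r \<in> carrier S \<Longrightarrow> x \<in> I \<Longrightarrow> r \<otimes> x \<in> I"
  using assms by (auto simp: left_ideal_def additive_subgroup_iff)

lemma left_idealI:
  assumes "I \<subseteq> carrier S" and "\<zero> \<in> I" and "\<And>x y. x \<in> I \<Longrightarrow> y \<in> I \<Longrightarrow> x \<oplus> y \<in> I"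
    and "\<And>r x. r \<in> carrier S \<Longrightarrow> x \<in> I \<Longrightarrow> r \<otimes> x \<in> I"
  shows "left_ideal S I"
proof -
  have "\<ominus> x \<in> I" if "x \<in> I" for x
  proof -
    have "\<ominus> \<one> \<otimes> x \<in> I" using assms(4)[of "\<ominus> \<one>" x] that by simp
    moreover have "\<ominus> \<one> \<otimes> x = \<ominus> x" using assms(1) that by (simp add: l_minus subset_iff)
    ultimately show ?thesis by simp
  qed
  then show ?thesis using assms by (auto simp: left_ideal_def additive_subgroup_iff)
qed

lemma J_maximal: "maximal_left_ideal S J"
  using local theI'[of "maximal_left_ideal S"] unfolding local_ring_def local_max_ideal_def by blast

lemma J_unique: "maximal_left_ideal S I \<Longrightarrow> I = J"
  using local J_maximal unfolding local_ring_def by blast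

lemma J_left_ideal: "left_ideal S J"
  using J_maximal by (simp add: maximal_left_ideal_def)

lemmas J_carrier = left_idealD(1)[OF J_left_ideal, THEN subsetD]
lemmas J_zero = left_idealD(2)[OF J_left_ideal]
lemmas J_add = left_idealD(3)[OF J_left_ideal]
lemmas J_mult_left = left_idealD(5)[OF J_left_ideal]

lemma left_ideal_one:
  assumes "left_ideal S I" and "\<one> \<in> I"
  shows "I = carrier S"
  using left_idealD[OF assms(1)] assms(2) by (metis r_one subsetI subset_antisym)

lemma one_notin_J: "\<one> \<notin> J"
  using J_maximal left_ideal_one unfolding maximal_left_ideal_def by blast

text \<open>Zorn: a proper left ideal lies in a maximal one, and there is only one.\<close>

lemma proper_left_ideal_subset_J:
  assumes I: "left_ideal S I" and "\<one> \<notin> I"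
  shows "I \<subseteq> J"
proof -
  let ?A = "{K. left_ideal S K \<and> I \<subseteq> K \<and> \<one> \<notin> K}"
  have "\<exists>M\<in>?A. \<forall>X\<in>?A. M \<subseteq> X \<longrightarrow> X = M"
  proof (rule subset_Zorn_nonempty)
    show "?A \<noteq> {}" using assms by blast
    fix C assume C: "C \<noteq> {}" "subset.chain ?A C"
    then have CA: "\<And>K. K \<in> C \<Longrightarrow> left_ideal S K \<and> I \<subseteq> K \<and> \<one> \<notin> K"
      and ch: "\<And>K L. K \<in> C \<Longrightarrow> L \<in> C \<Longrightarrow> K \<subseteq> L \<or> L \<subseteq> K"
      by (auto simp: subset_chain_def)
    have "left_ideal S (\<Union>C)"
    proof (rule left_idealI)
      show "\<Union>C \<subseteq> carrier S" using CA left_idealD(1) by blast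
      show "\<zero> \<in> \<Union>C" using C(1) CA left_idealD(2) by blast
      fix x y assume "x \<in> \<Union>C" "y \<in> \<Union>C"
      then obtain K where "K \<in> C" "x \<in> K" "y \<in> K" using ch by blast
      then show "x \<oplus> y \<in> \<Union>C" using CA left_idealD(3) by blast
    next
      fix r x assume "r \<in> carrier S" "x \<in> \<Union>C"
      then show "r \<otimes> x \<in> \<Union>C" using CA left_idealD(5) by blast
    qed
    then show "\<Union>C \<in> ?A" using C(1) CA by blast
  qed
  then obtain M where "M \<in> ?A" and max': "\<forall>X\<in>?A. M \<subseteq> X \<longrightarrow> X = M" by (elim bexE)
  then have M: "left_ideal S M" "I \<subseteq> M" "\<one> \<notin> M" by simp_all
  have max: "X = M" if "left_ideal S X" "I \<subseteq> X" "\<one> \<notin> X" "M \<subseteq> X" for X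
    using max'[rule_format, of X] that by simp
  have "maximal_left_ideal S M"
    unfolding maximal_left_ideal_def
  proof (intro conjI allI impI)
    show "M \<noteq> carrier S" using M(3) by blast
    fix K assume K: "left_ideal S K" "M \<subseteq> K"
    show "K = M \<or> K = carrier S"
    proof (cases "\<one> \<in> K")
      case True
      then show ?thesis using left_ideal_one K by blast
    next
      case False
      then show ?thesis using max K M(2) by blast
    qed
  qed fact
  then show ?thesis using J_unique M(2) by blast
qed

lemma left_inverse:
  assumes "x \<in> carrier S" and "x \<notin> J"
  obtains y where "y \<in> carrier S" and "y \<otimes> x = \<one>"
proof -
  let ?I = "(\<lambda>r. r \<otimes> x) ` carrier S"
  have "left_ideal S ?I"
  proof (rule left_idealI)
    show "?I \<subseteq> carrier S" using assms(1) by auto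
    show "\<zero> \<in> ?I" using assms(1) by (intro image_eqI[of _ _ \<zero>]) auto
    show "u \<oplus> v \<in> ?I" if "u \<in> ?I" "v \<in> ?I" for u v
      using that assms(1) by (auto simp: l_distr[symmetric])
    show "r \<otimes> u \<in> ?I" if "r \<in> carrier S" "u \<in> ?I" for r u
      using that assms(1) by (auto simp: m_assoc[symmetric])
  qed
  moreover have "x \<in> ?I" using assms(1) by (intro image_eqI[of _ _ \<one>]) auto
  ultimately have "\<one> \<in> ?I" using proper_left_ideal_subset_J assms(2) by blast
  then show ?thesis using that by (metis imageE)
qed

text \<open>If some \<open>z r\<close> with \<open>z \<in> J\<close> were left invertible, say \<open>w (z r) = 1\<close>, then \<open>e = r w z\<close> would be an
  idempotent of \<open>J\<close>; as \<open>1 - e \<notin> J\<close> is left invertible and kills \<open>e\<close>, this forces \<open>e = 0\<close> and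
  \<open>1 = (w z r)(w z r) = w z e r = 0\<close>.\<close>

lemma J_mult_right:
  assumes z: "z \<in> J" and r: "r \<in> carrier S"
  shows "z \<otimes> r \<in> J"
proof (rule ccontr)
  assume "z \<otimes> r \<notin> J"
  have zc: "z \<in> carrier S" using J_carrier z by blast
  obtain w where w: "w \<in> carrier S" "w \<otimes> (z \<otimes> r) = \<one>"
    using left_inverse[of "z \<otimes> r"] \<open>z \<otimes> r \<notin> J\<close> zc r by auto
  define e where "e = r \<otimes> w \<otimes> z"
  have ec: "e \<in> carrier S" using w r zc by (simp add: e_def)
  have eJ: "e \<in> J" unfolding e_def using J_mult_left[of "r \<otimes> w" z] w r z by simp
  have "e \<otimes> e = r \<otimes> (w \<otimes> (z \<otimes> r)) \<otimes> (w \<otimes> z)"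
    using w(1) r zc by (simp add: e_def m_assoc)
  then have ee: "e \<otimes> e = e" using w r zc by (simp add: e_def m_assoc)
  have "\<one> \<ominus> e \<notin> J"
  proof
    assume "\<one> \<ominus> e \<in> J"
    then have "(\<one> \<ominus> e) \<oplus> e \<in> J" using J_add eJ by blast
    then show False using one_notin_J ec by (simp add: a_minus_def a_assoc l_neg)
  qed
  then obtain u where u: "u \<in> carrier S" "u \<otimes> (\<one> \<ominus> e) = \<one>"
    using left_inverse[of "\<one> \<ominus> e"] ec by auto
  have "(\<one> \<ominus> e) \<otimes> e = e \<ominus> e \<otimes> e"
    using ec by (simp add: a_minus_def l_distr l_minus)
  then have k: "(\<one> \<ominus> e) \<otimes> e = \<zero>" using ee ec by (simp add: a_minus_def r_neg)
  have "e = (u \<otimes> (\<one> \<ominus> e)) \<otimes> e" using u(2) ec by simp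
  also have "\<dots> = u \<otimes> ((\<one> \<ominus> e) \<otimes> e)" using u(1) ec by (intro m_assoc) auto
  finally have e0: "e = \<zero>" using u(1) k by simp
  have "\<one> = (w \<otimes> (z \<otimes> r)) \<otimes> (w \<otimes> (z \<otimes> r))" using w(2) by simp
  also have "\<dots> = w \<otimes> z \<otimes> e \<otimes> r" using w(1) r zc by (simp add: e_def m_assoc)
  also have "\<dots> = \<zero>" using e0 w(1) zc r by simp
  finally show False using one_notin_J J_zero by simp
qed

text \<open>The left inverse is itself outside the two-sided ideal \<open>J\<close>, hence left invertible, and then its left
  inverse must be \<open>x\<close>.\<close>

lemma unit_outside_J:
  assumes "x \<in> carrier S" and "x \<notin> J"
  obtains y where "y \<in> carrier S" and "y \<otimes> x = \<one>" and "x \<otimes> y = \<one>"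
proof -
  obtain y where y: "y \<in> carrier S" "y \<otimes> x = \<one>" using left_inverse assms by blast
  have "y \<notin> J" using J_mult_right[of y x] y assms(1) one_notin_J by auto
  then obtain v where v: "v \<in> carrier S" "v \<otimes> y = \<one>" using left_inverse y(1) by blast
  have "v = v \<otimes> (y \<otimes> x)" using y v by simp
  also have "\<dots> = x" using v y(1) assms(1) by (simp add: m_assoc[symmetric])
  finally have "x \<otimes> y = \<one>" using v by simp
  then show ?thesis using that y by blast
qed

end


section \<open>Graded local rings\<close>

sublocale graded_ring \<subseteq> ring_parts: decomposed_group R "rpart R"
  by unfold_locales (rule rpart_direct_sum)

context graded_ring
begin

abbreviation rcomp :: "nat \<Rightarrow> 'a \<Rightarrow> 'a" where "rcomp \<equiv> component R (rpart R)"

lemma deg_zero_simps [simp]: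
  "carrier (deg_zero R) = rpart R 0" "\<one>\<^bsub>deg_zero R\<^esub> = \<one>" "\<zero>\<^bsub>deg_zero R\<^esub> = \<zero>"
  "add (deg_zero R) = add R" "mult (deg_zero R) = mult R"
  by (simp_all add: deg_zero_def)

lemma rpart_zero_mult: "x \<in> rpart R 0 \<Longrightarrow> y \<in> rpart R 0 \<Longrightarrow> x \<otimes> y \<in> rpart R 0"
  using mult_rpart[of x 0 y 0] by simp

lemma deg_zero_ring: "ring (deg_zero R)"
proof (rule ringI)
  note c = ring_parts.part_carrier
  show "abelian_group (deg_zero R)"
  proof (rule abelian_groupI)
    fix x assume "x \<in> carrier (deg_zero R)"
    then show "\<exists>y\<in>carrier (deg_zero R). y \<oplus>\<^bsub>deg_zero R\<^esub> x = \<zero>\<^bsub>deg_zero R\<^esub>"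
      by (intro bexI[of _ "\<ominus> x"]) (auto simp: l_neg c ring_parts.part_neg)
  qed (auto simp: ring_parts.part_add c a_ac)
  show "monoid (deg_zero R)"
    by (rule monoidI) (auto simp: one_rpart rpart_zero_mult c m_assoc)
qed (auto simp: ring_parts.part_carrier l_distr r_distr)

lemma rcomp_zero_mult:
  assumes "x \<in> carrier R" and "y \<in> carrier R"
  shows "rcomp 0 (x \<otimes> y) = rcomp 0 x \<otimes> rcomp 0 y"
  using assms(1)
proof (induction rule: ring_parts.homogeneous_induct)
  case zero
  then show ?case using assms by simp
next
  case (add u v)
  then show ?case using assms(2) by (simp add: l_distr ring_parts.component_add)
next
  case (part i u)
  then have u: "u \<in> carrier R" by (rule ring_parts.part_carrier)
  show ?case using assms(2)
  proof (induction rule: ring_parts.homogeneous_induct)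
    case zero
    then show ?case using u by simp
  next
    case (add v w)
    then show ?case using u by (simp add: r_distr ring_parts.component_add)
  next
    case (part j v)
    then have "u \<otimes> v \<in> rpart R (i + j)" "v \<in> carrier R"
      using \<open>u \<in> rpart R i\<close> mult_rpart ring_parts.part_carrier by auto
    then show ?case using u part \<open>u \<in> rpart R i\<close>
      by (auto simp: ring_parts.component_homogeneous)
  qed
qed

lemma rcomp_zero_part: "x \<in> rpart R 0 \<Longrightarrow> rcomp 0 x = x"
  using ring_parts.component_homogeneous[of x 0 0] by simp

lemma positive_part_iff: "x \<in> positive_part R \<longleftrightarrow> x \<in> carrier R \<and> rcomp 0 x = \<zero>"
proof -
  let ?K = "{x \<in> carrier R. rcomp 0 x = \<zero>}"
  have "positive_part R = ?K"
    unfolding positive_part_def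
  proof (rule hull_unique)
    show "(\<Union>i\<in>{0<..}. rpart R i) \<subseteq> ?K"
      by (auto simp: ring_parts.part_carrier ring_parts.component_homogeneous)
    show "additive_subgroup ?K R"
      by (auto simp: additive_subgroup_iff ring_parts.component_add ring_parts.component_neg)
    fix H assume H: "(\<Union>i\<in>{0<..}. rpart R i) \<subseteq> H" "additive_subgroup H R"
    show "?K \<subseteq> H"
    proof
      fix x assume x: "x \<in> ?K"
      show "x \<in> H"
      proof (rule ring_parts.additive_in_subgroup)
        show "rcomp i x \<in> H" for i
          using H x additive_subgroup.zero_closed[OF H(2)]
          by (cases i) (use ring_parts.component_props(1)[of x i] in auto)
      qed (use x H in auto)
    qed
  qed
  then show ?thesis by blast
qed

end

locale local_graded_ring = graded_ring R for R :: "('a, 'x) gr_ring_scheme" (structure) +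
  assumes deg_zero_local: "local_ring (deg_zero R)"

sublocale local_graded_ring \<subseteq> R0: noncommutative_local_ring "deg_zero R"
  by (intro noncommutative_local_ring.intro noncommutative_local_ring_axioms.intro
      deg_zero_ring deg_zero_local)

context local_graded_ring
begin

abbreviation m0 :: "'a set" where "m0 \<equiv> local_max_ideal (deg_zero R)"
abbreviation mm :: "'a set" where "mm \<equiv> graded_max_ideal R"

lemma m0_carrier: "x \<in> m0 \<Longrightarrow> x \<in> rpart R 0"
  using R0.J_carrier by simp

lemma m0_closed: "x \<in> m0 \<Longrightarrow> x \<in> carrier R"
  using m0_carrier ring_parts.part_carrier by blast

lemma mm_iff: "x \<in> mm \<longleftrightarrow> x \<in> carrier R \<and> rcomp 0 x \<in> m0"
proof
  assume "x \<in> mm"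
  then obtain u v where "u \<in> m0" "v \<in> positive_part R" "x = u \<oplus> v"
    unfolding graded_max_ideal_def set_add_def' by blast
  moreover from this have "rcomp 0 u = u"
    using m0_carrier by (simp add: rcomp_zero_part)
  ultimately show "x \<in> carrier R \<and> rcomp 0 x \<in> m0"
    using m0_closed by (auto simp: positive_part_iff ring_parts.component_add)
next
  assume x: "x \<in> carrier R \<and> rcomp 0 x \<in> m0"
  have c: "rcomp 0 x \<in> carrier R" using x by blast
  have "x \<ominus> rcomp 0 x \<in> positive_part R"
    using x c by (simp add: positive_part_iff ring_parts.component_add ring_parts.component_neg
        ring_parts.component_component a_minus_def r_neg)
  moreover have "x = rcomp 0 x \<oplus> (x \<ominus> rcomp 0 x)"
    using x c by (simp add: add_minus_cancel)
  ultimately show "x \<in> mm" using x unfolding graded_max_ideal_def set_add_def' by blast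
qed

lemma mm_closed: "x \<in> mm \<Longrightarrow> x \<in> carrier R"
  by (simp add: mm_iff)

lemma mm_zero: "\<zero> \<in> mm"
  using R0.J_zero by (simp add: mm_iff)

lemma mm_add: "x \<in> mm \<Longrightarrow> y \<in> mm \<Longrightarrow> x \<oplus> y \<in> mm"
  using R0.J_add by (simp add: mm_iff ring_parts.component_add)

lemma mm_mult_left: "r \<in> carrier R \<Longrightarrow> x \<in> mm \<Longrightarrow> r \<otimes> x \<in> mm"
  using R0.J_mult_left ring_parts.component_props(1)[of r 0] by (simp add: mm_iff rcomp_zero_mult)

lemma mm_mult_right: "x \<in> mm \<Longrightarrow> r \<in> carrier R \<Longrightarrow> x \<otimes> r \<in> mm"
  using R0.J_mult_right ring_parts.component_props(1)[of r 0] by (simp add: mm_iff rcomp_zero_mult)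

lemma one_notin_mm: "\<one> \<notin> mm"
  using R0.one_notin_J one_rpart by (simp add: mm_iff ring_parts.component_homogeneous)

lemma one_neq_zero: "\<one> \<noteq> \<zero>"
  using one_notin_mm mm_zero by auto

lemma m0_subset_mm: "x \<in> m0 \<Longrightarrow> x \<in> mm"
  using m0_carrier m0_closed by (simp add: mm_iff rcomp_zero_part)

lemma rpart_pos_subset_mm: "x \<in> rpart R i \<Longrightarrow> i \<noteq> 0 \<Longrightarrow> x \<in> mm"
  using ring_parts.part_carrier R0.J_zero by (simp add: mm_iff ring_parts.component_homogeneous)

text \<open>Outside \<open>\<mm>\<close> the degree zero component is a unit, so up to \<open>\<mm>\<close> every such element is
  invertible.\<close>

lemma unit_modulo_mm:
  assumes "c \<in> carrier R" and "c \<notin> mm"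
  obtains v where "v \<in> carrier R" and "\<one> \<ominus> v \<otimes> c \<in> mm"
proof -
  have c0: "rcomp 0 c \<in> rpart R 0" "rcomp 0 c \<notin> m0"
    using assms ring_parts.component_props(1) by (auto simp: mm_iff)
  then obtain v where v: "v \<in> rpart R 0" "v \<otimes> rcomp 0 c = \<one>"
    using R0.unit_outside_J[of "rcomp 0 c"] by auto
  have vc: "v \<in> carrier R" using v ring_parts.part_carrier by blast
  have "rcomp 0 (\<one> \<ominus> v \<otimes> c) = \<one> \<ominus> v \<otimes> rcomp 0 c"
    using vc v assms(1) one_rpart
    by (simp add: ring_parts.component_minus rcomp_zero_mult ring_parts.component_homogeneous)
  then have "\<one> \<ominus> v \<otimes> c \<in> mm"
    using vc v assms(1) R0.J_zero by (simp add: mm_iff a_minus_def r_neg)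
  then show ?thesis using that vc by blast
qed

lemma one_minus_m0_unit:
  assumes "c \<in> m0"
  obtains v where "v \<in> rpart R 0" and "v \<otimes> (\<one> \<ominus> c) = \<one>"
proof -
  have cc: "c \<in> carrier R" "c \<in> rpart R 0" using assms m0_closed m0_carrier by auto
  have "\<one> \<ominus> c \<notin> m0"
  proof
    assume "\<one> \<ominus> c \<in> m0"
    then have "(\<one> \<ominus> c) \<oplus> c \<in> m0" using R0.J_add assms by auto
    then show False using R0.one_notin_J cc by (simp add: a_minus_def a_assoc l_neg)
  qed
  moreover have "\<one> \<ominus> c \<in> rpart R 0"
    using cc one_rpart by (simp add: a_minus_def ring_parts.part_add ring_parts.part_neg)
  ultimately show ?thesis using that R0.unit_outside_J[of "\<one> \<ominus> c"] by auto
qed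

end

section \<open>Graded modules and their homomorphisms\<close>

lemma set_addI: "h \<in> H \<Longrightarrow> k \<in> K \<Longrightarrow> h \<oplus>\<^bsub>M\<^esub> k \<in> H <+>\<^bsub>M\<^esub> K"
  by (auto simp: set_add_def')

lemma set_addE:
  assumes "x \<in> H <+>\<^bsub>M\<^esub> K"
  obtains h k where "h \<in> H" and "k \<in> K" and "x = h \<oplus>\<^bsub>M\<^esub> k"
  using assms by (auto simp: set_add_def')


context left_module
begin

lemma smult_zero_left [simp]: "x \<in> carrier M \<Longrightarrow> \<zero> \<odot>\<^bsub>M\<^esub> x = \<zero>\<^bsub>M\<^esub>"
  using smult_l_distr[of \<zero> \<zero> x] M.add.l_cancel_one[of "\<zero> \<odot>\<^bsub>M\<^esub> x" "\<zero> \<odot>\<^bsub>M\<^esub> x"] by auto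

lemma smult_zero_right [simp]: "r \<in> carrier R \<Longrightarrow> r \<odot>\<^bsub>M\<^esub> \<zero>\<^bsub>M\<^esub> = \<zero>\<^bsub>M\<^esub>"
  using smult_r_distr[of r "\<zero>\<^bsub>M\<^esub>" "\<zero>\<^bsub>M\<^esub>"]
    M.add.l_cancel_one[of "r \<odot>\<^bsub>M\<^esub> \<zero>\<^bsub>M\<^esub>" "r \<odot>\<^bsub>M\<^esub> \<zero>\<^bsub>M\<^esub>"] by auto

lemma smult_neg_left:
  assumes "r \<in> carrier R" and "x \<in> carrier M"
  shows "(\<ominus> r) \<odot>\<^bsub>M\<^esub> x = \<ominus>\<^bsub>M\<^esub> (r \<odot>\<^bsub>M\<^esub> x)"
proof -
  have "(\<ominus> r) \<odot>\<^bsub>M\<^esub> x \<oplus>\<^bsub>M\<^esub> r \<odot>\<^bsub>M\<^esub> x = \<zero>\<^bsub>M\<^esub>"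
    using assms by (simp add: smult_l_distr[symmetric] R.l_neg)
  then show ?thesis using assms M.minus_equality by simp
qed

lemma smult_neg_right:
  assumes "r \<in> carrier R" and "x \<in> carrier M"
  shows "r \<odot>\<^bsub>M\<^esub> (\<ominus>\<^bsub>M\<^esub> x) = \<ominus>\<^bsub>M\<^esub> (r \<odot>\<^bsub>M\<^esub> x)"
proof -
  have "r \<odot>\<^bsub>M\<^esub> (\<ominus>\<^bsub>M\<^esub> x) \<oplus>\<^bsub>M\<^esub> r \<odot>\<^bsub>M\<^esub> x = \<zero>\<^bsub>M\<^esub>"
    using assms by (simp add: smult_r_distr[symmetric] M.l_neg)
  then show ?thesis using assms M.minus_equality by simp
qed

lemma smult_minus_left:
  "\<lbrakk>r \<in> carrier R; s \<in> carrier R; x \<in> carrier M\<rbrakk> \<Longrightarrow> (r \<ominus> s) \<odot>\<^bsub>M\<^esub> x = r \<odot>\<^bsub>M\<^esub> x \<ominus>\<^bsub>M\<^esub> s \<odot>\<^bsub>M\<^esub> x"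
  by (simp add: R.minus_eq M.minus_eq smult_l_distr smult_neg_left)

lemma smult_finsum:
  assumes "r \<in> carrier R" and "f \<in> A \<rightarrow> carrier M"
  shows "r \<odot>\<^bsub>M\<^esub> (\<Oplus>\<^bsub>M\<^esub>i\<in>A. f i) = (\<Oplus>\<^bsub>M\<^esub>i\<in>A. r \<odot>\<^bsub>M\<^esub> f i)"
proof -
  have "abelian_group_hom M M (\<lambda>x. r \<odot>\<^bsub>M\<^esub> x)"
    by (rule additive_map_hom) (use assms in \<open>auto simp: smult_r_distr intro: M.abelian_group_axioms\<close>)
  from abelian_group_hom.hom_finsum[OF this assms(2)] show ?thesis .
qed

lemma finsum_smult:
  assumes "x \<in> carrier M" and "f \<in> A \<rightarrow> carrier R"
  shows "(\<Oplus>i\<in>A. f i) \<odot>\<^bsub>M\<^esub> x = (\<Oplus>\<^bsub>M\<^esub>i\<in>A. f i \<odot>\<^bsub>M\<^esub> x)"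
proof -
  have "abelian_group_hom R M (\<lambda>r. r \<odot>\<^bsub>M\<^esub> x)"
    by (rule additive_map_hom)
      (use assms in \<open>auto simp: smult_l_distr intro: M.abelian_group_axioms R.abelian_group_axioms\<close>)
  from abelian_group_hom.hom_finsum[OF this assms(2)] show ?thesis .
qed

lemma submodule_iff:
  "submodule H R M \<longleftrightarrow> H \<subseteq> carrier M \<and> \<zero>\<^bsub>M\<^esub> \<in> H \<and> (\<forall>x\<in>H. \<forall>y\<in>H. x \<oplus>\<^bsub>M\<^esub> y \<in> H) \<and>
     (\<forall>r\<in>carrier R. \<forall>x\<in>H. r \<odot>\<^bsub>M\<^esub> x \<in> H)" (is "?L \<longleftrightarrow> ?R")
proof
  assume ?L
  then interpret submodule H R M .
  show ?R using subset one_closed m_closed by auto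
next
  assume H: ?R
  have "\<ominus>\<^bsub>M\<^esub> x \<in> H" if "x \<in> H" for x
  proof -
    have "(\<ominus> \<one>) \<odot>\<^bsub>M\<^esub> x \<in> H" using H that by simp
    moreover have "x \<in> carrier M" using H that by blast
    ultimately show ?thesis by (simp add: smult_neg_left)
  qed
  then have "additive_subgroup H M" using H by (simp add: M.additive_subgroup_iff)
  then show ?L using H
    by (auto simp: submodule_def submodule_axioms_def additive_subgroup_def)
qed

lemma submoduleI:
  assumes "H \<subseteq> carrier M" and "\<zero>\<^bsub>M\<^esub> \<in> H" and "\<And>x y. x \<in> H \<Longrightarrow> y \<in> H \<Longrightarrow> x \<oplus>\<^bsub>M\<^esub> y \<in> H"
    and "\<And>r x. r \<in> carrier R \<Longrightarrow> x \<in> H \<Longrightarrow> r \<odot>\<^bsub>M\<^esub> x \<in> H"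
  shows "submodule H R M"
  using assms by (simp add: submodule_iff)

lemma submoduleD:
  assumes "submodule H R M"
  shows "additive_subgroup H M" and "x \<in> H \<Longrightarrow> x \<in> carrier M" and "\<zero>\<^bsub>M\<^esub> \<in> H"
    and "x \<in> H \<Longrightarrow> y \<in> H \<Longrightarrow> x \<oplus>\<^bsub>M\<^esub> y \<in> H" and "r \<in> carrier R \<Longrightarrow> x \<in> H \<Longrightarrow> r \<odot>\<^bsub>M\<^esub> x \<in> H"
    and "x \<in> H \<Longrightarrow> \<ominus>\<^bsub>M\<^esub> x \<in> H" and "x \<in> H \<Longrightarrow> y \<in> H \<Longrightarrow> x \<ominus>\<^bsub>M\<^esub> y \<in> H"
proof -
  show *: "additive_subgroup H M" using assms by (simp add: submodule_def additive_subgroup_def)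
  show "x \<in> H \<Longrightarrow> x \<in> carrier M" and "\<zero>\<^bsub>M\<^esub> \<in> H"
    and "x \<in> H \<Longrightarrow> y \<in> H \<Longrightarrow> x \<oplus>\<^bsub>M\<^esub> y \<in> H" and "r \<in> carrier R \<Longrightarrow> x \<in> H \<Longrightarrow> r \<odot>\<^bsub>M\<^esub> x \<in> H"
    using assms by (auto simp: submodule_iff)
  show "x \<in> H \<Longrightarrow> \<ominus>\<^bsub>M\<^esub> x \<in> H" and "x \<in> H \<Longrightarrow> y \<in> H \<Longrightarrow> x \<ominus>\<^bsub>M\<^esub> y \<in> H"
    using * by (auto simp: M.additive_subgroup_iff M.minus_eq)
qed

lemma submodule_carrier: "submodule (carrier M) R M"
  by (rule submoduleI) auto

lemma submodule_finsum:
  assumes "submodule H R M" and "\<And>i. i \<in> A \<Longrightarrow> f i \<in> H"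
  shows "(\<Oplus>\<^bsub>M\<^esub>i\<in>A. f i) \<in> H"
  by (rule M.finsum_closed_under) (use assms submoduleD[OF assms(1)] in auto)

lemma submodule_span_submodule:
  assumes "S \<subseteq> carrier M"
  shows "submodule (submodule_span R M S) R M"
  unfolding submodule_span_def hull_def
  using assms submodule_carrier by (intro submoduleI) (auto simp: submodule_iff)

lemma span_subset: "x \<in> S \<Longrightarrow> x \<in> submodule_span R M S"
  unfolding submodule_span_def by (rule hull_inc)

lemma span_minimal: "\<lbrakk>submodule H R M; S \<subseteq> H; x \<in> submodule_span R M S\<rbrakk> \<Longrightarrow> x \<in> H"
  unfolding submodule_span_def using hull_minimal[of S H "\<lambda>N. submodule N R M"] by blast

lemma span_closed: "\<lbrakk>S \<subseteq> carrier M; x \<in> submodule_span R M S\<rbrakk> \<Longrightarrow> x \<in> carrier M"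
  using submodule_span_submodule submoduleD(2) by blast

lemma span_mono: "S \<subseteq> T \<Longrightarrow> submodule_span R M S \<subseteq> submodule_span R M T"
  unfolding submodule_span_def by (rule hull_mono)

lemma in_spanE:
  assumes "S \<subseteq> carrier M" and "x \<in> submodule_span R M S"
  obtains A c where "finite A" and "A \<subseteq> S" and "c \<in> A \<rightarrow> carrier R"
    and "x = (\<Oplus>\<^bsub>M\<^esub>s\<in>A. c s \<odot>\<^bsub>M\<^esub> s)"
proof -
  let ?H = "{x. \<exists>A c. finite A \<and> A \<subseteq> S \<and> c \<in> A \<rightarrow> carrier R \<and> x = (\<Oplus>\<^bsub>M\<^esub>s\<in>A. c s \<odot>\<^bsub>M\<^esub> s)}"
  have cl: "(\<lambda>s. c s \<odot>\<^bsub>M\<^esub> s) \<in> A \<rightarrow> carrier M" if "A \<subseteq> S" "c \<in> A \<rightarrow> carrier R" for A c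
    using that assms(1) by blast
  have "submodule ?H R M"
  proof (rule submoduleI)
    show "?H \<subseteq> carrier M" using cl by auto
    show "\<zero>\<^bsub>M\<^esub> \<in> ?H" by (intro CollectI exI[of _ "{}"]) auto
    fix x y assume "x \<in> ?H" "y \<in> ?H"
    then obtain A c B d where A: "finite A" "A \<subseteq> S" "c \<in> A \<rightarrow> carrier R" "x = (\<Oplus>\<^bsub>M\<^esub>s\<in>A. c s \<odot>\<^bsub>M\<^esub> s)"
      and B: "finite B" "B \<subseteq> S" "d \<in> B \<rightarrow> carrier R" "y = (\<Oplus>\<^bsub>M\<^esub>s\<in>B. d s \<odot>\<^bsub>M\<^esub> s)" by blast
    define c' where "c' s = (if s \<in> A then c s else \<zero>)" for s
    define d' where "d' s = (if s \<in> B then d s else \<zero>)" for s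
    have c': "c' \<in> A \<union> B \<rightarrow> carrier R" and d': "d' \<in> A \<union> B \<rightarrow> carrier R"
      using A(3) B(3) by (auto simp: c'_def d'_def)
    have "x = (\<Oplus>\<^bsub>M\<^esub>s\<in>A. c' s \<odot>\<^bsub>M\<^esub> s)"
      unfolding A(4) using cl[OF A(2,3)] by (intro M.finsum_cong') (auto simp: c'_def)
    also have "\<dots> = (\<Oplus>\<^bsub>M\<^esub>s\<in>A \<union> B. c' s \<odot>\<^bsub>M\<^esub> s)"
    proof (rule M.finsum_superset)
      show "finite (A \<union> B)" "A \<subseteq> A \<union> B" using A(1) B(1) by auto
      show "c' s \<odot>\<^bsub>M\<^esub> s = \<zero>\<^bsub>M\<^esub>" if "s \<in> A \<union> B - A" for s
        using that B(2) assms(1) by (auto simp: c'_def subset_iff)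
      show "(\<lambda>s. c' s \<odot>\<^bsub>M\<^esub> s) \<in> A \<rightarrow> carrier M" using cl[OF A(2)] c' by auto
    qed
    finally have x: "x = (\<Oplus>\<^bsub>M\<^esub>s\<in>A \<union> B. c' s \<odot>\<^bsub>M\<^esub> s)" .
    have "y = (\<Oplus>\<^bsub>M\<^esub>s\<in>B. d' s \<odot>\<^bsub>M\<^esub> s)"
      unfolding B(4) using cl[OF B(2,3)] by (intro M.finsum_cong') (auto simp: d'_def)
    also have "\<dots> = (\<Oplus>\<^bsub>M\<^esub>s\<in>A \<union> B. d' s \<odot>\<^bsub>M\<^esub> s)"
    proof (rule M.finsum_superset)
      show "finite (A \<union> B)" "B \<subseteq> A \<union> B" using A(1) B(1) by auto
      show "d' s \<odot>\<^bsub>M\<^esub> s = \<zero>\<^bsub>M\<^esub>" if "s \<in> A \<union> B - B" for s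
        using that A(2) assms(1) by (auto simp: d'_def subset_iff)
      show "(\<lambda>s. d' s \<odot>\<^bsub>M\<^esub> s) \<in> B \<rightarrow> carrier M" using cl[OF B(2)] d' by auto
    qed
    finally have y: "y = (\<Oplus>\<^bsub>M\<^esub>s\<in>A \<union> B. d' s \<odot>\<^bsub>M\<^esub> s)" .
    have AB: "A \<union> B \<subseteq> S" using A B by blast
    have "x \<oplus>\<^bsub>M\<^esub> y = (\<Oplus>\<^bsub>M\<^esub>s\<in>A \<union> B. c' s \<odot>\<^bsub>M\<^esub> s \<oplus>\<^bsub>M\<^esub> d' s \<odot>\<^bsub>M\<^esub> s)"
      unfolding x y by (rule M.finsum_addf[symmetric]) (intro cl[OF AB] c' d')+
    also have "\<dots> = (\<Oplus>\<^bsub>M\<^esub>s\<in>A \<union> B. (c' s \<oplus> d' s) \<odot>\<^bsub>M\<^esub> s)"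
      using c' d' AB assms(1) by (intro M.finsum_cong') (auto simp: smult_l_distr Pi_iff subset_iff)
    finally show "x \<oplus>\<^bsub>M\<^esub> y \<in> ?H" using AB c' d' A(1) B(1)
      by (intro CollectI exI[of _ "A \<union> B"] exI[of _ "\<lambda>s. c' s \<oplus> d' s"]) auto
  next
    fix r x assume r: "r \<in> carrier R" and "x \<in> ?H"
    then obtain A c where A: "finite A" "A \<subseteq> S" "c \<in> A \<rightarrow> carrier R" "x = (\<Oplus>\<^bsub>M\<^esub>s\<in>A. c s \<odot>\<^bsub>M\<^esub> s)"
      by blast
    have "r \<odot>\<^bsub>M\<^esub> x = (\<Oplus>\<^bsub>M\<^esub>s\<in>A. r \<odot>\<^bsub>M\<^esub> (c s \<odot>\<^bsub>M\<^esub> s))"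
      unfolding A(4) by (rule smult_finsum[OF r cl[OF A(2,3)]])
    also have "\<dots> = (\<Oplus>\<^bsub>M\<^esub>s\<in>A. (r \<otimes> c s) \<odot>\<^bsub>M\<^esub> s)"
      using A assms(1) r by (intro M.finsum_cong') (auto simp: smult_assoc Pi_iff subset_iff)
    finally show "r \<odot>\<^bsub>M\<^esub> x \<in> ?H" using A r
      by (intro CollectI exI[of _ A] exI[of _ "\<lambda>s. r \<otimes> c s"]) auto
  qed
  moreover have "S \<subseteq> ?H"
  proof
    fix s assume "s \<in> S"
    then show "s \<in> ?H" using assms(1)
      by (intro CollectI exI[of _ "{s}"] exI[of _ "\<lambda>_. \<one>"]) auto
  qed
  ultimately have "x \<in> ?H" using span_minimal assms(2) by blast
  then show ?thesis using that by blast
qed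

lemma submodule_set_add:
  assumes "submodule H R M" and "submodule K R M"
  shows "submodule (H <+>\<^bsub>M\<^esub> K) R M"
proof (rule submoduleI)
  note H = submoduleD[OF assms(1)] and K = submoduleD[OF assms(2)]
  show "H <+>\<^bsub>M\<^esub> K \<subseteq> carrier M" using H K by (auto simp: set_add_def')
  show "\<zero>\<^bsub>M\<^esub> \<in> H <+>\<^bsub>M\<^esub> K"
    using set_addI[OF H(3) K(3), of M] by simp
  show "x \<oplus>\<^bsub>M\<^esub> y \<in> H <+>\<^bsub>M\<^esub> K" if "x \<in> H <+>\<^bsub>M\<^esub> K" "y \<in> H <+>\<^bsub>M\<^esub> K" for x y
  proof -
    from that obtain h k h' k' where *: "h \<in> H" "k \<in> K" "h' \<in> H" "k' \<in> K"
      "x = h \<oplus>\<^bsub>M\<^esub> k" "y = h' \<oplus>\<^bsub>M\<^esub> k'" by (auto simp: set_add_def')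
    have "h \<in> carrier M" "k \<in> carrier M" "h' \<in> carrier M" "k' \<in> carrier M"
      using *(1-4) H(2) K(2) by blast+
    then have "x \<oplus>\<^bsub>M\<^esub> y = (h \<oplus>\<^bsub>M\<^esub> h') \<oplus>\<^bsub>M\<^esub> (k \<oplus>\<^bsub>M\<^esub> k')" using *(5,6) by (simp add: M.a_ac)
    then show ?thesis using set_addI[OF H(4)[OF *(1,3)] K(4)[OF *(2,4)], of M] by simp
  qed
  show "r \<odot>\<^bsub>M\<^esub> x \<in> H <+>\<^bsub>M\<^esub> K" if "r \<in> carrier R" "x \<in> H <+>\<^bsub>M\<^esub> K" for r x
  proof -
    from that obtain h k where *: "h \<in> H" "k \<in> K" "x = h \<oplus>\<^bsub>M\<^esub> k" by (auto simp: set_add_def')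
    then have "r \<odot>\<^bsub>M\<^esub> x = r \<odot>\<^bsub>M\<^esub> h \<oplus>\<^bsub>M\<^esub> r \<odot>\<^bsub>M\<^esub> k"
      using H(2)[of h] K(2)[of k] that by (simp add: smult_r_distr)
    then show ?thesis using set_addI[OF H(5)[OF that(1) *(1)] K(5)[OF that(1) *(2)], of M] by simp
  qed
qed

lemma set_add_left: "\<lbrakk>submodule H R M; submodule K R M; x \<in> H\<rbrakk> \<Longrightarrow> x \<in> H <+>\<^bsub>M\<^esub> K"
  using set_addI[of x H "\<zero>\<^bsub>M\<^esub>" K M] submoduleD(2)[of H x] submoduleD(3)[of K] by simp

lemma set_add_right: "\<lbrakk>submodule H R M; submodule K R M; x \<in> K\<rbrakk> \<Longrightarrow> x \<in> H <+>\<^bsub>M\<^esub> K"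
  using set_addI[of "\<zero>\<^bsub>M\<^esub>" H x K M] submoduleD(2)[of K x] submoduleD(3)[of H] by simp

lemma in_span_insertE:
  assumes "t \<in> carrier M" and "X \<subseteq> carrier M" and "x \<in> submodule_span R M (insert t X)"
  obtains a w where "a \<in> carrier R" and "w \<in> submodule_span R M X" and "x = a \<odot>\<^bsub>M\<^esub> t \<oplus>\<^bsub>M\<^esub> w"
proof -
  let ?T = "(\<lambda>a. a \<odot>\<^bsub>M\<^esub> t) ` carrier R"
  have G: "submodule (submodule_span R M X) R M" by (rule submodule_span_submodule[OF assms(2)])
  have T: "submodule ?T R M"
  proof (rule submoduleI)
    show "\<zero>\<^bsub>M\<^esub> \<in> ?T" using assms(1) by (intro image_eqI[of _ _ \<zero>]) auto
  qed (use assms(1) in \<open>auto simp: smult_l_distr[symmetric] smult_assoc[symmetric]\<close>)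
  have "t \<in> ?T" using assms(1) by (intro image_eqI[of _ _ \<one>]) auto
  then have "insert t X \<subseteq> ?T <+>\<^bsub>M\<^esub> submodule_span R M X"
    using set_add_left[OF T G] set_add_right[OF T G] span_subset[of _ X] by blast
  then have "x \<in> ?T <+>\<^bsub>M\<^esub> submodule_span R M X"
    using span_minimal[OF submodule_set_add[OF T G] _ assms(3)] by blast
  then obtain u w where "u \<in> ?T" "w \<in> submodule_span R M X" "x = u \<oplus>\<^bsub>M\<^esub> w" by (rule set_addE)
  then show ?thesis using that by blast
qed

end

sublocale graded_module \<subseteq> parts: decomposed_group M "mpart M"
  by unfold_locales (rule mpart_direct_sum)

abbreviation mcomp :: "('a, 'b, 'y) gr_module_scheme \<Rightarrow> int \<Rightarrow> 'b \<Rightarrow> 'b" where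
  "mcomp M \<equiv> component M (mpart M)"

definition graded_submodule ::
    "('a, 'x) gr_ring_scheme \<Rightarrow> ('a, 'b, 'y) gr_module_scheme \<Rightarrow> 'b set \<Rightarrow> bool" where
  "graded_submodule R M H \<longleftrightarrow> submodule H R M \<and> (\<forall>x \<in> H. \<forall>j. mcomp M j x \<in> H)"

context graded_module
begin

lemma mcomp_smult_homogeneous:
  assumes "r \<in> rpart R i" and "x \<in> carrier M"
  shows "mcomp M j (r \<odot>\<^bsub>M\<^esub> x) = r \<odot>\<^bsub>M\<^esub> mcomp M (j - int i) x"
proof -
  have r: "r \<in> carrier R" using assms(1) ring_parts.part_carrier by blast
  show ?thesis using assms(2)
  proof (induction rule: parts.homogeneous_induct)
    case zero
    then show ?case using r by simp
  next
    case (add x y)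
    then show ?case using r by (simp add: smult_r_distr parts.component_add)
  next
    case (part l x)
    then have "r \<odot>\<^bsub>M\<^esub> x \<in> mpart M (int i + l)" using smult_mpart assms(1) by blast
    then show ?case using part r by (auto simp: parts.component_homogeneous)
  qed
qed

lemma mcomp_smult:
  assumes "r \<in> carrier R" and "x \<in> carrier M"
  shows "mcomp M j (r \<odot>\<^bsub>M\<^esub> x) =
    (\<Oplus>\<^bsub>M\<^esub>i\<in>{i. rcomp i r \<noteq> \<zero>}. rcomp i r \<odot>\<^bsub>M\<^esub> mcomp M (j - int i) x)"
proof -
  let ?I = "{i. rcomp i r \<noteq> \<zero>}"
  have c: "(\<lambda>i. rcomp i r) \<in> ?I \<rightarrow> carrier R" "(\<lambda>i. rcomp i r \<odot>\<^bsub>M\<^esub> x) \<in> ?I \<rightarrow> carrier M"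
    using assms by auto
  have "r \<odot>\<^bsub>M\<^esub> x = (\<Oplus>i\<in>?I. rcomp i r) \<odot>\<^bsub>M\<^esub> x"
    using ring_parts.component_props(3)[OF assms(1)] by simp
  also have "\<dots> = (\<Oplus>\<^bsub>M\<^esub>i\<in>?I. rcomp i r \<odot>\<^bsub>M\<^esub> x)" by (rule finsum_smult[OF assms(2) c(1)])
  finally have "mcomp M j (r \<odot>\<^bsub>M\<^esub> x) = (\<Oplus>\<^bsub>M\<^esub>i\<in>?I. mcomp M j (rcomp i r \<odot>\<^bsub>M\<^esub> x))"
    using abelian_group_hom.hom_finsum[OF parts.component_hom c(2), of j] by simp
  then show ?thesis
    using mcomp_smult_homogeneous[OF ring_parts.component_props(1)[OF assms(1)] assms(2)] by simp
qed

text \<open>How gradedness of submodules is checked: scalars need not be homogeneous, but their components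
  act degree by degree.\<close>

lemma mcomp_smult_in:
  assumes "submodule H R M" and "r \<in> carrier R" and "x \<in> carrier M"
    and "\<And>i. rcomp i r \<odot>\<^bsub>M\<^esub> mcomp M (j - int i) x \<in> H"
  shows "mcomp M j (r \<odot>\<^bsub>M\<^esub> x) \<in> H"
  unfolding mcomp_smult[OF assms(2,3)] by (rule submodule_finsum[OF assms(1)]) (rule assms(4))

lemma graded_submoduleD:
  assumes "graded_submodule R M H"
  shows "submodule H R M" and "x \<in> H \<Longrightarrow> mcomp M j x \<in> H"
  using assms by (auto simp: graded_submodule_def)

lemma graded_submodule_span:
  assumes "S \<subseteq> carrier M" and "\<And>s j. s \<in> S \<Longrightarrow> mcomp M j s \<in> submodule_span R M S"
  shows "graded_submodule R M (submodule_span R M S)"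
proof -
  let ?H = "submodule_span R M S"
  have H: "submodule ?H R M" by (rule submodule_span_submodule[OF assms(1)])
  have "submodule {x \<in> carrier M. \<forall>j. mcomp M j x \<in> ?H} R M"
  proof (rule submoduleI)
    show "r \<odot>\<^bsub>M\<^esub> x \<in> {x \<in> carrier M. \<forall>j. mcomp M j x \<in> ?H}"
      if "r \<in> carrier R" "x \<in> {x \<in> carrier M. \<forall>j. mcomp M j x \<in> ?H}" for r x
      using that by (auto intro!: mcomp_smult_in[OF H] submoduleD(5)[OF H])
  qed (auto simp: parts.component_add submoduleD[OF H])
  then have "x \<in> {x \<in> carrier M. \<forall>j. mcomp M j x \<in> ?H}" if "x \<in> ?H" for x
    by (rule span_minimal[OF _ _ that]) (use assms in auto)
  then show ?thesis using H by (auto simp: graded_submodule_def)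
qed

lemma graded_submodule_span_homogeneous:
  assumes "S \<subseteq> (\<Union>j. mpart M j)"
  shows "graded_submodule R M (submodule_span R M S)"
proof (rule graded_submodule_span)
  show S: "S \<subseteq> carrier M" using assms parts.part_carrier by blast
  fix s j assume s: "s \<in> S"
  then obtain i where "s \<in> mpart M i" using assms by blast
  then show "mcomp M j s \<in> submodule_span R M S"
    using span_subset[OF s] submoduleD(3)[OF submodule_span_submodule[OF S]]
    by (simp add: parts.component_homogeneous)
qed

lemma graded_submodule_set_add:
  assumes "graded_submodule R M H" and "graded_submodule R M K"
  shows "graded_submodule R M (H <+>\<^bsub>M\<^esub> K)"
  unfolding graded_submodule_def
proof (intro conjI ballI allI)
  note H = graded_submoduleD[OF assms(1)] and K = graded_submoduleD[OF assms(2)]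
  show "submodule (H <+>\<^bsub>M\<^esub> K) R M" by (rule submodule_set_add[OF H(1) K(1)])
  fix x j assume "x \<in> H <+>\<^bsub>M\<^esub> K"
  then obtain h k where *: "h \<in> H" "k \<in> K" "x = h \<oplus>\<^bsub>M\<^esub> k" by (rule set_addE)
  then have "mcomp M j x = mcomp M j h \<oplus>\<^bsub>M\<^esub> mcomp M j k"
    using submoduleD(2)[OF H(1), of h] submoduleD(2)[OF K(1), of k] by (simp add: parts.component_add)
  then show "mcomp M j x \<in> H <+>\<^bsub>M\<^esub> K" using set_addI[OF H(2)[OF *(1)] K(2)[OF *(2)]] by simp
qed

end

lemma restrict_module_simps [simp]:
  "carrier (restrict_module M H) = H" "\<zero>\<^bsub>restrict_module M H\<^esub> = \<zero>\<^bsub>M\<^esub>"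
  "add (restrict_module M H) = add M" "smult (restrict_module M H) = smult M"
  "mpart (restrict_module M H) j = mpart M j \<inter> H"
  by (simp_all add: restrict_module_def)

context graded_module
begin

lemma restrict_abelian_group:
  assumes "additive_subgroup H M"
  shows "abelian_group (restrict_module M H)"
proof (rule abelian_groupI)
  have H: "H \<subseteq> carrier M" "\<zero>\<^bsub>M\<^esub> \<in> H" "\<And>x y. x \<in> H \<Longrightarrow> y \<in> H \<Longrightarrow> x \<oplus>\<^bsub>M\<^esub> y \<in> H"
    "\<And>x. x \<in> H \<Longrightarrow> \<ominus>\<^bsub>M\<^esub> x \<in> H" using assms by (auto simp: M.additive_subgroup_iff)
  fix x assume "x \<in> carrier (restrict_module M H)"
  then show "\<exists>y\<in>carrier (restrict_module M H). y \<oplus>\<^bsub>restrict_module M H\<^esub> x = \<zero>\<^bsub>restrict_module M H\<^esub>"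
    using H by (intro bexI[of _ "\<ominus>\<^bsub>M\<^esub> x"]) (auto simp: M.l_neg subset_iff)
qed (use assms in \<open>auto simp: M.additive_subgroup_iff M.a_ac subset_iff\<close>)

lemma restrict_neg:
  assumes "additive_subgroup H M" and "x \<in> H"
  shows "\<ominus>\<^bsub>restrict_module M H\<^esub> x = \<ominus>\<^bsub>M\<^esub> x"
proof -
  interpret N: abelian_group "restrict_module M H" by (rule restrict_abelian_group[OF assms(1)])
  have H: "H \<subseteq> carrier M" using assms by (auto simp: M.additive_subgroup_iff)
  have *: "\<ominus>\<^bsub>restrict_module M H\<^esub> x \<oplus>\<^bsub>M\<^esub> x = \<zero>\<^bsub>M\<^esub>" "\<ominus>\<^bsub>restrict_module M H\<^esub> x \<in> H"
    using N.l_neg[of x] N.a_inv_closed[of x] assms(2) by auto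
  show ?thesis using M.minus_equality[OF *(1), symmetric] *(2) H assms(2) by blast
qed

lemma restrict_minus:
  assumes "additive_subgroup H M" and "x \<in> H" and "y \<in> H"
  shows "x \<ominus>\<^bsub>restrict_module M H\<^esub> y = x \<ominus>\<^bsub>M\<^esub> y"
  using restrict_neg[OF assms(1,3)] by (simp add: a_minus_def)

lemma restrict_finsum:
  assumes "additive_subgroup H M" and "f \<in> A \<rightarrow> H"
  shows "finsum (restrict_module M H) f A = finsum M f A"
proof (rule finsum_in_subgroup)
  show "abelian_monoid (restrict_module M H)"
    using restrict_abelian_group[OF assms(1)] by (rule abelian_group.axioms(1))
  show "abelian_monoid M" by (rule M.abelian_monoid_axioms)
qed (use assms in \<open>auto simp: M.additive_subgroup_iff\<close>)

lemma restrict_graded_module: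
  assumes "graded_submodule R M H"
  shows "graded_module R (restrict_module M H)"
proof -
  let ?N = "restrict_module M H"
  note sub = graded_submoduleD[OF assms]
  note H = submoduleD[OF sub(1)]
  interpret N: abelian_group ?N by (rule restrict_abelian_group[OF H(1)])
  have lm: "left_module R ?N"
    by (intro left_module.intro left_module_axioms.intro R.ring_axioms N.abelian_group_axioms)
      (auto simp: H smult_l_distr smult_r_distr smult_assoc)
  have "internal_direct_sum ?N (mpart ?N)"
  proof (rule internal_direct_sumI[where c = "\<lambda>x i. mcomp M i x" and p = "mcomp M"])
    show "additive_subgroup (mpart ?N i) ?N" for i
      using H restrict_neg[OF H(1)] parts.part_neg
      by (auto simp: N.additive_subgroup_iff parts.part_add)
    fix x assume "x \<in> carrier ?N"
    then have x: "x \<in> H" "x \<in> carrier M" using H by auto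
    show "mcomp M i x \<in> mpart ?N i" for i using x parts.component_props(1) sub(2) by auto
    show "finite {i. mcomp M i x \<noteq> \<zero>\<^bsub>?N\<^esub>}" using parts.component_props(2)[OF x(2)] by simp
    have "(\<Oplus>\<^bsub>?N\<^esub>i\<in>{i. mcomp M i x \<noteq> \<zero>\<^bsub>?N\<^esub>}. mcomp M i x) =
        (\<Oplus>\<^bsub>M\<^esub>i\<in>{i. mcomp M i x \<noteq> \<zero>\<^bsub>M\<^esub>}. mcomp M i x)"
      using sub(2) x by (simp add: restrict_finsum[OF H(1)] Pi_iff)
    then show "x = (\<Oplus>\<^bsub>?N\<^esub>i\<in>{i. mcomp M i x \<noteq> \<zero>\<^bsub>?N\<^esub>}. mcomp M i x)"
      using parts.component_props(3)[OF x(2)] by simp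
  next
    show "abelian_group_hom ?N ?N (mcomp M i)" for i
      by (rule additive_map_hom) (auto simp: H sub parts.component_add intro: N.abelian_group_axioms)
    show "mcomp M i x = (if i = j then x else \<zero>\<^bsub>?N\<^esub>)" if "x \<in> mpart ?N j" for i j x
      using that parts.component_homogeneous[of x j i] by simp
  qed (rule N.abelian_group_axioms)
  then show ?thesis
    by (intro graded_module.intro graded_module_axioms.intro lm graded_ring_axioms)
      (auto simp: smult_mpart H ring_parts.part_carrier)
qed

lemma submodule_restrict_iff:
  assumes "graded_submodule R M H"
  shows "submodule K R (restrict_module M H) \<longleftrightarrow> submodule K R M \<and> K \<subseteq> H"
proof -
  interpret N: graded_module R "restrict_module M H" by (rule restrict_graded_module[OF assms(1)])
  show ?thesis
    using submoduleD(2)[OF graded_submoduleD(1)[OF assms]] by (auto simp: submodule_iff N.submodule_iff)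
qed

lemma span_restrict:
  assumes "graded_submodule R M H" and "S \<subseteq> H"
  shows "submodule_span R (restrict_module M H) S = submodule_span R M S"
proof -
  have H: "submodule H R M" using graded_submoduleD(1)[OF assms(1)] .
  have S: "S \<subseteq> carrier M" using assms(2) submoduleD(2)[OF H] by blast
  have "submodule (submodule_span R M S) R (restrict_module M H)"
    using submodule_restrict_iff[OF assms(1)] submodule_span_submodule[OF S] span_minimal[OF H assms(2)]
    by blast
  then have "submodule_span R (restrict_module M H) S \<subseteq> submodule_span R M S"
    unfolding submodule_span_def by (intro hull_minimal hull_subset)
  moreover have "submodule_span R M S \<subseteq> submodule_span R (restrict_module M H) S"
    unfolding submodule_span_def
    by (rule hull_antimono) (use submodule_restrict_iff[OF assms(1)] in blast)
  ultimately show ?thesis by blast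
qed

end

text \<open>Homogeneous maps of degree \<open>t\<close>, i.e. degree-preserving maps into the twist by \<open>t\<close>.\<close>

definition deg_hom ::
    "('a, 'x) gr_ring_scheme \<Rightarrow> int \<Rightarrow> ('a, 'b, 'y) gr_module_scheme \<Rightarrow>
     ('a, 'c, 'z) gr_module_scheme \<Rightarrow> ('b \<Rightarrow> 'c) set" where
  "deg_hom R t M N = {f. f \<in> carrier M \<rightarrow> carrier N \<and>
     (\<forall>x \<in> carrier M. \<forall>y \<in> carrier M. f (x \<oplus>\<^bsub>M\<^esub> y) = f x \<oplus>\<^bsub>N\<^esub> f y) \<and>
     (\<forall>r \<in> carrier R. \<forall>x \<in> carrier M. f (r \<odot>\<^bsub>M\<^esub> x) = r \<odot>\<^bsub>N\<^esub> f x) \<and>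
     (\<forall>j. \<forall>x \<in> mpart M j. f x \<in> mpart N (t + j))}"

lemma graded_hom_twist: "graded_hom R M (twist t N) = deg_hom R t M N"
  by (auto simp: graded_hom_def deg_hom_def twist_def image_subset_iff)

lemma graded_hom_deg_hom: "graded_hom R M N = deg_hom R 0 M N"
  by (auto simp: graded_hom_def deg_hom_def image_subset_iff)

locale graded_linear =
  fixes R :: "('a, 'x) gr_ring_scheme" and t :: int
    and M :: "('a, 'b, 'y) gr_module_scheme" and N :: "('a, 'c, 'z) gr_module_scheme"
    and f :: "'b \<Rightarrow> 'c"
  assumes dom: "graded_module R M" and cod: "graded_module R N" and hom: "f \<in> deg_hom R t M N"
begin

lemma closed [simp]: "x \<in> carrier M \<Longrightarrow> f x \<in> carrier N"
  and add: "x \<in> carrier M \<Longrightarrow> y \<in> carrier M \<Longrightarrow> f (x \<oplus>\<^bsub>M\<^esub> y) = f x \<oplus>\<^bsub>N\<^esub> f y"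
  and smult: "r \<in> carrier R \<Longrightarrow> x \<in> carrier M \<Longrightarrow> f (r \<odot>\<^bsub>M\<^esub> x) = r \<odot>\<^bsub>N\<^esub> f x"
  and part: "x \<in> mpart M j \<Longrightarrow> f x \<in> mpart N (t + j)"
  using hom by (auto simp: deg_hom_def)

lemma additive: "abelian_group_hom M N f"
proof -
  interpret M: graded_module R M by (rule dom)
  interpret N: graded_module R N by (rule cod)
  show ?thesis
    by (rule additive_map_hom) (auto simp: add intro: M.M.abelian_group_axioms N.M.abelian_group_axioms)
qed

lemma zero [simp]: "f \<zero>\<^bsub>M\<^esub> = \<zero>\<^bsub>N\<^esub>"
  using additive by (rule abelian_group_hom.hom_zero)

lemma neg: "x \<in> carrier M \<Longrightarrow> f (\<ominus>\<^bsub>M\<^esub> x) = \<ominus>\<^bsub>N\<^esub> f x"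
  by (rule abelian_group_hom.hom_a_inv[OF additive])

lemma minus: "x \<in> carrier M \<Longrightarrow> y \<in> carrier M \<Longrightarrow> f (x \<ominus>\<^bsub>M\<^esub> y) = f x \<ominus>\<^bsub>N\<^esub> f y"
  by (rule abelian_group_hom.hom_minus[OF additive])

lemma mcomp_image:
  assumes "x \<in> carrier M"
  shows "mcomp N j (f x) = f (mcomp M (j - t) x)"
proof -
  interpret M: graded_module R M by (rule dom)
  interpret N: graded_module R N by (rule cod)
  note f_add = add and f_part = part
  show ?thesis using assms
  proof (induction rule: M.parts.homogeneous_induct)
    case (add x y)
    then show ?case by (simp add: f_add M.parts.component_add N.parts.component_add)
  next
    case (part i x)
    then show ?case
      using N.parts.component_homogeneous[OF f_part[OF part], of j]
        M.parts.component_homogeneous[OF part, of "j - t"] by auto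
  qed simp
qed

lemma submodule_image:
  assumes "submodule H R M"
  shows "submodule (f ` H) R N"
proof -
  interpret M: graded_module R M by (rule dom)
  interpret N: graded_module R N by (rule cod)
  note H = M.submoduleD[OF assms]
  show ?thesis
  proof (rule N.submoduleI)
    show "f ` H \<subseteq> carrier N" using H by auto
    show "\<zero>\<^bsub>N\<^esub> \<in> f ` H" using H(3) by (intro image_eqI[of _ _ "\<zero>\<^bsub>M\<^esub>"]) auto
    fix x y assume "x \<in> f ` H" "y \<in> f ` H"
    then obtain u v where "u \<in> H" "v \<in> H" "x = f u" "y = f v" by blast
    then show "x \<oplus>\<^bsub>N\<^esub> y \<in> f ` H" using H by (intro image_eqI[of _ _ "u \<oplus>\<^bsub>M\<^esub> v"]) (auto simp: add)
  next
    fix r x assume "r \<in> carrier R" "x \<in> f ` H"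
    then obtain u where "r \<in> carrier R" "u \<in> H" "x = f u" by blast
    then show "r \<odot>\<^bsub>N\<^esub> x \<in> f ` H" using H by (intro image_eqI[of _ _ "r \<odot>\<^bsub>M\<^esub> u"]) (auto simp: smult)
  qed
qed

lemma graded_submodule_image:
  assumes "graded_submodule R M H"
  shows "graded_submodule R N (f ` H)"
proof -
  interpret M: graded_module R M by (rule dom)
  interpret N: graded_module R N by (rule cod)
  note H = M.graded_submoduleD[OF assms]
  show ?thesis
    using submodule_image[OF H(1)] H(2) M.submoduleD(2)[OF H(1)] mcomp_image
    by (auto simp: graded_submodule_def)
qed

lemma submodule_preimage:
  assumes "submodule K R N"
  shows "submodule {x \<in> carrier M. f x \<in> K} R M"
proof -
  interpret M: graded_module R M by (rule dom)
  interpret N: graded_module R N by (rule cod)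
  show ?thesis
    by (rule M.submoduleI) (auto simp: N.submoduleD[OF assms] add smult)
qed

lemma image_span:
  assumes "S \<subseteq> carrier M"
  shows "f ` submodule_span R M S = submodule_span R N (f ` S)"
proof -
  interpret M: graded_module R M by (rule dom)
  interpret N: graded_module R N by (rule cod)
  have fS: "f ` S \<subseteq> carrier N" using assms by auto
  have "submodule {x \<in> carrier M. f x \<in> submodule_span R N (f ` S)} R M"
    by (rule submodule_preimage[OF N.submodule_span_submodule[OF fS]])
  then have "submodule_span R M S \<subseteq> {x \<in> carrier M. f x \<in> submodule_span R N (f ` S)}"
    using M.span_minimal[of _ S] assms N.span_subset[of _ "f ` S"] by blast
  moreover have "submodule_span R N (f ` S) \<subseteq> f ` submodule_span R M S"
    using N.span_minimal[OF submodule_image[OF M.submodule_span_submodule[OF assms]], of "f ` S"]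
      M.span_subset[of _ S] by blast
  ultimately show ?thesis by blast
qed

lemma max_ideal_times_image:
  assumes "x \<in> max_ideal_times R M" and "\<And>r. r \<in> graded_max_ideal R \<Longrightarrow> r \<in> carrier R"
  shows "f x \<in> max_ideal_times R N"
proof -
  interpret M: graded_module R M by (rule dom)
  interpret N: graded_module R N by (rule cod)
  let ?S = "{r \<odot>\<^bsub>M\<^esub> x | r x. r \<in> graded_max_ideal R \<and> x \<in> carrier M}"
  let ?T = "{r \<odot>\<^bsub>N\<^esub> x | r x. r \<in> graded_max_ideal R \<and> x \<in> carrier N}"
  have "?S \<subseteq> carrier M" using assms(2) by auto
  then have "f x \<in> submodule_span R N (f ` ?S)"
    using image_span assms(1) unfolding max_ideal_times_def by blast
  moreover have "f ` ?S \<subseteq> ?T" using assms(2) smult closed by blast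
  ultimately show ?thesis using N.span_mono[of "f ` ?S" ?T] unfolding max_ideal_times_def by blast
qed

end

lemma deg_hom_id: "(\<lambda>x. x) \<in> deg_hom R 0 M M"
  by (auto simp: deg_hom_def)

lemma deg_hom_comp:
  assumes "f \<in> deg_hom R s M N" and "g \<in> deg_hom R t N P" and "s + t = u"
  shows "(\<lambda>x. g (f x)) \<in> deg_hom R u M P"
proof -
  have "g (f x) \<in> mpart P (u + j)" if "x \<in> mpart M j" for x j
  proof -
    have "g (f x) \<in> mpart P (t + (s + j))" using that assms(1,2) by (simp add: deg_hom_def)
    moreover have "t + (s + j) = u + j" using assms(3) by simp
    ultimately show ?thesis by simp
  qed
  then show ?thesis using assms(1,2) by (auto simp: deg_hom_def Pi_iff)
qed

lemma deg_hom_zero: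
  assumes "graded_module R N"
  shows "(\<lambda>x. \<zero>\<^bsub>N\<^esub>) \<in> deg_hom R t M N"
proof -
  interpret N: graded_module R N by fact
  show ?thesis by (auto simp: deg_hom_def)
qed

lemma deg_hom_add:
  assumes "graded_module R N" and f: "f \<in> deg_hom R t M N" and g: "g \<in> deg_hom R t M N"
  shows "(\<lambda>x. f x \<oplus>\<^bsub>N\<^esub> g x) \<in> deg_hom R t M N"
proof -
  interpret N: graded_module R N by fact
  have c: "\<And>x. x \<in> carrier M \<Longrightarrow> f x \<in> carrier N" "\<And>x. x \<in> carrier M \<Longrightarrow> g x \<in> carrier N"
    using f g by (auto simp: deg_hom_def)
  show ?thesis
    using f g c unfolding deg_hom_def
    by (auto simp: N.smult_r_distr N.parts.part_add N.M.a_ac)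
qed

lemma deg_hom_neg:
  assumes "graded_module R N" and f: "f \<in> deg_hom R t M N"
  shows "(\<lambda>x. \<ominus>\<^bsub>N\<^esub> f x) \<in> deg_hom R t M N"
proof -
  interpret N: graded_module R N by fact
  have c: "\<And>x. x \<in> carrier M \<Longrightarrow> f x \<in> carrier N"
    using f by (auto simp: deg_hom_def)
  show ?thesis
    using f c unfolding deg_hom_def
    by (auto simp: N.smult_neg_right N.parts.part_neg N.M.minus_add)
qed

lemma deg_hom_minus:
  assumes "graded_module R N" and f: "f \<in> deg_hom R t M N" and g: "g \<in> deg_hom R t M N"
  shows "(\<lambda>x. f x \<ominus>\<^bsub>N\<^esub> g x) \<in> deg_hom R t M N"
  unfolding a_minus_def by (rule deg_hom_add[OF assms(1) f deg_hom_neg[OF assms(1) g]])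

lemma deg_hom_restrict_dom:
  "f \<in> deg_hom R t M N \<Longrightarrow> H \<subseteq> carrier M \<Longrightarrow> f \<in> deg_hom R t (restrict_module M H) N"
  by (auto simp: deg_hom_def subset_iff)

lemma deg_hom_restrict_cod:
  "f \<in> deg_hom R t M N \<Longrightarrow> f ` carrier M \<subseteq> K \<Longrightarrow> (\<And>j. mpart M j \<subseteq> carrier M) \<Longrightarrow>
    f \<in> deg_hom R t M (restrict_module N K)"
  by (auto simp: deg_hom_def subset_iff)

lemma deg_hom_unrestrict_cod:
  "f \<in> deg_hom R t M (restrict_module N K) \<Longrightarrow> K \<subseteq> carrier N \<Longrightarrow> f \<in> deg_hom R t M N"
  by (auto simp: deg_hom_def subset_iff)


section \<open>The graded Nakayama lemma\<close>

text \<open>A homogeneous generating set that meets every degree in a finite set and is bounded below: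
  finitely generated modules have one, and so do modules bounded below with finite-dimensional
  components. The lemma of Nakayama needs no more.\<close>

definition locally_finite_generators ::
    "('a, 'x) gr_ring_scheme \<Rightarrow> ('a, 'b, 'y) gr_module_scheme \<Rightarrow> 'b set \<Rightarrow> bool" where
  "locally_finite_generators R M S \<longleftrightarrow> S \<subseteq> (\<Union>j. mpart M j) \<and> submodule_span R M S = carrier M \<and>
     (\<forall>j. finite (S \<inter> mpart M j)) \<and> (\<exists>j\<^sub>0. \<forall>j<j\<^sub>0. S \<inter> mpart M j \<subseteq> {\<zero>\<^bsub>M\<^esub>})"

locale module_over_local = R?: local_graded_ring R + graded_module R M
  for R :: "('a, 'x) gr_ring_scheme" (structure) and M :: "('a, 'b, 'y) gr_module_scheme" (structure)
begin

abbreviation mM :: "'b set" where "mM \<equiv> max_ideal_times R M"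

lemma max_ideal_times_generators:
  "{r \<odot>\<^bsub>M\<^esub> x | r x. r \<in> mm \<and> x \<in> carrier M} \<subseteq> carrier M"
  using mm_closed by auto

lemma mM_submodule: "submodule mM R M"
  unfolding max_ideal_times_def by (rule submodule_span_submodule[OF max_ideal_times_generators])

lemmas mM_closed = submoduleD(2)[OF mM_submodule]

lemma smult_in_mM: "r \<in> mm \<Longrightarrow> x \<in> carrier M \<Longrightarrow> r \<odot>\<^bsub>M\<^esub> x \<in> mM"
  unfolding max_ideal_times_def by (rule span_subset) blast

lemma mM_minimal:
  assumes "submodule H R M" and "\<And>r x. r \<in> mm \<Longrightarrow> x \<in> carrier M \<Longrightarrow> r \<odot>\<^bsub>M\<^esub> x \<in> H" and "x \<in> mM"
  shows "x \<in> H"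
  using span_minimal[OF assms(1) _ assms(3)[unfolded max_ideal_times_def]] assms(2) by blast

lemma mM_graded: "graded_submodule R M mM"
  unfolding max_ideal_times_def
proof (rule graded_submodule_span[OF max_ideal_times_generators])
  fix s j assume "s \<in> {r \<odot>\<^bsub>M\<^esub> x | r x. r \<in> mm \<and> x \<in> carrier M}"
  then obtain r x where *: "r \<in> mm" "x \<in> carrier M" "s = r \<odot>\<^bsub>M\<^esub> x" by blast
  have "rcomp i r \<in> mm" for i
  proof (cases "i = 0")
    case True
    then show ?thesis using *(1) m0_subset_mm by (simp add: mm_iff)
  next
    case False
    then show ?thesis
      using rpart_pos_subset_mm ring_parts.component_props(1) mm_closed[OF *(1)] by blast
  qed
  then have "mcomp M j (r \<odot>\<^bsub>M\<^esub> x) \<in> mM"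
    using *(2) smult_in_mM by (intro mcomp_smult_in[OF mM_submodule mm_closed[OF *(1)]]) auto
  then show "mcomp M j s \<in> submodule_span R M {r \<odot>\<^bsub>M\<^esub> x | r x. r \<in> mm \<and> x \<in> carrier M}"
    using *(3) unfolding max_ideal_times_def by simp
qed

text \<open>Scalars of positive degree only involve components of \<open>x\<close> of degree below \<open>j\<close>. Modulo a submodule
  containing these, \<open>R\<close> acts on the degree \<open>j\<close> part through \<open>R\<^sub>0\<close>.\<close>

lemma mcomp_smult_modulo:
  assumes N: "submodule N R M" and low: "\<And>l. l < j \<Longrightarrow> mpart M l \<subseteq> N"
    and r: "r \<in> carrier R" and x: "x \<in> carrier M"
  obtains n where "n \<in> N" and "mcomp M j (r \<odot>\<^bsub>M\<^esub> x) = rcomp 0 r \<odot>\<^bsub>M\<^esub> mcomp M j x \<oplus>\<^bsub>M\<^esub> n"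
proof -
  let ?r = "r \<ominus> rcomp 0 r"
  have r0: "rcomp 0 r \<in> carrier R" "rcomp 0 r \<in> rpart R 0" "?r \<in> carrier R"
    using r ring_parts.component_props(1) by auto
  have "mcomp M j (?r \<odot>\<^bsub>M\<^esub> x) \<in> N"
  proof (rule mcomp_smult_in[OF N r0(3) x])
    fix i
    show "rcomp i ?r \<odot>\<^bsub>M\<^esub> mcomp M (j - int i) x \<in> N"
    proof (cases "i = 0")
      case True
      have "rcomp 0 ?r = \<zero>"
        using r r0 by (simp add: R.minus_eq ring_parts.component_add ring_parts.component_neg rcomp_zero_part R.r_neg)
      then show ?thesis using True x submoduleD(3)[OF N] by simp
    next
      case False
      then have "mcomp M (j - int i) x \<in> N"
        using low[of "j - int i"] parts.component_props(1)[OF x, of "j - int i"] by auto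
      then show ?thesis using submoduleD(5)[OF N] r0(3) by blast
    qed
  qed
  moreover have "mcomp M j (r \<odot>\<^bsub>M\<^esub> x) = rcomp 0 r \<odot>\<^bsub>M\<^esub> mcomp M j x \<oplus>\<^bsub>M\<^esub> mcomp M j (?r \<odot>\<^bsub>M\<^esub> x)"
  proof -
    have "r \<odot>\<^bsub>M\<^esub> x = (rcomp 0 r \<oplus> ?r) \<odot>\<^bsub>M\<^esub> x" using r r0 by (simp add: R.add_minus_cancel)
    also have "\<dots> = rcomp 0 r \<odot>\<^bsub>M\<^esub> x \<oplus>\<^bsub>M\<^esub> ?r \<odot>\<^bsub>M\<^esub> x" using r0 x by (simp add: smult_l_distr)
    finally show ?thesis
      using r0 x mcomp_smult_homogeneous[OF r0(2) x, of j] by (simp add: parts.component_add)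
  qed
  ultimately show ?thesis using that by blast
qed

text \<open>The inductive step: a generator \<open>t\<close> of the degree \<open>j\<close> part is dispensable, because
  \<open>t = c t + w\<close> with \<open>c\<close> in the maximal ideal of \<open>R\<^sub>0\<close> and \<open>w\<close> in the span of the others.\<close>

lemma nakayama_remove_generator:
  assumes N: "graded_submodule R M N" and low: "\<And>l. l < j \<Longrightarrow> mpart M l \<subseteq> N"
    and cover: "\<And>x. x \<in> carrier M \<Longrightarrow> x \<in> N <+>\<^bsub>M\<^esub> mM"
    and G: "graded_submodule R M G" "N \<subseteq> G" and t: "t \<in> mpart M j"
    and all: "mpart M j \<subseteq> submodule_span R M (insert t G)"
  shows "t \<in> G"
proof -
  note NN = graded_submoduleD[OF N] and GG = graded_submoduleD[OF G(1)]
  note Gs = submoduleD[OF GG(1)]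
  have tc: "t \<in> carrier M" using t parts.part_carrier by blast
  have span: "\<exists>a w. a \<in> carrier R \<and> w \<in> G \<and> x = a \<odot>\<^bsub>M\<^esub> t \<oplus>\<^bsub>M\<^esub> w"
    if "x \<in> submodule_span R M (insert t G)" for x
    using in_span_insertE[OF tc _ that] Gs(2) span_minimal[OF GG(1), of G] by (metis order_refl subsetI)
  let ?E = "{y. \<exists>c w. c \<in> m0 \<and> w \<in> G \<and> y = c \<odot>\<^bsub>M\<^esub> t \<oplus>\<^bsub>M\<^esub> w}"
  have E_add: "y \<oplus>\<^bsub>M\<^esub> z \<in> ?E" if y: "y \<in> ?E" and z: "z \<in> ?E" for y z
  proof -
    from y z obtain c w d v where *: "c \<in> m0" "w \<in> G" "y = c \<odot>\<^bsub>M\<^esub> t \<oplus>\<^bsub>M\<^esub> w"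
      "d \<in> m0" "v \<in> G" "z = d \<odot>\<^bsub>M\<^esub> t \<oplus>\<^bsub>M\<^esub> v" by blast
    have cl: "c \<in> carrier R" "d \<in> carrier R" "w \<in> carrier M" "v \<in> carrier M"
      "c \<odot>\<^bsub>M\<^esub> t \<in> carrier M" "d \<odot>\<^bsub>M\<^esub> t \<in> carrier M"
      using * m0_closed Gs(2) tc by auto
    have "y \<oplus>\<^bsub>M\<^esub> z = (c \<odot>\<^bsub>M\<^esub> t \<oplus>\<^bsub>M\<^esub> d \<odot>\<^bsub>M\<^esub> t) \<oplus>\<^bsub>M\<^esub> (w \<oplus>\<^bsub>M\<^esub> v)"
      using cl(3-6) unfolding *(3,6) by (simp add: M.a_ac)
    also have "\<dots> = (c \<oplus> d) \<odot>\<^bsub>M\<^esub> t \<oplus>\<^bsub>M\<^esub> (w \<oplus>\<^bsub>M\<^esub> v)"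
      using cl(1,2) tc by (simp add: smult_l_distr)
    finally show ?thesis using R0.J_add[of c d] * Gs(4) by auto
  qed
  have E_G: "w \<in> ?E" if "w \<in> G" for w
    using that Gs(2)[OF that] R0.J_zero tc by (intro CollectI exI[of _ \<zero>] exI[of _ w]) auto
  have E_smult: "r \<odot>\<^bsub>M\<^esub> y \<in> ?E" if "r \<in> rpart R 0" "y \<in> ?E" for r y
  proof -
    have r: "r \<in> carrier R" using that ring_parts.part_carrier by blast
    from that(2) obtain c w where *: "c \<in> m0" "w \<in> G" "y = c \<odot>\<^bsub>M\<^esub> t \<oplus>\<^bsub>M\<^esub> w" by blast
    have cl: "c \<in> carrier R" "w \<in> carrier M" using * m0_closed Gs(2) by auto
    have "r \<odot>\<^bsub>M\<^esub> y = (r \<otimes> c) \<odot>\<^bsub>M\<^esub> t \<oplus>\<^bsub>M\<^esub> r \<odot>\<^bsub>M\<^esub> w"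
      using cl r tc unfolding *(3) by (simp add: smult_r_distr smult_assoc)
    then show ?thesis using R0.J_mult_left[of r c] that * Gs(5)[OF r] by auto
  qed
  have modE: "mcomp M j (r \<odot>\<^bsub>M\<^esub> x) \<in> ?E"
    if r: "r \<in> carrier R" and x: "x \<in> carrier M" and xE: "rcomp 0 r \<odot>\<^bsub>M\<^esub> mcomp M j x \<in> ?E" for r x
  proof -
    obtain n where "n \<in> N" "mcomp M j (r \<odot>\<^bsub>M\<^esub> x) = rcomp 0 r \<odot>\<^bsub>M\<^esub> mcomp M j x \<oplus>\<^bsub>M\<^esub> n"
      using mcomp_smult_modulo[OF NN(1) low r x] by blast
    then show ?thesis using E_add[OF xE E_G[of n]] G(2) by auto
  qed
  have Esub: "submodule {x \<in> carrier M. mcomp M j x \<in> ?E} R M"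
  proof (rule submoduleI)
    show "\<zero>\<^bsub>M\<^esub> \<in> {x \<in> carrier M. mcomp M j x \<in> ?E}" using E_G[OF Gs(3)] by simp
    show "x \<oplus>\<^bsub>M\<^esub> y \<in> {x \<in> carrier M. mcomp M j x \<in> ?E}"
      if "x \<in> {x \<in> carrier M. mcomp M j x \<in> ?E}" "y \<in> {x \<in> carrier M. mcomp M j x \<in> ?E}" for x y
      using that E_add[of "mcomp M j x" "mcomp M j y"] by (simp add: parts.component_add)
    show "r \<odot>\<^bsub>M\<^esub> x \<in> {x \<in> carrier M. mcomp M j x \<in> ?E}"
      if "r \<in> carrier R" "x \<in> {x \<in> carrier M. mcomp M j x \<in> ?E}" for r x
      using modE[of r x] E_smult[OF ring_parts.component_props(1)[OF that(1), of 0], of "mcomp M j x"] that by simp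
  qed blast
  have mE: "mcomp M j x \<in> ?E" if "x \<in> mM" for x
  proof -
    have "x \<in> {x \<in> carrier M. mcomp M j x \<in> ?E}"
    proof (rule mM_minimal[OF Esub _ that])
      fix r x assume r: "r \<in> mm" and x: "x \<in> carrier M"
      have rc: "r \<in> carrier R" "rcomp 0 r \<in> m0" "rcomp 0 r \<in> carrier R" using r by (auto simp: mm_iff)
      obtain a w where aw: "a \<in> carrier R" "w \<in> G" "mcomp M j x = a \<odot>\<^bsub>M\<^esub> t \<oplus>\<^bsub>M\<^esub> w"
        using span all parts.component_props(1)[OF x] by blast
      have a0: "rcomp 0 a \<in> rpart R 0" "rcomp 0 a \<in> carrier R"
        using aw ring_parts.component_props(1) by auto
      have wc: "w \<in> carrier M" "mcomp M j w \<in> G" using aw Gs(2) GG(2) by auto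
      obtain n where n: "n \<in> N" "mcomp M j (a \<odot>\<^bsub>M\<^esub> t) = rcomp 0 a \<odot>\<^bsub>M\<^esub> mcomp M j t \<oplus>\<^bsub>M\<^esub> n"
        using mcomp_smult_modulo[OF NN(1) low aw(1) tc] by blast
      have nc: "n \<in> G" "n \<in> carrier M" using n G(2) Gs(2) by auto
      have "mcomp M j x = mcomp M j (a \<odot>\<^bsub>M\<^esub> t \<oplus>\<^bsub>M\<^esub> w)"
        using x parts.component_component[OF x, of j j] aw(3) by simp
      also have "\<dots> = rcomp 0 a \<odot>\<^bsub>M\<^esub> t \<oplus>\<^bsub>M\<^esub> (n \<oplus>\<^bsub>M\<^esub> mcomp M j w)"
        using aw(1) tc wc nc a0 n(2) parts.component_homogeneous[OF t, of j]
        by (simp add: parts.component_add M.a_assoc)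
      finally have "rcomp 0 r \<odot>\<^bsub>M\<^esub> mcomp M j x =
          (rcomp 0 r \<otimes> rcomp 0 a) \<odot>\<^bsub>M\<^esub> t \<oplus>\<^bsub>M\<^esub> rcomp 0 r \<odot>\<^bsub>M\<^esub> (n \<oplus>\<^bsub>M\<^esub> mcomp M j w)"
        using rc a0 tc nc wc Gs(2) by (simp add: smult_r_distr smult_assoc)
      moreover have "rcomp 0 r \<otimes> rcomp 0 a \<in> m0" using R0.J_mult_right[of "rcomp 0 r" "rcomp 0 a"] rc a0 by simp
      ultimately have "rcomp 0 r \<odot>\<^bsub>M\<^esub> mcomp M j x \<in> ?E"
        using Gs(5)[OF rc(3) Gs(4)[OF nc(1) wc(2)]] by blast
      then show "r \<odot>\<^bsub>M\<^esub> x \<in> {x \<in> carrier M. mcomp M j x \<in> ?E}" using modE rc x by simp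
    qed
    then show ?thesis by simp
  qed
  obtain n y where ny: "n \<in> N" "y \<in> mM" "t = n \<oplus>\<^bsub>M\<^esub> y" using cover[OF tc] by (rule set_addE)
  have nG: "mcomp M j n \<in> G" using NN(2) ny(1) G(2) by blast
  have nc: "n \<in> carrier M" "y \<in> carrier M" using ny submoduleD(2)[OF NN(1)] mM_closed by auto
  have "t = mcomp M j n \<oplus>\<^bsub>M\<^esub> mcomp M j y"
    using parts.component_homogeneous[OF t, of j] ny(3) nc parts.component_add by simp
  then have "t \<in> ?E" using E_add[OF E_G[OF nG] mE[OF ny(2)]] by simp
  then obtain c w where c: "c \<in> m0" "w \<in> G" "t = c \<odot>\<^bsub>M\<^esub> t \<oplus>\<^bsub>M\<^esub> w" by blast
  have cc: "c \<in> carrier R" "w \<in> carrier M" using c m0_closed Gs(2) by auto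
  obtain v where v: "v \<in> rpart R 0" "v \<otimes> (\<one> \<ominus> c) = \<one>" using one_minus_m0_unit[OF c(1)] by blast
  have vc: "v \<in> carrier R" using v ring_parts.part_carrier by blast
  have "(\<one> \<ominus> c) \<odot>\<^bsub>M\<^esub> t = t \<ominus>\<^bsub>M\<^esub> c \<odot>\<^bsub>M\<^esub> t"
    using cc tc by (simp add: smult_minus_left)
  also have "\<dots> = (w \<oplus>\<^bsub>M\<^esub> c \<odot>\<^bsub>M\<^esub> t) \<ominus>\<^bsub>M\<^esub> c \<odot>\<^bsub>M\<^esub> t"
    using c(3) cc tc M.a_comm[of w "c \<odot>\<^bsub>M\<^esub> t"] by simp
  also have "\<dots> = w" using cc tc by (simp add: M.minus_eq M.a_assoc M.r_neg)
  finally have "(\<one> \<ominus> c) \<odot>\<^bsub>M\<^esub> t = w" .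
  then have "v \<odot>\<^bsub>M\<^esub> w = (v \<otimes> (\<one> \<ominus> c)) \<odot>\<^bsub>M\<^esub> t" using vc cc tc by (simp add: smult_assoc)
  then have "v \<odot>\<^bsub>M\<^esub> w = t" using v tc by simp
  then show ?thesis using Gs(5)[OF vc c(2)] by simp
qed

text \<open>By induction on the degree: in degree \<open>j\<close> everything below already lies in \<open>N\<close>, and the
  finitely many generators of degree \<open>j\<close> are removed one at a time.\<close>

lemma graded_nakayama:
  assumes S: "locally_finite_generators R M S" and N: "graded_submodule R M N"
    and cover: "\<And>x. x \<in> carrier M \<Longrightarrow> x \<in> N <+>\<^bsub>M\<^esub> mM"
  shows "N = carrier M"
proof -
  note NN = graded_submoduleD[OF N]
  have S_hom: "S \<subseteq> (\<Union>j. mpart M j)" and S_span: "submodule_span R M S = carrier M"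
    and S_fin: "\<And>j. finite (S \<inter> mpart M j)" using S by (auto simp: locally_finite_generators_def)
  have Sc: "S \<subseteq> carrier M" using S_hom parts.part_carrier by blast
  obtain j0 where j0: "\<And>j. j < j0 \<Longrightarrow> S \<inter> mpart M j \<subseteq> {\<zero>\<^bsub>M\<^esub>}"
    using S by (auto simp: locally_finite_generators_def)
  have zero_sub: "submodule {\<zero>\<^bsub>M\<^esub>} R M" by (rule submoduleI) auto
  have "submodule {x \<in> carrier M. \<forall>j<j0. mcomp M j x = \<zero>\<^bsub>M\<^esub>} R M"
  proof (rule submoduleI)
    fix r x assume r: "r \<in> carrier R" and x: "x \<in> {x \<in> carrier M. \<forall>j<j0. mcomp M j x = \<zero>\<^bsub>M\<^esub>}"
    have "mcomp M j (r \<odot>\<^bsub>M\<^esub> x) \<in> {\<zero>\<^bsub>M\<^esub>}" if "j < j0" for j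
      by (rule mcomp_smult_in[OF zero_sub r]) (use x r that in auto)
    then show "r \<odot>\<^bsub>M\<^esub> x \<in> {x \<in> carrier M. \<forall>j<j0. mcomp M j x = \<zero>\<^bsub>M\<^esub>}" using r x by auto
  qed (auto simp: parts.component_add)
  moreover have "S \<subseteq> {x \<in> carrier M. \<forall>j<j0. mcomp M j x = \<zero>\<^bsub>M\<^esub>}"
  proof
    fix s assume s: "s \<in> S"
    then obtain l where l: "s \<in> mpart M l" using S_hom by blast
    show "s \<in> {x \<in> carrier M. \<forall>j<j0. mcomp M j x = \<zero>\<^bsub>M\<^esub>}"
      using s Sc j0[of l] l parts.component_homogeneous[OF l] by auto
  qed
  ultimately have low: "mcomp M j x = \<zero>\<^bsub>M\<^esub>" if "j < j0" "x \<in> carrier M" for j x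
    using span_minimal[of "{x \<in> carrier M. \<forall>j<j0. mcomp M j x = \<zero>\<^bsub>M\<^esub>}" S x] S_span that by auto
  have start: "mpart M j \<subseteq> N" if "j < j0" for j
  proof
    fix x assume x: "x \<in> mpart M j"
    then show "x \<in> N"
      using low[OF that parts.part_carrier[OF x]] parts.component_homogeneous[OF x, of j] submoduleD(3)[OF NN(1)]
      by simp
  qed
  have step: "mpart M j \<subseteq> N" if below: "\<And>l. l < j \<Longrightarrow> mpart M l \<subseteq> N" for j
  proof -
    have remove: "mpart M j \<subseteq> N"
      if "finite T" "T \<subseteq> mpart M j" "mpart M j \<subseteq> submodule_span R M (T \<union> N)" for T
      using that
    proof (induction T)
      case empty
      then show ?case using span_minimal[OF NN(1), of N] by auto
    next
      case (insert t T)
      let ?G = "submodule_span R M (T \<union> N)"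
      have c: "T \<union> N \<subseteq> carrier M" using insert submoduleD(2)[OF NN(1)] parts.part_carrier by blast
      have tc: "t \<in> carrier M" using insert parts.part_carrier by blast
      have G: "graded_submodule R M ?G"
      proof (rule graded_submodule_span[OF c])
        fix s i assume s: "s \<in> T \<union> N"
        show "mcomp M i s \<in> ?G"
        proof (cases "s \<in> N")
          case True
          then show ?thesis using NN(2) span_subset by blast
        next
          case False
          then have "s \<in> T" "s \<in> mpart M j" using s insert by auto
          then show ?thesis
            using span_subset[of s "T \<union> N"] submoduleD(3)[OF submodule_span_submodule[OF c]]
              parts.component_homogeneous[of s j i] by auto
        qed
      qed
      have NG: "N \<subseteq> ?G" using span_subset by blast
      have "submodule_span R M (insert t T \<union> N) \<subseteq> submodule_span R M (insert t ?G)"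
        unfolding submodule_span_def by (rule hull_minimal)
          (use span_subset[of _ "T \<union> N"] span_subset[of _ "insert t ?G"] tc c
            submodule_span_submodule[of "insert t ?G"] span_closed[OF c]
            in \<open>auto simp: submodule_span_def\<close>)
      then have tG: "t \<in> ?G"
        using insert by (intro nakayama_remove_generator[OF N below cover G NG, of j]) auto
      have "insert t T \<union> N \<subseteq> ?G" using tG span_subset[of _ "T \<union> N"] by blast
      then have "submodule_span R M (insert t T \<union> N) \<subseteq> ?G"
        using span_minimal[OF submodule_span_submodule[OF c]] by blast
      then show ?case using insert by blast
    qed
    let ?T = "S \<inter> mpart M j"
    let ?G = "submodule_span R M (?T \<union> N)"
    have c: "?T \<union> N \<subseteq> carrier M" using Sc submoduleD(2)[OF NN(1)] by blast
    note Gs = submoduleD[OF submodule_span_submodule[OF c]]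
    have "submodule {x \<in> carrier M. mcomp M j x \<in> ?G} R M"
    proof (rule submoduleI)
      fix r x assume r: "r \<in> carrier R" and x: "x \<in> {x \<in> carrier M. mcomp M j x \<in> ?G}"
      then have xc: "x \<in> carrier M" by simp
      obtain n where "n \<in> N" "mcomp M j (r \<odot>\<^bsub>M\<^esub> x) = rcomp 0 r \<odot>\<^bsub>M\<^esub> mcomp M j x \<oplus>\<^bsub>M\<^esub> n"
        using mcomp_smult_modulo[OF NN(1) below r xc] by blast
      moreover have "rcomp 0 r \<odot>\<^bsub>M\<^esub> mcomp M j x \<in> ?G" using Gs(5) x r by blast
      ultimately show "r \<odot>\<^bsub>M\<^esub> x \<in> {x \<in> carrier M. mcomp M j x \<in> ?G}"
        using Gs(4) span_subset[of n "?T \<union> N"] r xc by simp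
    qed (auto simp: parts.component_add Gs)
    moreover have "S \<subseteq> {x \<in> carrier M. mcomp M j x \<in> ?G}"
    proof
      fix s assume s: "s \<in> S"
      then obtain l where l: "s \<in> mpart M l" using S_hom by blast
      then show "s \<in> {x \<in> carrier M. mcomp M j x \<in> ?G}"
        using s Sc span_subset[of s "?T \<union> N"] Gs(3) parts.component_homogeneous[OF l, of j] by auto
    qed
    ultimately have "mcomp M j x \<in> ?G" if "x \<in> carrier M" for x
      using span_minimal[of "{x \<in> carrier M. mcomp M j x \<in> ?G}" S x] S_span that by blast
    then have "mpart M j \<subseteq> ?G"
      using parts.component_homogeneous parts.part_carrier by (metis subsetI)
    then show ?thesis using remove[of ?T] S_fin by blast
  qed
  have "\<forall>j < j0 + int k. mpart M j \<subseteq> N" for k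
  proof (induction k)
    case 0
    then show ?case using start by simp
  next
    case (Suc k)
    show ?case
    proof (intro allI impI)
      fix j assume "j < j0 + int (Suc k)"
      then have "\<And>l. l < j \<Longrightarrow> l < j0 + int k" by simp
      then show "mpart M j \<subseteq> N" using step[of j] Suc by blast
    qed
  qed
  moreover have "\<exists>k. j < j0 + int k" for j by (rule exI[of _ "nat (j - j0 + 1)"]) linarith
  ultimately have "mpart M j \<subseteq> N" for j by blast
  then have "x \<in> N" if "x \<in> carrier M" for x
    using parts.additive_in_subgroup[OF that submoduleD(1)[OF NN(1)]] parts.component_props(1)[OF that] by blast
  then show ?thesis using submoduleD(2)[OF NN(1)] by blast
qed

end

lemma (in graded_linear) locally_finite_generators_image:
  assumes S: "locally_finite_generators R M S" and surj: "f ` carrier M = carrier N"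
  shows "locally_finite_generators R N (f ` S)"
proof -
  interpret M: graded_module R M by (rule dom)
  interpret N: graded_module R N by (rule cod)
  have S_hom: "S \<subseteq> (\<Union>j. mpart M j)" and S_span: "submodule_span R M S = carrier M"
    and S_fin: "\<And>j. finite (S \<inter> mpart M j)" using S by (auto simp: locally_finite_generators_def)
  obtain j0 where j0: "\<And>j. j < j0 \<Longrightarrow> S \<inter> mpart M j \<subseteq> {\<zero>\<^bsub>M\<^esub>}"
    using S by (auto simp: locally_finite_generators_def)
  have Sc: "S \<subseteq> carrier M" using S_hom M.parts.part_carrier by blast
  have sub: "f ` S \<inter> mpart N j \<subseteq> insert \<zero>\<^bsub>N\<^esub> (f ` (S \<inter> mpart M (j - t)))" for j
  proof
    fix y assume y: "y \<in> f ` S \<inter> mpart N j"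
    then obtain s l where s: "s \<in> S" "y = f s" "s \<in> mpart M l" using S_hom by blast
    show "y \<in> insert \<zero>\<^bsub>N\<^esub> (f ` (S \<inter> mpart M (j - t)))"
    proof (cases "l = j - t")
      case True
      then show ?thesis using s by blast
    next
      case False
      then have "y = \<zero>\<^bsub>N\<^esub>"
        using N.parts.component_homogeneous[of y j j] N.parts.component_homogeneous[OF part[OF s(3)], of j] y s(2)
        by auto
      then show ?thesis by simp
    qed
  qed
  show ?thesis
    unfolding locally_finite_generators_def
  proof (intro conjI allI exI[of _ "j0 + t"] impI)
    show "f ` S \<subseteq> (\<Union>j. mpart N j)" using S_hom part by blast
    show "submodule_span R N (f ` S) = carrier N" using image_span[OF Sc] S_span surj by simp
    show "finite (f ` S \<inter> mpart N j)" for j by (rule finite_subset[OF sub]) (use S_fin in simp)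
    show "f ` S \<inter> mpart N j \<subseteq> {\<zero>\<^bsub>N\<^esub>}" if "j < j0 + t" for j
    proof -
      have "S \<inter> mpart M (j - t) \<subseteq> {\<zero>\<^bsub>M\<^esub>}" using j0[of "j - t"] that by simp
      then have "f ` (S \<inter> mpart M (j - t)) \<subseteq> {\<zero>\<^bsub>N\<^esub>}" using zero by blast
      then show ?thesis using sub[of j] by blast
    qed
  qed
qed

section \<open>Free graded modules\<close>

text \<open>Extended by zero outside \<open>B\<close>, so that supports can be formed over the whole type.\<close>

definition coord :: "('a, 'x) ring_scheme \<Rightarrow> ('a, 'b, 'y) module_scheme \<Rightarrow> 'b set \<Rightarrow> 'b \<Rightarrow> 'b \<Rightarrow> 'a" where
  "coord R M B x b = (if b \<in> B then (THE c. c \<in> B \<rightarrow>\<^sub>E carrier R \<and> finite {b \<in> B. c b \<noteq> \<zero>\<^bsub>R\<^esub>} \<and>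
        x = (\<Oplus>\<^bsub>M\<^esub>b\<in>{b \<in> B. c b \<noteq> \<zero>\<^bsub>R\<^esub>}. c b \<odot>\<^bsub>M\<^esub> b)) b else \<zero>\<^bsub>R\<^esub>)"

locale based_module = left_module R M
  for R :: "('a, 'x) ring_scheme" (structure) and M :: "('a, 'b, 'y) module_scheme" (structure) +
  fixes B :: "'b set"
  assumes basis: "module_basis R M B"
begin

lemma basis_carrier: "b \<in> B \<Longrightarrow> b \<in> carrier M"
  using basis by (auto simp: module_basis_def)

lemma coord_props:
  assumes "x \<in> carrier M"
  shows coord_closed [simp]: "coord R M B x b \<in> carrier R"
    and coord_finite: "finite {b. coord R M B x b \<noteq> \<zero>}"
    and coord_support: "{b. coord R M B x b \<noteq> \<zero>} \<subseteq> B"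
    and coord_sum: "x = (\<Oplus>\<^bsub>M\<^esub>b\<in>{b. coord R M B x b \<noteq> \<zero>}. coord R M B x b \<odot>\<^bsub>M\<^esub> b)"
proof -
  let ?P = "\<lambda>c. c \<in> B \<rightarrow>\<^sub>E carrier R \<and> finite {b \<in> B. c b \<noteq> \<zero>} \<and>
      x = (\<Oplus>\<^bsub>M\<^esub>b\<in>{b \<in> B. c b \<noteq> \<zero>}. c b \<odot>\<^bsub>M\<^esub> b)"
  define d where "d = (THE c. ?P c)"
  have "\<exists>!c. ?P c" using basis assms unfolding module_basis_def by blast
  from theI'[OF this] have d: "?P d" unfolding d_def .
  have cd: "coord R M B x b = (if b \<in> B then d b else \<zero>)" for b
    unfolding coord_def d_def ..
  have S: "{b. coord R M B x b \<noteq> \<zero>} = {b \<in> B. d b \<noteq> \<zero>}" by (auto simp: cd)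
  have dR: "\<And>b. b \<in> B \<Longrightarrow> d b \<in> carrier R" and dfin: "finite {b \<in> B. d b \<noteq> \<zero>}"
    using d by (blast dest: PiE_mem)+
  show "coord R M B x b \<in> carrier R" using dR by (auto simp: cd)
  show "finite {b. coord R M B x b \<noteq> \<zero>}" "{b. coord R M B x b \<noteq> \<zero>} \<subseteq> B" using dfin by (auto simp: S)
  have "(\<Oplus>\<^bsub>M\<^esub>b\<in>{b \<in> B. d b \<noteq> \<zero>}. d b \<odot>\<^bsub>M\<^esub> b) =
      (\<Oplus>\<^bsub>M\<^esub>b\<in>{b. coord R M B x b \<noteq> \<zero>}. coord R M B x b \<odot>\<^bsub>M\<^esub> b)"
    by (rule M.finsum_cong') (use dR basis_carrier in \<open>auto simp: S cd\<close>)
  then show "x = (\<Oplus>\<^bsub>M\<^esub>b\<in>{b. coord R M B x b \<noteq> \<zero>}. coord R M B x b \<odot>\<^bsub>M\<^esub> b)" using d by simp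
qed

lemma coord_sum_superset:
  assumes "x \<in> carrier M" and "finite A" and "{b. coord R M B x b \<noteq> \<zero>} \<subseteq> A" and "A \<subseteq> B"
  shows "x = (\<Oplus>\<^bsub>M\<^esub>b\<in>A. coord R M B x b \<odot>\<^bsub>M\<^esub> b)"
proof -
  have "(\<Oplus>\<^bsub>M\<^esub>b\<in>{b. coord R M B x b \<noteq> \<zero>}. coord R M B x b \<odot>\<^bsub>M\<^esub> b) = (\<Oplus>\<^bsub>M\<^esub>b\<in>A. coord R M B x b \<odot>\<^bsub>M\<^esub> b)"
  proof (rule M.finsum_superset[OF assms(2,3)])
    show "coord R M B x b \<odot>\<^bsub>M\<^esub> b = \<zero>\<^bsub>M\<^esub>" if "b \<in> A - {b. coord R M B x b \<noteq> \<zero>}" for b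
      using that assms basis_carrier by auto
    show "(\<lambda>b. coord R M B x b \<odot>\<^bsub>M\<^esub> b) \<in> {b. coord R M B x b \<noteq> \<zero>} \<rightarrow> carrier M"
      using assms(1) coord_support[OF assms(1)] basis_carrier by auto
  qed
  then show ?thesis using coord_sum[OF assms(1)] by simp
qed

lemma coord_unique:
  assumes "finite A" and "A \<subseteq> B" and "\<And>b. b \<in> A \<Longrightarrow> c b \<in> carrier R"
    and "x = (\<Oplus>\<^bsub>M\<^esub>b\<in>A. c b \<odot>\<^bsub>M\<^esub> b)"
  shows "coord R M B x b = (if b \<in> A then c b else \<zero>)"
proof -
  let ?P = "\<lambda>c. c \<in> B \<rightarrow>\<^sub>E carrier R \<and> finite {b \<in> B. c b \<noteq> \<zero>} \<and>
      x = (\<Oplus>\<^bsub>M\<^esub>b\<in>{b \<in> B. c b \<noteq> \<zero>}. c b \<odot>\<^bsub>M\<^esub> b)"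
  define d where "d b = (if b \<in> B then (if b \<in> A then c b else \<zero>) else undefined)" for b
  have Ac: "b \<in> carrier M" if "b \<in> A" for b using that assms(2) basis_carrier by blast
  have S: "{b \<in> B. d b \<noteq> \<zero>} \<subseteq> A" by (auto simp: d_def)
  have "(\<Oplus>\<^bsub>M\<^esub>b\<in>{b \<in> B. d b \<noteq> \<zero>}. d b \<odot>\<^bsub>M\<^esub> b) = (\<Oplus>\<^bsub>M\<^esub>b\<in>A. d b \<odot>\<^bsub>M\<^esub> b)"
  proof (rule M.finsum_superset[OF assms(1) S])
    show "d b \<odot>\<^bsub>M\<^esub> b = \<zero>\<^bsub>M\<^esub>" if "b \<in> A - {b \<in> B. d b \<noteq> \<zero>}" for b
      using that Ac assms(2) by (auto simp: d_def)
    show "(\<lambda>b. d b \<odot>\<^bsub>M\<^esub> b) \<in> {b \<in> B. d b \<noteq> \<zero>} \<rightarrow> carrier M"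
      using Ac assms(3) by (auto simp: d_def)
  qed
  also have "\<dots> = x" unfolding assms(4)
    by (rule M.finsum_cong') (use Ac assms(2,3) in \<open>auto simp: d_def\<close>)
  finally have "x = (\<Oplus>\<^bsub>M\<^esub>b\<in>{b \<in> B. d b \<noteq> \<zero>}. d b \<odot>\<^bsub>M\<^esub> b)" by simp
  moreover have "d \<in> B \<rightarrow>\<^sub>E carrier R" using assms(3) by (auto simp: d_def)
  moreover have "finite {b \<in> B. d b \<noteq> \<zero>}" using S assms(1) by (rule finite_subset)
  ultimately have Pd: "?P d" by blast
  have "x \<in> carrier M" unfolding assms(4) using Ac assms(3) by (auto intro: M.finsum_closed)
  then have "\<exists>!c. ?P c" using basis unfolding module_basis_def by blast
  then have "(THE c. ?P c) = d" using Pd by (rule the1_equality[of ?P d])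
  then have "coord R M B x b = (if b \<in> B then d b else \<zero>)" unfolding coord_def by simp
  then show ?thesis using assms(2) by (auto simp: d_def)
qed

lemma coord_add:
  assumes "x \<in> carrier M" and "y \<in> carrier M"
  shows "coord R M B (x \<oplus>\<^bsub>M\<^esub> y) b = coord R M B x b \<oplus> coord R M B y b"
proof -
  let ?A = "{b. coord R M B x b \<noteq> \<zero>} \<union> {b. coord R M B y b \<noteq> \<zero>}"
  have A: "finite ?A" "?A \<subseteq> B" using assms coord_finite coord_support by auto
  have c: "b \<in> ?A \<Longrightarrow> b \<in> carrier M" for b using A basis_carrier by blast
  have "x \<oplus>\<^bsub>M\<^esub> y = (\<Oplus>\<^bsub>M\<^esub>b\<in>?A. coord R M B x b \<odot>\<^bsub>M\<^esub> b) \<oplus>\<^bsub>M\<^esub> (\<Oplus>\<^bsub>M\<^esub>b\<in>?A. coord R M B y b \<odot>\<^bsub>M\<^esub> b)"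
    using coord_sum_superset[OF assms(1) A(1) _ A(2)] coord_sum_superset[OF assms(2) A(1) _ A(2)] by simp
  also have "\<dots> = (\<Oplus>\<^bsub>M\<^esub>b\<in>?A. coord R M B x b \<odot>\<^bsub>M\<^esub> b \<oplus>\<^bsub>M\<^esub> coord R M B y b \<odot>\<^bsub>M\<^esub> b)"
    by (rule M.finsum_addf[symmetric]) (use assms c in auto)
  also have "\<dots> = (\<Oplus>\<^bsub>M\<^esub>b\<in>?A. (coord R M B x b \<oplus> coord R M B y b) \<odot>\<^bsub>M\<^esub> b)"
    by (rule M.finsum_cong') (use assms c in \<open>auto simp: smult_l_distr\<close>)
  finally have "coord R M B (x \<oplus>\<^bsub>M\<^esub> y) b = (if b \<in> ?A then coord R M B x b \<oplus> coord R M B y b else \<zero>)"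
    by (intro coord_unique[OF A]) (use assms in auto)
  then show ?thesis by auto
qed

lemma coord_smult:
  assumes "r \<in> carrier R" and "x \<in> carrier M"
  shows "coord R M B (r \<odot>\<^bsub>M\<^esub> x) b = r \<otimes> coord R M B x b"
proof -
  let ?A = "{b. coord R M B x b \<noteq> \<zero>}"
  have A: "finite ?A" "?A \<subseteq> B" using assms coord_finite coord_support by auto
  have c: "b \<in> ?A \<Longrightarrow> b \<in> carrier M" for b using A basis_carrier by blast
  have "r \<odot>\<^bsub>M\<^esub> x = r \<odot>\<^bsub>M\<^esub> (\<Oplus>\<^bsub>M\<^esub>b\<in>?A. coord R M B x b \<odot>\<^bsub>M\<^esub> b)" using coord_sum[OF assms(2)] by simp
  also have "\<dots> = (\<Oplus>\<^bsub>M\<^esub>b\<in>?A. r \<odot>\<^bsub>M\<^esub> (coord R M B x b \<odot>\<^bsub>M\<^esub> b))"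
    by (rule smult_finsum) (use assms c in auto)
  also have "\<dots> = (\<Oplus>\<^bsub>M\<^esub>b\<in>?A. (r \<otimes> coord R M B x b) \<odot>\<^bsub>M\<^esub> b)"
    by (rule M.finsum_cong') (use assms c in \<open>auto simp: smult_assoc\<close>)
  finally have "coord R M B (r \<odot>\<^bsub>M\<^esub> x) b = (if b \<in> ?A then r \<otimes> coord R M B x b else \<zero>)"
    by (intro coord_unique[OF A]) (use assms in auto)
  then show ?thesis using assms by auto
qed

lemma coord_basis: "b \<in> B \<Longrightarrow> coord R M B b b' = (if b' = b then \<one> else \<zero>)"
  using coord_unique[of "{b}" "\<lambda>_. \<one>" b b'] basis_carrier by auto

lemma coord_zero: "coord R M B \<zero>\<^bsub>M\<^esub> b = \<zero>"
  using coord_unique[of "{}" "\<lambda>_. \<zero>"] by simp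

lemma basis_nonzero: "b \<in> B \<Longrightarrow> \<one> \<noteq> \<zero> \<Longrightarrow> b \<noteq> \<zero>\<^bsub>M\<^esub>"
  using coord_basis[of b b] coord_zero[of b] by auto

lemma basis_span: "submodule_span R M B = carrier M"
proof
  have B: "B \<subseteq> carrier M" using basis_carrier by blast
  note s = submodule_span_submodule[OF B]
  show "submodule_span R M B \<subseteq> carrier M" using span_closed[OF B] by blast
  show "carrier M \<subseteq> submodule_span R M B"
  proof
    fix x assume x: "x \<in> carrier M"
    have "(\<Oplus>\<^bsub>M\<^esub>b\<in>{b. coord R M B x b \<noteq> \<zero>}. coord R M B x b \<odot>\<^bsub>M\<^esub> b) \<in> submodule_span R M B"
      using coord_support[OF x] x by (intro submodule_finsum[OF s] submoduleD(5)[OF s] span_subset) auto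
    then show "x \<in> submodule_span R M B" using coord_sum[OF x] by simp
  qed
qed

lemma basis_independent:
  assumes "finite A" and "A \<subseteq> B" and "\<And>b. b \<in> A \<Longrightarrow> c b \<in> carrier R"
    and "(\<Oplus>\<^bsub>M\<^esub>b\<in>A. c b \<odot>\<^bsub>M\<^esub> b) = \<zero>\<^bsub>M\<^esub>" and "b \<in> A"
  shows "c b = \<zero>"
  using coord_unique[OF assms(1-3) assms(4)[symmetric], of b] coord_zero[of b] assms(5) by simp

end

lemma (in left_module) module_basisI:
  assumes B: "B \<subseteq> carrier M" and span: "carrier M \<subseteq> submodule_span R M B"
    and indep: "\<And>A c b. \<lbrakk>finite A; A \<subseteq> B; \<And>b. b \<in> A \<Longrightarrow> c b \<in> carrier R;
      (\<Oplus>\<^bsub>M\<^esub>b\<in>A. c b \<odot>\<^bsub>M\<^esub> b) = \<zero>\<^bsub>M\<^esub>; b \<in> A\<rbrakk> \<Longrightarrow> c b = \<zero>"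
  shows "module_basis R M B"
  unfolding module_basis_def
proof (intro conjI ballI ex_ex1I)
  show "B \<subseteq> carrier M" by (rule B)
  fix x assume x: "x \<in> carrier M"
  then obtain A c where A: "finite A" "A \<subseteq> B" "c \<in> A \<rightarrow> carrier R" "x = (\<Oplus>\<^bsub>M\<^esub>s\<in>A. c s \<odot>\<^bsub>M\<^esub> s)"
    using in_spanE[OF B, of x] span by blast
  define d where "d b = (if b \<in> B then (if b \<in> A then c b else \<zero>) else undefined)" for b
  have Ac: "b \<in> carrier M" "c b \<in> carrier R" if "b \<in> A" for b using that A(2,3) B by auto
  have S: "{b \<in> B. d b \<noteq> \<zero>} \<subseteq> A" by (auto simp: d_def)
  have "(\<Oplus>\<^bsub>M\<^esub>b\<in>{b \<in> B. d b \<noteq> \<zero>}. d b \<odot>\<^bsub>M\<^esub> b) = (\<Oplus>\<^bsub>M\<^esub>b\<in>A. d b \<odot>\<^bsub>M\<^esub> b)"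
  proof (rule M.finsum_superset[OF A(1) S])
    show "d b \<odot>\<^bsub>M\<^esub> b = \<zero>\<^bsub>M\<^esub>" if "b \<in> A - {b \<in> B. d b \<noteq> \<zero>}" for b
      using that Ac A(2) by (auto simp: d_def)
    show "(\<lambda>b. d b \<odot>\<^bsub>M\<^esub> b) \<in> {b \<in> B. d b \<noteq> \<zero>} \<rightarrow> carrier M"
      using Ac by (auto simp: d_def)
  qed
  also have "\<dots> = x" unfolding A(4)
    by (rule M.finsum_cong') (use Ac A(2) in \<open>auto simp: d_def\<close>)
  finally have "x = (\<Oplus>\<^bsub>M\<^esub>b\<in>{b \<in> B. d b \<noteq> \<zero>}. d b \<odot>\<^bsub>M\<^esub> b)" by simp
  moreover have "d \<in> B \<rightarrow>\<^sub>E carrier R" using Ac by (auto simp: d_def)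
  moreover have "finite {b \<in> B. d b \<noteq> \<zero>}" using S A(1) by (rule finite_subset)
  ultimately show "\<exists>c. c \<in> B \<rightarrow>\<^sub>E carrier R \<and> finite {b \<in> B. c b \<noteq> \<zero>} \<and>
      x = (\<Oplus>\<^bsub>M\<^esub>b\<in>{b \<in> B. c b \<noteq> \<zero>}. c b \<odot>\<^bsub>M\<^esub> b)" by blast
next
  fix x c d
  assume c: "c \<in> B \<rightarrow>\<^sub>E carrier R \<and> finite {b \<in> B. c b \<noteq> \<zero>} \<and> x = (\<Oplus>\<^bsub>M\<^esub>b\<in>{b \<in> B. c b \<noteq> \<zero>}. c b \<odot>\<^bsub>M\<^esub> b)"
    and d: "d \<in> B \<rightarrow>\<^sub>E carrier R \<and> finite {b \<in> B. d b \<noteq> \<zero>} \<and> x = (\<Oplus>\<^bsub>M\<^esub>b\<in>{b \<in> B. d b \<noteq> \<zero>}. d b \<odot>\<^bsub>M\<^esub> b)"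
  let ?A = "{b \<in> B. c b \<noteq> \<zero>} \<union> {b \<in> B. d b \<noteq> \<zero>}"
  have A: "finite ?A" "?A \<subseteq> B" using c d by auto
  have cl: "c b \<in> carrier R" "d b \<in> carrier R" "b \<in> carrier M" if "b \<in> B" for b
    using that c d B by (auto simp: PiE_def Pi_def)
  have ext: "(\<Oplus>\<^bsub>M\<^esub>b\<in>{b \<in> B. e b \<noteq> \<zero>}. e b \<odot>\<^bsub>M\<^esub> b) = (\<Oplus>\<^bsub>M\<^esub>b\<in>?A. e b \<odot>\<^bsub>M\<^esub> b)"
    if "{b \<in> B. e b \<noteq> \<zero>} \<subseteq> ?A" "\<And>b. b \<in> B \<Longrightarrow> e b \<in> carrier R" for e
    by (rule M.finsum_superset[OF A(1) that(1)]) (use that cl(3) in auto)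
  have xc: "x = (\<Oplus>\<^bsub>M\<^esub>b\<in>?A. c b \<odot>\<^bsub>M\<^esub> b)" using ext[of c] cl(1) c by simp
  have xd: "x = (\<Oplus>\<^bsub>M\<^esub>b\<in>?A. d b \<odot>\<^bsub>M\<^esub> b)" using ext[of d] cl(2) d by simp
  have xcl: "x \<in> carrier M" unfolding xc using cl by (intro M.finsum_closed) auto
  have "x = (\<Oplus>\<^bsub>M\<^esub>b\<in>?A. (c b \<ominus> d b) \<odot>\<^bsub>M\<^esub> b \<oplus>\<^bsub>M\<^esub> d b \<odot>\<^bsub>M\<^esub> b)"
    unfolding xc
    by (rule M.finsum_cong') (use cl in \<open>auto simp: smult_l_distr[symmetric] R.add_minus_cancel\<close>)
  also have "\<dots> = (\<Oplus>\<^bsub>M\<^esub>b\<in>?A. (c b \<ominus> d b) \<odot>\<^bsub>M\<^esub> b) \<oplus>\<^bsub>M\<^esub> x"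
    unfolding xd by (rule M.finsum_addf) (use cl in auto)
  finally have "(\<Oplus>\<^bsub>M\<^esub>b\<in>?A. (c b \<ominus> d b) \<odot>\<^bsub>M\<^esub> b) \<oplus>\<^bsub>M\<^esub> x = x" ..
  moreover have scl: "(\<Oplus>\<^bsub>M\<^esub>b\<in>?A. (c b \<ominus> d b) \<odot>\<^bsub>M\<^esub> b) \<in> carrier M"
    using cl by (intro M.finsum_closed) auto
  ultimately have z: "(\<Oplus>\<^bsub>M\<^esub>b\<in>?A. (c b \<ominus> d b) \<odot>\<^bsub>M\<^esub> b) = \<zero>\<^bsub>M\<^esub>"
    using M.add.r_cancel_one[OF xcl scl] by simp
  have "c b = d b" if "b \<in> B" for b
  proof (cases "b \<in> ?A")
    case True
    have "c b \<ominus> d b = \<zero>" using indep[OF A _ z True] cl by auto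
    then show ?thesis using cl[OF that] R.add_minus_cancel(1)[of "c b" "d b"] by simp
  next
    case False
    then show ?thesis using that by auto
  qed
  then show "c = d" using c d by (intro PiE_ext[of c B "\<lambda>_. carrier R" d]) auto
qed

locale free_module = based_module R M B + graded_module R M
  for R :: "('a, 'x) gr_ring_scheme" (structure) and M :: "('a, 'b, 'y) gr_module_scheme" (structure)
    and B :: "'b set" +
  assumes homogeneous_basis: "B \<subseteq> (\<Union>j. mpart M j)" and nontrivial: "\<one> \<noteq> \<zero>"
begin

lemma basis_degree_unique:
  assumes "b \<in> B" and "b \<in> mpart M i" and "b \<in> mpart M j"
  shows "i = j"
  using parts.component_homogeneous[OF assms(2), of i] parts.component_homogeneous[OF assms(3), of i]
    basis_nonzero[OF assms(1) nontrivial] by (auto split: if_splits)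

text \<open>Replacing each coordinate of a homogeneous element by its part of the right degree yields
  coordinates of the same element.\<close>

lemma coord_homogeneous:
  assumes x: "x \<in> mpart M j" and b: "b \<in> B" "b \<in> mpart M i"
  shows "if i \<le> j then coord R M B x b \<in> rpart R (nat (j - i)) else coord R M B x b = \<zero>"
proof -
  have xc: "x \<in> carrier M" using x parts.part_carrier by blast
  let ?c = "coord R M B x" and ?A = "{b. coord R M B x b \<noteq> \<zero>}"
  obtain dg where dg: "\<And>b. b \<in> B \<Longrightarrow> b \<in> mpart M (dg b)" using homogeneous_basis by (metis UN_E subsetD)
  define c' where "c' b = (if dg b \<le> j then rcomp (nat (j - dg b)) (?c b) else \<zero>)" for b
  have A: "finite ?A" "?A \<subseteq> B" using xc coord_finite coord_support by auto
  have cl: "b \<in> ?A \<Longrightarrow> b \<in> carrier M" for b using A basis_carrier by blast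
  have term_eq: "mcomp M j (r \<odot>\<^bsub>M\<^esub> b) = (if dg b \<le> j then rcomp (nat (j - dg b)) r else \<zero>) \<odot>\<^bsub>M\<^esub> b"
    if "r \<in> carrier R" "b \<in> B" for r b
    using that(1)
  proof (induction rule: ring_parts.homogeneous_induct)
    case zero
    then show ?case using basis_carrier[OF that(2)] by simp
  next
    case (add x y)
    then show ?case using basis_carrier[OF that(2)]
      by (auto simp: smult_l_distr parts.component_add ring_parts.component_add)
  next
    case (part l r)
    have rc: "r \<in> carrier R" using part ring_parts.part_carrier by blast
    have h: "r \<odot>\<^bsub>M\<^esub> b \<in> mpart M (int l + dg b)" using smult_mpart[OF part dg[OF that(2)]] .
    show ?case
      using parts.component_homogeneous[OF h, of j] ring_parts.component_homogeneous[OF part]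
        basis_carrier[OF that(2)] rc by (auto simp: nat_eq_iff)
  qed
  have "x = mcomp M j x" using parts.component_homogeneous[OF x, of j] by simp
  also have "\<dots> = mcomp M j (\<Oplus>\<^bsub>M\<^esub>b\<in>?A. ?c b \<odot>\<^bsub>M\<^esub> b)" using coord_sum[OF xc] by simp
  also have "\<dots> = (\<Oplus>\<^bsub>M\<^esub>b\<in>?A. mcomp M j (?c b \<odot>\<^bsub>M\<^esub> b))"
    by (rule abelian_group_hom.hom_finsum[OF parts.component_hom]) (use cl xc in auto)
  also have "\<dots> = (\<Oplus>\<^bsub>M\<^esub>b\<in>?A. c' b \<odot>\<^bsub>M\<^esub> b)"
    by (rule M.finsum_cong') (use cl xc A in \<open>auto simp: term_eq c'_def\<close>)
  finally have "?c b = (if b \<in> ?A then c' b else \<zero>)"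
    by (intro coord_unique[OF A]) (use xc in \<open>auto simp: c'_def\<close>)
  then have "?c b = c' b \<or> ?c b = \<zero>" by presburger
  moreover have "dg b = i" using basis_degree_unique dg b by blast
  ultimately have "?c b = (if i \<le> j then rcomp (nat (j - i)) (?c b) else \<zero>) \<or> ?c b = \<zero>"
    unfolding c'_def by meson
  moreover have "rcomp (nat (j - i)) (?c b) \<in> rpart R (nat (j - i))"
    using ring_parts.component_props(1) coord_closed[OF xc] by blast
  ultimately obtain y where "?c b = (if i \<le> j then y else \<zero>) \<or> ?c b = \<zero>" "y \<in> rpart R (nat (j - i))"
    by meson
  then show ?thesis by auto
qed

text \<open>The universal property. The map is graded because coordinates of homogeneous elements are
  homogeneous.\<close>

lemma free_extension:
  fixes N :: "('a, 'c, 'z) gr_module_scheme"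
  assumes "graded_module R N" and \<beta>: "\<And>b j. b \<in> B \<Longrightarrow> b \<in> mpart M j \<Longrightarrow> \<beta> b \<in> mpart N (t + j)"
  obtains f where "f \<in> deg_hom R t M N" and "\<forall>b \<in> B. f b = \<beta> b"
proof -
  interpret N: graded_module R N by fact
  let ?c = "coord R M B"
  have \<beta>c: "\<beta> b \<in> carrier N" if "b \<in> B" for b
    using that \<beta> homogeneous_basis N.parts.part_carrier by blast
  define f where "f x = (\<Oplus>\<^bsub>N\<^esub>b\<in>{b. ?c x b \<noteq> \<zero>}. ?c x b \<odot>\<^bsub>N\<^esub> \<beta> b)" for x
  have f_super: "f x = (\<Oplus>\<^bsub>N\<^esub>b\<in>A. ?c x b \<odot>\<^bsub>N\<^esub> \<beta> b)"
    if "x \<in> carrier M" "finite A" "{b. ?c x b \<noteq> \<zero>} \<subseteq> A" "A \<subseteq> B" for x A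
    unfolding f_def
  proof (rule N.M.finsum_superset[OF that(2,3)])
    show "?c x b \<odot>\<^bsub>N\<^esub> \<beta> b = \<zero>\<^bsub>N\<^esub>" if "b \<in> A - {b. ?c x b \<noteq> \<zero>}" for b
      using that \<beta>c \<open>A \<subseteq> B\<close> by auto
    show "(\<lambda>b. ?c x b \<odot>\<^bsub>N\<^esub> \<beta> b) \<in> {b. ?c x b \<noteq> \<zero>} \<rightarrow> carrier N"
      using \<beta>c coord_support[OF that(1)] that(1) by auto
  qed
  have "f \<in> deg_hom R t M N"
    unfolding deg_hom_def
  proof (intro CollectI conjI ballI allI)
    show "f \<in> carrier M \<rightarrow> carrier N"
    proof
      fix x assume x: "x \<in> carrier M"
      show "f x \<in> carrier N" unfolding f_def
        using coord_support[OF x] x \<beta>c by (intro N.M.finsum_closed) auto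
    qed
    fix x y assume x: "x \<in> carrier M" and y: "y \<in> carrier M"
    let ?A = "{b. ?c x b \<noteq> \<zero>} \<union> {b. ?c y b \<noteq> \<zero>}"
    have A: "finite ?A" "?A \<subseteq> B" using x y coord_finite coord_support by auto
    have A\<beta>: "\<beta> b \<in> carrier N" if "b \<in> ?A" for b using that A(2) \<beta>c by blast
    have "{b. ?c (x \<oplus>\<^bsub>M\<^esub> y) b \<noteq> \<zero>} \<subseteq> ?A" using x y by (auto simp: coord_add)
    then have "f (x \<oplus>\<^bsub>M\<^esub> y) = (\<Oplus>\<^bsub>N\<^esub>b\<in>?A. ?c (x \<oplus>\<^bsub>M\<^esub> y) b \<odot>\<^bsub>N\<^esub> \<beta> b)"
      by (intro f_super[OF _ A(1) _ A(2)]) (use x y in auto)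
    also have "\<dots> = (\<Oplus>\<^bsub>N\<^esub>b\<in>?A. ?c x b \<odot>\<^bsub>N\<^esub> \<beta> b \<oplus>\<^bsub>N\<^esub> ?c y b \<odot>\<^bsub>N\<^esub> \<beta> b)"
      by (rule N.M.finsum_cong') (use x y A\<beta> in \<open>auto simp: coord_add N.smult_l_distr\<close>)
    also have "\<dots> = (\<Oplus>\<^bsub>N\<^esub>b\<in>?A. ?c x b \<odot>\<^bsub>N\<^esub> \<beta> b) \<oplus>\<^bsub>N\<^esub> (\<Oplus>\<^bsub>N\<^esub>b\<in>?A. ?c y b \<odot>\<^bsub>N\<^esub> \<beta> b)"
      by (rule N.M.finsum_addf) (use x y A\<beta> in auto)
    finally show "f (x \<oplus>\<^bsub>M\<^esub> y) = f x \<oplus>\<^bsub>N\<^esub> f y"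
      using f_super[OF x A(1) _ A(2)] f_super[OF y A(1) _ A(2)] by simp
  next
    fix r x assume r: "r \<in> carrier R" and x: "x \<in> carrier M"
    let ?A = "{b. ?c x b \<noteq> \<zero>}"
    have A: "finite ?A" "?A \<subseteq> B" using x coord_finite coord_support by auto
    have A\<beta>: "\<beta> b \<in> carrier N" if "b \<in> ?A" for b using that A(2) \<beta>c by blast
    have "{b. ?c (r \<odot>\<^bsub>M\<^esub> x) b \<noteq> \<zero>} \<subseteq> ?A" using x r by (auto simp: coord_smult)
    then have "f (r \<odot>\<^bsub>M\<^esub> x) = (\<Oplus>\<^bsub>N\<^esub>b\<in>?A. ?c (r \<odot>\<^bsub>M\<^esub> x) b \<odot>\<^bsub>N\<^esub> \<beta> b)"
      by (intro f_super[OF _ A(1) _ A(2)]) (use x r in auto)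
    also have "\<dots> = (\<Oplus>\<^bsub>N\<^esub>b\<in>?A. r \<odot>\<^bsub>N\<^esub> (?c x b \<odot>\<^bsub>N\<^esub> \<beta> b))"
      by (rule N.M.finsum_cong') (use x r A\<beta> in \<open>auto simp: coord_smult N.smult_assoc\<close>)
    also have "\<dots> = r \<odot>\<^bsub>N\<^esub> f x"
      unfolding f_def by (rule N.smult_finsum[symmetric]) (use x r A\<beta> in auto)
    finally show "f (r \<odot>\<^bsub>M\<^esub> x) = r \<odot>\<^bsub>N\<^esub> f x" .
  next
    fix j x assume x: "x \<in> mpart M j"
    then have xc: "x \<in> carrier M" using parts.part_carrier by blast
    have t: "?c x b \<odot>\<^bsub>N\<^esub> \<beta> b \<in> mpart N (t + j)" if bA: "b \<in> {b. ?c x b \<noteq> \<zero>}" for b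
    proof -
      have b: "b \<in> B" using bA coord_support[OF xc] by blast
      then obtain i where i: "b \<in> mpart M i" using homogeneous_basis by blast
      have c: "i \<le> j" "?c x b \<in> rpart R (nat (j - i))"
        using coord_homogeneous[OF x b i] bA by (auto split: if_splits)
      have e: "int (nat (j - i)) + (t + i) = t + j" using c(1) by simp
      show ?thesis using N.smult_mpart[OF c(2) \<beta>[OF b i]] unfolding e .
    qed
    show "f x \<in> mpart N (t + j)" unfolding f_def
      by (rule N.M.finsum_closed_under) (use t N.parts.part_carrier[OF t] N.parts.part_add in auto)
  qed
  moreover have "f b = \<beta> b" if "b \<in> B" for b
  proof -
    have "f b = (\<Oplus>\<^bsub>N\<^esub>b'\<in>{b}. ?c b b' \<odot>\<^bsub>N\<^esub> \<beta> b')"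
      using that basis_carrier coord_basis[OF that] by (intro f_super) (auto split: if_splits)
    then show ?thesis using \<beta>c[OF that] coord_basis[OF that, of b] by simp
  qed
  ultimately show ?thesis using that by blast
qed

end

section \<open>Free modules over a graded local ring\<close>

text \<open>Linear maps preserve multiples of \<open>\<mm>\<close>, so for a direct summand the inclusion and the projection
  \<open>e\<close> give the two inclusions.\<close>

lemma (in module_over_local) retract_max_ideal_times:
  assumes H: "graded_submodule R M H" and e: "e \<in> deg_hom R 0 M M"
    and "e ` carrier M \<subseteq> H" and fixed: "\<forall>x \<in> H. e x = x"
  shows "max_ideal_times R (restrict_module M H) = mM \<inter> H"
proof -
  interpret N: graded_module R "restrict_module M H" by (rule restrict_graded_module[OF H])
  have Hc: "H \<subseteq> carrier M" using submoduleD(2)[OF graded_submoduleD(1)[OF H]] by blast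
  interpret e: graded_linear R 0 M "restrict_module M H" e
    by unfold_locales (use deg_hom_restrict_cod[OF e assms(3)] parts.part_carrier in blast)
  interpret i: graded_linear R 0 "restrict_module M H" M "\<lambda>x. x"
    by unfold_locales (rule deg_hom_restrict_dom[OF deg_hom_id Hc])
  interpret N: module_over_local R "restrict_module M H" by unfold_locales
  show ?thesis
  proof (intro equalityI subsetI)
    fix x assume "x \<in> max_ideal_times R (restrict_module M H)"
    then show "x \<in> mM \<inter> H" using i.max_ideal_times_image mm_closed N.mM_closed by auto
  next
    fix x assume "x \<in> mM \<inter> H"
    then show "x \<in> max_ideal_times R (restrict_module M H)"
      using e.max_ideal_times_image[of x] mm_closed fixed by auto
  qed
qed

lemma (in graded_module) retract_locally_finite_generators:
  assumes H: "graded_submodule R M H" and e: "e \<in> deg_hom R 0 M M"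
    and "e ` carrier M \<subseteq> H" and fixed: "\<forall>x \<in> H. e x = x" and S: "locally_finite_generators R M S"
  shows "locally_finite_generators R (restrict_module M H) (e ` S)"
proof -
  interpret N: graded_module R "restrict_module M H" by (rule restrict_graded_module[OF H])
  have Hc: "H \<subseteq> carrier M" using submoduleD(2)[OF graded_submoduleD(1)[OF H]] by blast
  interpret e: graded_linear R 0 M "restrict_module M H" e
    by unfold_locales (use deg_hom_restrict_cod[OF e assms(3)] parts.part_carrier in blast)
  have "x \<in> e ` carrier M" if "x \<in> H" for x
    using fixed Hc that by (intro image_eqI[of _ _ x]) auto
  then show ?thesis using assms(3) by (intro e.locally_finite_generators_image[OF S]) auto
qed

locale free_over_local = module_over_local R M
  for R :: "('a, 'x) gr_ring_scheme" (structure) and M :: "('a, 'b, 'y) gr_module_scheme" (structure) +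
  fixes B :: "'b set"
  assumes module_basis_B: "module_basis R M B" and homogeneous_B: "B \<subseteq> (\<Union>j. mpart M j)"

sublocale free_over_local \<subseteq> free_module R M B
  by unfold_locales (rule module_basis_B homogeneous_B one_neq_zero)+

context free_over_local
begin

lemma coord_in_mm:
  assumes "x \<in> mM"
  shows "coord R M B x b \<in> mm"
proof -
  have "submodule {x \<in> carrier M. coord R M B x b \<in> mm} R M"
    by (rule submoduleI) (auto simp: coord_zero coord_add coord_smult mm_zero mm_add mm_mult_left)
  then have "x \<in> {x \<in> carrier M. coord R M B x b \<in> mm}"
    by (rule mM_minimal[OF _ _ assms]) (auto simp: coord_smult mm_mult_right mm_closed)
  then show ?thesis by simp
qed

lemma subbasis_carrier: "X \<subseteq> B \<Longrightarrow> X \<subseteq> carrier M"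
  using basis_carrier by blast

lemma subbasis_graded: "X \<subseteq> B \<Longrightarrow> graded_submodule R M (submodule_span R M X)"
  using graded_submodule_span_homogeneous homogeneous_basis by blast

lemma subbasis_retraction:
  assumes "X \<subseteq> B"
  obtains e where "e \<in> deg_hom R 0 M M" and "e ` carrier M \<subseteq> submodule_span R M X"
    and "\<forall>x \<in> submodule_span R M X. e x = x"
proof -
  have gm: "graded_module R M" by unfold_locales
  obtain e where e: "e \<in> deg_hom R 0 M M" "\<forall>b \<in> B. e b = (if b \<in> X then b else \<zero>\<^bsub>M\<^esub>)"
    by (rule free_extension[OF gm, of "\<lambda>b. if b \<in> X then b else \<zero>\<^bsub>M\<^esub>" 0]) auto
  interpret e: graded_linear R 0 M M e by unfold_locales (rule e)
  have Xc: "X \<subseteq> carrier M" using subbasis_carrier[OF assms] .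
  note sX = submodule_span_submodule[OF Xc]
  have "e ` carrier M = submodule_span R M (e ` B)" using e.image_span[of B] basis_span basis_carrier by auto
  moreover have "e ` B \<subseteq> submodule_span R M X"
    using e(2) span_subset[of _ X] submoduleD(3)[OF sX] by auto
  ultimately have im: "e ` carrier M \<subseteq> submodule_span R M X" using span_minimal[OF sX] by blast
  have "submodule {x \<in> carrier M. e x = x} R M"
    by (rule submoduleI) (auto simp: e.add e.smult)
  then have fixed: "e x = x" if "x \<in> submodule_span R M X" for x
  proof -
    have "X \<subseteq> {x \<in> carrier M. e x = x}" using e(2) assms Xc by auto
    with \<open>submodule {x \<in> carrier M. e x = x} R M\<close> show ?thesis using span_minimal[OF _ _ that] by blast
  qed
  show ?thesis using that[OF e(1) im] fixed by blast
qed

lemma subbasis_free: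
  assumes "X \<subseteq> B"
  shows "free_over_local R (restrict_module M (submodule_span R M X)) X"
proof -
  let ?H = "submodule_span R M X"
  have H: "graded_submodule R M ?H" by (rule subbasis_graded[OF assms])
  interpret N: graded_module R "restrict_module M ?H" by (rule restrict_graded_module[OF H])
  have XH: "X \<subseteq> ?H" using span_subset by blast
  have Hs: "additive_subgroup ?H M" and Hsub: "submodule ?H R M"
    using submoduleD(1) graded_submoduleD(1)[OF H] by auto
  have "module_basis R (restrict_module M ?H) X"
  proof (rule N.module_basisI)
    show "carrier (restrict_module M ?H) \<subseteq> submodule_span R (restrict_module M ?H) X"
      using span_restrict[OF H XH] by simp
    fix A c b
    assume A: "finite A" "A \<subseteq> X" "\<And>b. b \<in> A \<Longrightarrow> c b \<in> carrier R" "b \<in> A"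
      and z: "(\<Oplus>\<^bsub>restrict_module M ?H\<^esub>b\<in>A. c b \<odot>\<^bsub>restrict_module M ?H\<^esub> b) = \<zero>\<^bsub>restrict_module M ?H\<^esub>"
    have "(\<lambda>b. c b \<odot>\<^bsub>M\<^esub> b) \<in> A \<rightarrow> ?H" using A XH submoduleD(5)[OF Hsub] by blast
    then have "(\<Oplus>\<^bsub>M\<^esub>b\<in>A. c b \<odot>\<^bsub>M\<^esub> b) = \<zero>\<^bsub>M\<^esub>" using z by (simp add: restrict_finsum[OF Hs])
    then show "c b = \<zero>" using basis_independent[of A c b] A assms by blast
  qed (use XH in simp)
  moreover have "X \<subseteq> (\<Union>j. mpart (restrict_module M ?H) j)"
    using homogeneous_basis assms XH by auto
  ultimately show ?thesis by unfold_locales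
qed

lemma subbasis_max_ideal_times:
  assumes "X \<subseteq> B"
  shows "max_ideal_times R (restrict_module M (submodule_span R M X)) = mM \<inter> submodule_span R M X"
proof -
  obtain e where e: "e \<in> deg_hom R 0 M M" "e ` carrier M \<subseteq> submodule_span R M X"
    "\<forall>x \<in> submodule_span R M X. e x = x" by (rule subbasis_retraction[OF assms])
  show ?thesis by (rule retract_max_ideal_times[OF subbasis_graded[OF assms] e])
qed

lemma subbasis_locally_finite_generators:
  assumes "X \<subseteq> B" and "locally_finite_generators R M S"
  obtains T where "locally_finite_generators R (restrict_module M (submodule_span R M X)) T"
proof -
  obtain e where e: "e \<in> deg_hom R 0 M M" "e ` carrier M \<subseteq> submodule_span R M X"
    "\<forall>x \<in> submodule_span R M X. e x = x" by (rule subbasis_retraction[OF assms(1)])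
  show ?thesis
    by (rule that[OF retract_locally_finite_generators[OF subbasis_graded[OF assms(1)] e assms(2)]])
qed

text \<open>Linear algebra over the residue division ring, without naming it: for a linear map \<open>\<theta>\<close> into the
  quotient of \<open>N\<close> by a submodule containing \<open>\<mm>N\<close>, a maximal set of basis elements whose images are
  linearly independent modulo \<open>\<mm>\<close> spans the image. Every scalar outside \<open>\<mm>\<close> is invertible modulo
  \<open>\<mm>\<close>, which is all that the exchange argument uses.\<close>

lemma basis_selection:
  fixes N :: "('a, 'c, 'z) gr_module_scheme"
  assumes "graded_module R N" and \<theta>: "\<theta> \<in> deg_hom R t M N" and N0: "submodule N0 R N"
    and mN: "max_ideal_times R N \<subseteq> N0"
  obtains X where "X \<subseteq> B" and "\<And>z. z \<in> submodule_span R M X \<Longrightarrow> \<theta> z \<in> N0 \<Longrightarrow> z \<in> mM"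
    and "\<And>b. b \<in> B \<Longrightarrow> \<theta> b \<in> \<theta> ` submodule_span R M X <+>\<^bsub>N\<^esub> N0"
proof -
  interpret NN: graded_module R N by fact
  interpret NN: module_over_local R N by unfold_locales
  interpret \<theta>: graded_linear R t M N \<theta> by unfold_locales (rule \<theta>)
  let ?sp = "submodule_span R M"
  let ?A = "{X. X \<subseteq> B \<and> (\<forall>z\<in>?sp X. \<theta> z \<in> N0 \<longrightarrow> z \<in> mM)}"
  have "\<exists>X\<in>?A. \<forall>Y\<in>?A. X \<subseteq> Y \<longrightarrow> Y = X"
  proof (rule subset_Zorn_nonempty)
    have "submodule {\<zero>\<^bsub>M\<^esub>} R M" by (rule submoduleI) auto
    then have "?sp {} \<subseteq> {\<zero>\<^bsub>M\<^esub>}" using span_minimal[of "{\<zero>\<^bsub>M\<^esub>}" "{}"] by blast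
    then have "{} \<in> ?A" using submoduleD(3)[OF mM_submodule] by blast
    then show "?A \<noteq> {}" by blast
    fix C assume C: "C \<noteq> {}" "subset.chain ?A C"
    then have CA: "C \<subseteq> ?A" by (simp add: subset_chain_def)
    then have UB: "\<Union>C \<subseteq> B" by blast
    have "z \<in> mM" if z: "z \<in> ?sp (\<Union>C)" "\<theta> z \<in> N0" for z
    proof -
      obtain A c where A: "finite A" "A \<subseteq> \<Union>C" "c \<in> A \<rightarrow> carrier R" "z = (\<Oplus>\<^bsub>M\<^esub>s\<in>A. c s \<odot>\<^bsub>M\<^esub> s)"
        using in_spanE[OF subbasis_carrier[OF UB] z(1)] by blast
      obtain X where X: "X \<in> C" "A \<subseteq> X" using finite_subset_Union_chain[OF A(1,2) C] by blast
      have sX: "submodule (?sp X) R M"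
        using submodule_span_submodule subbasis_carrier CA X(1) by blast
      have "z \<in> ?sp X"
        unfolding A(4) using A(3) X(2) by (intro submodule_finsum[OF sX] submoduleD(5)[OF sX] span_subset) auto
      then show ?thesis using CA X(1) z(2) by blast
    qed
    then show "\<Union>C \<in> ?A" using UB by blast
  qed
  then obtain X where "X \<in> ?A" and max: "\<forall>Y\<in>?A. X \<subseteq> Y \<longrightarrow> Y = X" by (elim bexE)
  then have XB: "X \<subseteq> B" and Xind: "\<And>z. z \<in> ?sp X \<Longrightarrow> \<theta> z \<in> N0 \<Longrightarrow> z \<in> mM" by auto
  have Xc: "X \<subseteq> carrier M" using subbasis_carrier[OF XB] .
  note sX = submodule_span_submodule[OF Xc]
  note sXD = submoduleD[OF sX] and N0D = NN.submoduleD[OF N0]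
  have im: "submodule (\<theta> ` ?sp X) R N" by (rule \<theta>.submodule_image[OF sX])
  have "\<theta> b \<in> \<theta> ` ?sp X <+>\<^bsub>N\<^esub> N0" if b: "b \<in> B" for b
  proof (cases "b \<in> X")
    case True
    then show ?thesis using NN.set_add_left[OF im N0] span_subset[OF True] by blast
  next
    case False
    have bc: "b \<in> carrier M" using b basis_carrier by blast
    have "insert b X \<notin> ?A" using max False by blast
    then obtain z where z: "z \<in> ?sp (insert b X)" "\<theta> z \<in> N0" "z \<notin> mM" using b XB by blast
    obtain c w where cw: "c \<in> carrier R" "w \<in> ?sp X" "z = c \<odot>\<^bsub>M\<^esub> b \<oplus>\<^bsub>M\<^esub> w"
      using in_span_insertE[OF bc Xc z(1)] by blast
    have wc: "w \<in> carrier M" using cw(2) sXD(2) by blast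
    have \<theta>z: "\<theta> z = c \<odot>\<^bsub>N\<^esub> \<theta> b \<oplus>\<^bsub>N\<^esub> \<theta> w" using cw wc bc by (simp add: \<theta>.add \<theta>.smult)
    have "c \<notin> mm"
    proof
      assume c: "c \<in> mm"
      have "c \<odot>\<^bsub>N\<^esub> \<theta> b \<in> N0" using NN.smult_in_mM[OF c \<theta>.closed[OF bc]] mN by blast
      then have "\<theta> z \<ominus>\<^bsub>N\<^esub> c \<odot>\<^bsub>N\<^esub> \<theta> b \<in> N0" using z(2) N0D(7) by blast
      moreover have "\<theta> z \<ominus>\<^bsub>N\<^esub> c \<odot>\<^bsub>N\<^esub> \<theta> b = \<theta> w"
        using cw(1) bc wc \<theta>z by (simp add: NN.M.add_diff_cancel)
      ultimately have "w \<in> mM" using Xind[OF cw(2)] by simp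
      then have "z \<in> mM" using cw(3) submoduleD(4)[OF mM_submodule] smult_in_mM[OF c bc] by blast
      then show False using z(3) by blast
    qed
    then obtain v where v: "v \<in> carrier R" "\<one> \<ominus> v \<otimes> c \<in> mm" using unit_modulo_mm cw(1) by blast
    have k: "(\<one> \<ominus> v \<otimes> c) \<odot>\<^bsub>N\<^esub> \<theta> b \<in> N0" using NN.smult_in_mM[OF v(2) \<theta>.closed[OF bc]] mN by blast
    have vz: "v \<odot>\<^bsub>N\<^esub> \<theta> z \<in> N0" using N0D(5) v(1) z(2) by blast
    have vw: "\<ominus>\<^bsub>M\<^esub> (v \<odot>\<^bsub>M\<^esub> w) \<in> ?sp X" using sXD(5,6) v(1) cw(2) by blast
    let ?p = "(v \<otimes> c) \<odot>\<^bsub>N\<^esub> \<theta> b" and ?q = "v \<odot>\<^bsub>N\<^esub> \<theta> w"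
    have pq: "?p \<in> carrier N" "?q \<in> carrier N" "\<theta> b \<in> carrier N" using v cw bc wc by auto
    have e1: "(\<one> \<ominus> v \<otimes> c) \<odot>\<^bsub>N\<^esub> \<theta> b = \<theta> b \<ominus>\<^bsub>N\<^esub> ?p"
      using v(1) cw(1) pq by (simp add: NN.smult_minus_left)
    have e2: "v \<odot>\<^bsub>N\<^esub> \<theta> z = ?p \<oplus>\<^bsub>N\<^esub> ?q"
      using \<theta>z v(1) cw(1) bc wc by (simp add: NN.smult_r_distr NN.smult_assoc)
    have e3: "\<theta> (\<ominus>\<^bsub>M\<^esub> (v \<odot>\<^bsub>M\<^esub> w)) = \<ominus>\<^bsub>N\<^esub> ?q" using v(1) wc by (simp add: \<theta>.neg \<theta>.smult)
    have "(\<theta> b \<ominus>\<^bsub>N\<^esub> ?p) \<oplus>\<^bsub>N\<^esub> (?p \<oplus>\<^bsub>N\<^esub> ?q) = \<theta> b \<oplus>\<^bsub>N\<^esub> ?q"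
      using pq NN.M.add_minus_cancel(2)[of "\<theta> b" ?p] by (simp add: NN.M.a_assoc[symmetric])
    then have "\<theta> b = \<ominus>\<^bsub>N\<^esub> ?q \<oplus>\<^bsub>N\<^esub> ((\<theta> b \<ominus>\<^bsub>N\<^esub> ?p) \<oplus>\<^bsub>N\<^esub> (?p \<oplus>\<^bsub>N\<^esub> ?q))"
      using pq by (simp add: NN.M.a_comm[of "\<theta> b"] NN.M.r_neg1)
    then show ?thesis
      using set_addI[OF imageI[OF vw, of \<theta>] N0D(4)[OF k vz], of N] unfolding e1 e2 e3 by simp
  qed
  then show ?thesis using that XB Xind by blast
qed

end

lemma equalizer_submodule:
  assumes "graded_module R M" and "graded_module R N" and "f \<in> deg_hom R t M N" and "g \<in> deg_hom R t M N"
  shows "submodule {x \<in> carrier M. f x = g x} R M"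
proof -
  interpret M: graded_module R M by fact
  interpret f: graded_linear R t M N f by (rule graded_linear.intro[OF assms(1-3)])
  interpret g: graded_linear R t M N g by (rule graded_linear.intro[OF assms(1,2,4)])
  show ?thesis
    by (rule M.submoduleI) (auto simp: f.add g.add f.smult g.smult)
qed

lemma hom_eq_on_generators:
  assumes "graded_module R M" and "graded_module R N" and "f \<in> deg_hom R t M N" and "g \<in> deg_hom R t M N"
    and "B \<subseteq> carrier M" and "submodule_span R M B = carrier M" and "\<And>b. b \<in> B \<Longrightarrow> f b = g b"
    and "x \<in> carrier M"
  shows "f x = g x"
proof -
  interpret M: graded_module R M by fact
  have "submodule {x \<in> carrier M. f x = g x} R M" by (rule equalizer_submodule[OF assms(1-4)])
  moreover have "B \<subseteq> {x \<in> carrier M. f x = g x}" using assms(5,7) by auto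
  ultimately have "x \<in> {x \<in> carrier M. f x = g x}"
    using M.span_minimal[of _ B x] assms(6,8) by blast
  then show ?thesis by simp
qed

text \<open>Projectivity. A preimage of a homogeneous element can be replaced by one of its components.\<close>

lemma (in free_module) lift_along_surjection:
  fixes N :: "('a, 'c, 'y2) gr_module_scheme" and P :: "('a, 'd, 'z) gr_module_scheme"
  assumes "graded_module R N" and "graded_module R P"
    and \<theta>: "\<theta> \<in> deg_hom R 0 N P" "carrier P \<subseteq> \<theta> ` carrier N" and e: "e \<in> deg_hom R t M P"
  obtains f where "f \<in> deg_hom R t M N" and "\<forall>x \<in> carrier M. \<theta> (f x) = e x"
proof -
  have gm: "graded_module R M" by unfold_locales
  interpret N: graded_module R N by fact
  interpret P: graded_module R P by fact
  interpret \<theta>: graded_linear R 0 N P \<theta> by unfold_locales (rule \<theta>)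
  interpret e: graded_linear R t M P e by unfold_locales (rule e)
  have "\<exists>y. \<theta> y = e b \<and> (\<forall>j. b \<in> mpart M j \<longrightarrow> y \<in> mpart N (t + j))" if b: "b \<in> B" for b
  proof -
    obtain i where i: "b \<in> mpart M i" using b homogeneous_basis by blast
    have "e b \<in> \<theta> ` carrier N" by (rule subsetD[OF \<theta>(2) e.closed[OF basis_carrier[OF b]]])
    then obtain y where y: "e b = \<theta> y" "y \<in> carrier N" by (rule imageE)
    have "\<theta> (mcomp N (t + i) y) = mcomp P (t + i) (e b)" using \<theta>.mcomp_image[OF y(2), of "t + i"] y(1) by simp
    then have "\<theta> (mcomp N (t + i) y) = e b"
      using P.parts.component_homogeneous[OF e.part[OF i], of "t + i"] by simp
    then show ?thesis
      using N.parts.component_props(1)[OF y(2), of "t + i"] basis_degree_unique[OF b i]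
      by (intro exI[of _ "mcomp N (t + i) y"]) blast
  qed
  then obtain \<beta> where \<beta>: "\<And>b. b \<in> B \<Longrightarrow> \<theta> (\<beta> b) = e b"
    "\<And>b j. b \<in> B \<Longrightarrow> b \<in> mpart M j \<Longrightarrow> \<beta> b \<in> mpart N (t + j)" by metis
  obtain f where f: "f \<in> deg_hom R t M N" "\<forall>b \<in> B. f b = \<beta> b"
    using free_extension[OF assms(1), of \<beta> t] \<beta>(2) by blast
  have "(\<lambda>x. \<theta> (f x)) \<in> deg_hom R t M P" using deg_hom_comp[OF f(1) \<theta>(1)] by simp
  then have "\<theta> (f x) = e x" if "x \<in> carrier M" for x
    by (rule hom_eq_on_generators[OF gm assms(2) _ e _ basis_span _ that]) (use f(2) \<beta>(1) basis_carrier in auto)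
  then show ?thesis using that f(1) by blast
qed

lemma (in graded_module) free_transport:
  fixes N :: "('a, 'c, 'z) gr_module_scheme"
  assumes free: "free_graded_module R M" and N: "graded_module R N" and \<theta>: "\<theta> \<in> deg_hom R 0 M N"
    and bij: "bij_betw \<theta> (carrier M) (carrier N)"
  shows "free_graded_module R N"
proof -
  interpret N: graded_module R N by fact
  interpret \<theta>: graded_linear R 0 M N \<theta> by unfold_locales (rule \<theta>)
  obtain B where B: "B \<subseteq> (\<Union>j. mpart M j)" "module_basis R M B"
    using free by (auto simp: free_graded_module_def)
  interpret based_module R M B by unfold_locales (rule B(2))
  have Bc: "B \<subseteq> carrier M" using basis_carrier by blast
  have inj: "inj_on \<theta> (carrier M)" and surj: "\<theta> ` carrier M = carrier N" using bij by (auto simp: bij_betw_def)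
  have "module_basis R N (\<theta> ` B)"
  proof (rule N.module_basisI)
    show "\<theta> ` B \<subseteq> carrier N" using Bc by auto
    show "carrier N \<subseteq> submodule_span R N (\<theta> ` B)" using \<theta>.image_span[OF Bc] basis_span surj by simp
    fix A c y
    assume A: "finite A" "A \<subseteq> \<theta> ` B" "\<And>b. b \<in> A \<Longrightarrow> c b \<in> carrier R" "y \<in> A"
      and z: "(\<Oplus>\<^bsub>N\<^esub>b\<in>A. c b \<odot>\<^bsub>N\<^esub> b) = \<zero>\<^bsub>N\<^esub>"
    let ?A = "{b \<in> B. \<theta> b \<in> A}"
    have iA: "inj_on \<theta> ?A" using inj by (rule inj_on_subset) (use Bc in auto)
    have im: "\<theta> ` ?A = A" using A(2) by auto
    have fA: "finite ?A" using A(1) im finite_image_iff[OF iA] by simp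
    have Ac: "b \<in> ?A \<Longrightarrow> b \<in> carrier M \<and> c (\<theta> b) \<in> carrier R" for b using Bc A(3) by auto
    let ?x = "\<Oplus>\<^bsub>M\<^esub>b\<in>?A. c (\<theta> b) \<odot>\<^bsub>M\<^esub> b"
    have xc: "?x \<in> carrier M" using Ac by (intro M.finsum_closed) auto
    have "\<theta> ?x = (\<Oplus>\<^bsub>N\<^esub>b\<in>?A. \<theta> (c (\<theta> b) \<odot>\<^bsub>M\<^esub> b))"
      by (rule abelian_group_hom.hom_finsum[OF \<theta>.additive]) (use Ac in auto)
    also have "\<dots> = (\<Oplus>\<^bsub>N\<^esub>b\<in>?A. c (\<theta> b) \<odot>\<^bsub>N\<^esub> \<theta> b)"
      by (rule N.M.finsum_cong') (use Ac in \<open>auto simp: \<theta>.smult\<close>)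
    also have "\<dots> = (\<Oplus>\<^bsub>N\<^esub>b\<in>\<theta> ` ?A. c b \<odot>\<^bsub>N\<^esub> b)"
      by (rule N.M.finsum_reindex[symmetric, OF _ iA]) (use Ac in auto)
    also have "\<dots> = \<theta> \<zero>\<^bsub>M\<^esub>" using im z by simp
    finally have "?x = \<zero>\<^bsub>M\<^esub>" using inj_onD[OF inj _ xc] by simp
    moreover obtain b where "b \<in> ?A" "y = \<theta> b" using A(4) im by blast
    ultimately show "c y = \<zero>"
      using basis_independent[OF fA, of "\<lambda>b. c (\<theta> b)" b] Ac by auto
  qed
  moreover have "\<theta> ` B \<subseteq> (\<Union>j. mpart N j)" using B(1) \<theta>.part by fastforce
  ultimately show ?thesis using N by (auto simp: free_graded_module_def)
qed

context module_over_local
begin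

lemma carrier_graded_submodule: "graded_submodule R M (carrier M)"
  by (auto simp: graded_submodule_def submodule_carrier)

text \<open>A split surjection whose kernel lies in \<open>\<mm>M\<close> is bijective: the image of the section
  generates \<open>M\<close> modulo \<open>\<mm>M\<close>.\<close>

lemma split_surjection_bijective:
  fixes N :: "('a, 'c, 'z) gr_module_scheme"
  assumes S: "locally_finite_generators R M S" and N: "graded_module R N"
    and \<theta>: "\<theta> \<in> deg_hom R 0 M N" and \<sigma>: "\<sigma> \<in> deg_hom R 0 N M" "\<And>y. y \<in> carrier N \<Longrightarrow> \<theta> (\<sigma> y) = y"
    and ker: "\<And>x. x \<in> carrier M \<Longrightarrow> \<theta> x = \<zero>\<^bsub>N\<^esub> \<Longrightarrow> x \<in> mM"
  shows "bij_betw \<theta> (carrier M) (carrier N)" and "\<And>x. x \<in> carrier M \<Longrightarrow> \<sigma> (\<theta> x) = x"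
proof -
  interpret N: graded_module R N by (rule N)
  interpret N: module_over_local R N by unfold_locales
  interpret \<theta>: graded_linear R 0 M N \<theta> by unfold_locales (rule \<theta>)
  interpret \<sigma>: graded_linear R 0 N M \<sigma> by unfold_locales (rule \<sigma>(1))
  have im: "graded_submodule R M (\<sigma> ` carrier N)"
    by (rule \<sigma>.graded_submodule_image[OF N.carrier_graded_submodule])
  have "\<sigma> ` carrier N = carrier M"
  proof (rule graded_nakayama[OF S im])
    fix x assume x: "x \<in> carrier M"
    have "\<theta> (x \<ominus>\<^bsub>M\<^esub> \<sigma> (\<theta> x)) = \<zero>\<^bsub>N\<^esub>"
      using x \<sigma>(2) by (simp add: \<theta>.minus N.M.minus_eq N.M.r_neg)
    then have "x \<ominus>\<^bsub>M\<^esub> \<sigma> (\<theta> x) \<in> mM" using ker x by simp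
    then show "x \<in> \<sigma> ` carrier N <+>\<^bsub>M\<^esub> mM"
      using set_addI[of "\<sigma> (\<theta> x)" "\<sigma> ` carrier N" "x \<ominus>\<^bsub>M\<^esub> \<sigma> (\<theta> x)" mM M] x
      by (simp add: M.add_minus_cancel)
  qed
  then have "\<exists>y \<in> carrier N. x = \<sigma> y" if "x \<in> carrier M" for x using that by blast
  then show *: "\<sigma> (\<theta> x) = x" if "x \<in> carrier M" for x using \<sigma>(2) that by metis
  show "bij_betw \<theta> (carrier M) (carrier N)"
    by (rule bij_betw_byWitness[of _ \<sigma>]) (use * \<sigma>(2) in auto)
qed

end

context free_over_local
begin

lemma graded_module_M: "graded_module R M"
  by unfold_locales

lemma submodule_of_basis:
  assumes "submodule H R M" and "\<And>b. b \<in> B \<Longrightarrow> b \<in> H" and "x \<in> carrier M"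
  shows "x \<in> H"
  using span_minimal[OF assms(1), of B x] assms(2,3) basis_span by blast

text \<open>Such a \<open>u\<close> is onto by the lemma of Nakayama, splits because \<open>M\<close> is free, and has its kernel in
  \<open>\<mm>M\<close>.\<close>

lemma identity_modulo_mM_invertible:
  assumes S: "locally_finite_generators R M S" and u: "u \<in> deg_hom R 0 M M"
    and id: "\<And>x. x \<in> carrier M \<Longrightarrow> x \<ominus>\<^bsub>M\<^esub> u x \<in> mM"
  obtains v where "v \<in> deg_hom R 0 M M" and "\<forall>x \<in> carrier M. v (u x) = x"
proof -
  interpret u: graded_linear R 0 M M u by unfold_locales (rule u)
  have "u ` carrier M = carrier M"
  proof (rule graded_nakayama[OF S u.graded_submodule_image[OF carrier_graded_submodule]])
    fix x assume x: "x \<in> carrier M"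
    show "x \<in> u ` carrier M <+>\<^bsub>M\<^esub> mM"
      using set_addI[OF imageI[OF x, of u] id[OF x], of M] x by (simp add: M.add_minus_cancel)
  qed
  then obtain v where v: "v \<in> deg_hom R 0 M M" "\<forall>x \<in> carrier M. u (v x) = x"
    using lift_along_surjection[OF graded_module_M graded_module_M u _ deg_hom_id] by auto
  have "v (u x) = x" if "x \<in> carrier M" for x
  proof (rule split_surjection_bijective(2)[OF S graded_module_M u v(1) _ _ that])
    show "y \<in> mM" if "y \<in> carrier M" "u y = \<zero>\<^bsub>M\<^esub>" for y
      using id[OF that(1)] that by simp
  qed (use v(2) in blast)
  then show ?thesis using that v(1) by blast
qed

end


section \<open>Splitting off the contractible part\<close>

locale free_differential = free_over_local R M B
  for R :: "('a, 'x) gr_ring_scheme" (structure) and M :: "('a, 'b, 'y) gr_module_scheme" (structure)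
    and B :: "'b set" +
  fixes a :: int and d :: "'b \<Rightarrow> 'b" and S :: "'b set"
  assumes d_hom: "d \<in> deg_hom R a M M" and d_d [simp]: "\<And>x. x \<in> carrier M \<Longrightarrow> d (d x) = \<zero>\<^bsub>M\<^esub>"
    and gens: "locally_finite_generators R M S"

sublocale free_differential \<subseteq> d: graded_linear R a M M d
  by unfold_locales (rule d_hom)

context free_differential
begin

text \<open>A contraction of the acyclic part of \<open>M/\<mm>M\<close>, lifted to \<open>M\<close>. Choose basis elements \<open>X\<close> whose
  differentials form a basis of the boundaries modulo \<open>\<mm>M\<close>, and \<open>Y\<close> completing these differentials to
  a basis of \<open>M\<close> modulo \<open>\<mm>M\<close>. Sending a basis element \<open>b\<close> to some \<open>z\<close> in the span of \<open>X\<close> with \<open>b - dz\<close>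
  in \<open>N = span Y + \<mm>M\<close> inverts \<open>d\<close> modulo \<open>\<mm>M\<close> on the span of \<open>X\<close>, and a correction by an automorphism
  of that span inverts it exactly, which gives \<open>s\<^sub>0\<close>. The final \<open>s = s\<^sub>0 - s\<^sub>0 s\<^sub>0 d\<close> squares to zero.\<close>

lemma contraction:
  obtains s where "s \<in> deg_hom R (- a) M M" and "\<forall>x \<in> carrier M. s (d (s x)) = s x"
    and "\<forall>x \<in> carrier M. s (s x) = \<zero>\<^bsub>M\<^esub>" and "\<forall>x \<in> carrier M. d x \<ominus>\<^bsub>M\<^esub> d (s (d x)) \<in> mM"
proof -
  let ?sp = "submodule_span R M"
  obtain X where X: "X \<subseteq> B" and X_ind: "\<And>z. z \<in> ?sp X \<Longrightarrow> d z \<in> mM \<Longrightarrow> z \<in> mM"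
    and X_span: "\<And>b. b \<in> B \<Longrightarrow> d b \<in> d ` ?sp X <+>\<^bsub>M\<^esub> mM"
    by (rule basis_selection[OF graded_module_M d_hom mM_submodule subset_refl]) (simp only: )
  let ?F = "?sp X"
  have F: "graded_submodule R M ?F" by (rule subbasis_graded[OF X])
  note Fsub = graded_submoduleD(1)[OF F]
  note FD = submoduleD[OF Fsub] and mD = submoduleD[OF mM_submodule]
  have dF: "graded_submodule R M (d ` ?F)" by (rule d.graded_submodule_image[OF F])
  note dFsub = graded_submoduleD(1)[OF dF]
  let ?K = "d ` ?F <+>\<^bsub>M\<^esub> mM"
  have N0: "submodule ?K R M" by (rule submodule_set_add[OF dFsub mM_submodule])
  have boundary: "d x \<in> ?K" if "x \<in> carrier M" for x
    using submodule_of_basis[OF d.submodule_preimage[OF N0] _ that] X_span basis_carrier by blast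
  have mN0: "mM \<subseteq> ?K" using set_add_right[OF dFsub mM_submodule] by blast
  obtain Y where Y: "Y \<subseteq> B" and Y_ind: "\<And>z. z \<in> ?sp Y \<Longrightarrow> z \<in> ?K \<Longrightarrow> z \<in> mM"
    and Y_span: "\<And>b. b \<in> B \<Longrightarrow> b \<in> (\<lambda>x. x) ` ?sp Y <+>\<^bsub>M\<^esub> ?K"
    by (rule basis_selection[OF graded_module_M deg_hom_id N0 mN0]) (simp only: )
  let ?N = "?sp Y <+>\<^bsub>M\<^esub> mM"
  have sY: "graded_submodule R M (?sp Y)" by (rule subbasis_graded[OF Y])
  note sYsub = graded_submoduleD(1)[OF sY]
  have N: "graded_submodule R M ?N" by (rule graded_submodule_set_add[OF sY mM_graded])
  note Nsub = graded_submoduleD(1)[OF N]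
  have cover: "\<exists>z n. z \<in> ?F \<and> n \<in> ?N \<and> b = d z \<oplus>\<^bsub>M\<^esub> n" if b: "b \<in> B" for b
  proof -
    have "b \<in> ?sp Y <+>\<^bsub>M\<^esub> ?K" using Y_span[OF b] by simp
    then obtain y w where yw: "y \<in> ?sp Y" "w \<in> ?K" "b = y \<oplus>\<^bsub>M\<^esub> w" by (rule set_addE)
    obtain v m where vm: "v \<in> d ` ?F" "m \<in> mM" "w = v \<oplus>\<^bsub>M\<^esub> m" using yw(2) by (rule set_addE)
    have c: "y \<in> carrier M" "v \<in> carrier M" "m \<in> carrier M"
      using yw vm submoduleD(2)[OF sYsub] submoduleD(2)[OF dFsub] mM_closed by auto
    then have "b = v \<oplus>\<^bsub>M\<^esub> (y \<oplus>\<^bsub>M\<^esub> m)" unfolding yw(3) vm(3) by (simp add: M.a_ac)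
    then show ?thesis using vm(1) set_addI[OF yw(1) vm(2), of M] by blast
  qed
  have "\<exists>z. z \<in> ?F \<and> (\<forall>j. b \<in> mpart M j \<longrightarrow> z \<in> mpart M (- a + j)) \<and> b \<ominus>\<^bsub>M\<^esub> d z \<in> ?N" if b: "b \<in> B" for b
  proof -
    obtain i where i: "b \<in> mpart M i" using b homogeneous_basis by blast
    obtain z n where zn: "z \<in> ?F" "n \<in> ?N" "b = d z \<oplus>\<^bsub>M\<^esub> n" using cover[OF b] by blast
    have c: "z \<in> carrier M" "n \<in> carrier M" using FD(2) submoduleD(2)[OF Nsub] zn by auto
    let ?z = "mcomp M (- a + i) z"
    have "b = mcomp M i (d z) \<oplus>\<^bsub>M\<^esub> mcomp M i n"
      using parts.component_homogeneous[OF i, of i] zn(3) c by (simp add: parts.component_add)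
    then have "b = d ?z \<oplus>\<^bsub>M\<^esub> mcomp M i n" using d.mcomp_image[OF c(1), of i] by simp
    then have "b \<ominus>\<^bsub>M\<^esub> d ?z = mcomp M i n"
      using c M.add_diff_cancel(2)[of "mcomp M i n" "d ?z"] by simp
    then have "b \<ominus>\<^bsub>M\<^esub> d ?z \<in> ?N" using graded_submoduleD(2)[OF N zn(2)] by simp
    moreover have "?z \<in> ?F" "?z \<in> mpart M (- a + i)"
      using graded_submoduleD(2)[OF F zn(1)] parts.component_props(1)[OF c(1)] by auto
    ultimately show ?thesis using basis_degree_unique[OF b i] by metis
  qed
  then obtain \<beta> where \<beta>: "\<And>b. b \<in> B \<Longrightarrow> \<beta> b \<in> ?F"
    "\<And>b j. b \<in> B \<Longrightarrow> b \<in> mpart M j \<Longrightarrow> \<beta> b \<in> mpart M (- a + j)"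
    "\<And>b. b \<in> B \<Longrightarrow> b \<ominus>\<^bsub>M\<^esub> d (\<beta> b) \<in> ?N" by metis
  obtain r where r: "r \<in> deg_hom R (- a) M M" "\<forall>b \<in> B. r b = \<beta> b"
    using free_extension[OF graded_module_M, of \<beta> "- a"] \<beta>(2) by blast
  interpret r: graded_linear R "- a" M M r by unfold_locales (rule r(1))
  have rF: "r x \<in> ?F" if "x \<in> carrier M" for x
    using submodule_of_basis[OF r.submodule_preimage[OF Fsub] _ that] r(2) \<beta>(1) basis_carrier by simp
  have drh: "(\<lambda>x. x \<ominus>\<^bsub>M\<^esub> d (r x)) \<in> deg_hom R 0 M M"
    by (rule deg_hom_minus[OF graded_module_M deg_hom_id deg_hom_comp[OF r(1) d_hom]]) simp
  interpret dr: graded_linear R 0 M M "\<lambda>x. x \<ominus>\<^bsub>M\<^esub> d (r x)" by unfold_locales (rule drh)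
  have rem: "x \<ominus>\<^bsub>M\<^esub> d (r x) \<in> ?N" if "x \<in> carrier M" for x
    using submodule_of_basis[OF dr.submodule_preimage[OF Nsub] _ that] r(2) \<beta>(3) basis_carrier by simp
  have key: "w \<in> mM" if w: "w \<in> ?F" "d w \<in> ?N" for w
  proof -
    obtain y m where ym: "y \<in> ?sp Y" "m \<in> mM" "d w = y \<oplus>\<^bsub>M\<^esub> m" using w(2) by (rule set_addE)
    have c: "y \<in> carrier M" "m \<in> carrier M" using ym submoduleD(2)[OF sYsub] mM_closed by auto
    have "d w \<oplus>\<^bsub>M\<^esub> \<ominus>\<^bsub>M\<^esub> m \<in> ?K" by (rule set_addI[OF imageI[OF w(1)] mD(6)[OF ym(2)]])
    moreover have "d w \<oplus>\<^bsub>M\<^esub> \<ominus>\<^bsub>M\<^esub> m = y" unfolding ym(3) using c by (simp add: M.a_assoc M.r_neg)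
    ultimately have "y \<in> mM" using Y_ind[OF ym(1)] by simp
    then have "d w \<in> mM" unfolding ym(3) using ym(2) mD(4) by blast
    then show ?thesis using X_ind[OF w(1)] by blast
  qed
  interpret FX: free_over_local R "restrict_module M ?F" X by (rule subbasis_free[OF X])
  obtain T where T: "locally_finite_generators R (restrict_module M ?F) T"
    by (rule subbasis_locally_finite_generators[OF X gens])
  have Fc: "?F \<subseteq> carrier M" using FD(2) by blast
  have rM: "r \<in> deg_hom R (- a) M (restrict_module M ?F)"
    by (rule deg_hom_restrict_cod[OF r(1)]) (use rF parts.part_carrier in auto)
  have "(\<lambda>x. r (d x)) \<in> deg_hom R 0 M (restrict_module M ?F)"
    by (rule deg_hom_comp[OF d_hom rM]) simp
  then have u: "(\<lambda>x. r (d x)) \<in> deg_hom R 0 (restrict_module M ?F) (restrict_module M ?F)"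
    by (rule deg_hom_restrict_dom[OF _ Fc])
  have "w \<ominus>\<^bsub>M\<^esub> r (d w) \<in> mM \<inter> ?F" if w: "w \<in> ?F" for w
  proof -
    have wc: "w \<in> carrier M" using w Fc by blast
    have wF: "w \<ominus>\<^bsub>M\<^esub> r (d w) \<in> ?F" using FD(7)[OF w rF] wc by simp
    moreover have "d (w \<ominus>\<^bsub>M\<^esub> r (d w)) \<in> ?N" using rem[of "d w"] wc by (simp add: d.minus)
    ultimately show ?thesis using key by blast
  qed
  then have "w \<ominus>\<^bsub>restrict_module M ?F\<^esub> r (d w) \<in> max_ideal_times R (restrict_module M ?F)"
    if "w \<in> carrier (restrict_module M ?F)" for w
    using that rF[of "d w"] Fc subbasis_max_ideal_times[OF X]
    by (auto simp: restrict_minus[OF FD(1)])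
  then obtain v where v: "v \<in> deg_hom R 0 (restrict_module M ?F) (restrict_module M ?F)"
    "\<forall>w\<in>carrier (restrict_module M ?F). v (r (d w)) = w"
    using FX.identity_modulo_mM_invertible[OF T u] by blast
  have "(\<lambda>x. v (r x)) \<in> deg_hom R (- a) M (restrict_module M ?F)"
    by (rule deg_hom_comp[OF rM v(1)]) simp
  moreover define s0 where "s0 x = v (r x)" for x
  ultimately have s0F: "s0 \<in> deg_hom R (- a) M (restrict_module M ?F)" by (simp add: s0_def[abs_def])
  then have s0h: "s0 \<in> deg_hom R (- a) M M" by (rule deg_hom_unrestrict_cod[OF _ Fc])
  interpret s0: graded_linear R "- a" M M s0 by unfold_locales (rule s0h)
  have s0im: "s0 x \<in> ?F" if "x \<in> carrier M" for x using s0F that by (auto simp: deg_hom_def)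
  have s0d: "s0 (d w) = w" if "w \<in> ?F" for w using v(2) that by (simp add: s0_def)
  define s where "s x = s0 x \<ominus>\<^bsub>M\<^esub> s0 (s0 (d x))" for x
  have "(\<lambda>x. s0 (d x)) \<in> deg_hom R 0 M M" by (rule deg_hom_comp[OF d_hom s0h]) simp
  then have "(\<lambda>x. s0 (s0 (d x))) \<in> deg_hom R (- a) M M" by (rule deg_hom_comp[OF _ s0h]) simp
  then have sh: "s \<in> deg_hom R (- a) M M"
    unfolding s_def[abs_def] by (rule deg_hom_minus[OF graded_module_M s0h])
  interpret s: graded_linear R "- a" M M s by unfold_locales (rule sh)
  have sF: "s x \<in> ?F" if "x \<in> carrier M" for x
    unfolding s_def using that by (intro FD(7) s0im) auto
  have sd: "s (d x) = s0 (d x)" if "x \<in> carrier M" for x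
    using that by (simp add: s_def)
  show ?thesis
  proof (rule that[OF sh]; intro ballI)
    fix x assume x: "x \<in> carrier M"
    show "s (d (s x)) = s x" using sd[of "s x"] s0d[OF sF[OF x]] x by simp
    show "s (s x) = \<zero>\<^bsub>M\<^esub>" using s0d[OF sF[OF x]] x by (simp add: s_def[of "s x"])
    obtain v m where vm: "v \<in> d ` ?F" "m \<in> mM" "d x = v \<oplus>\<^bsub>M\<^esub> m" using boundary[OF x] by (rule set_addE)
    then obtain z where z: "z \<in> ?F" "v = d z" by blast
    have c: "z \<in> carrier M" "m \<in> carrier M" using z Fc vm(2) mM_closed by auto
    have "s (d x) = z \<oplus>\<^bsub>M\<^esub> s0 m" using sd[OF x] vm(3) z(2) c s0d[OF z(1)] by (simp add: s0.add)
    then have "d x \<ominus>\<^bsub>M\<^esub> d (s (d x)) = (d z \<oplus>\<^bsub>M\<^esub> m) \<ominus>\<^bsub>M\<^esub> (d z \<oplus>\<^bsub>M\<^esub> d (s0 m))"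
      using vm(3) z(2) c by (simp add: d.add)
    also have "\<dots> = m \<ominus>\<^bsub>M\<^esub> d (s0 m)"
      using c by (intro M.add_minus_add) auto
    finally have "d x \<ominus>\<^bsub>M\<^esub> d (s (d x)) = m \<ominus>\<^bsub>M\<^esub> d (s0 m)" .
    moreover have "d (s0 m) \<in> mM"
      using d.max_ideal_times_image[OF s0.max_ideal_times_image[OF vm(2)]] mm_closed by blast
    ultimately show "d x \<ominus>\<^bsub>M\<^esub> d (s (d x)) \<in> mM" using mD(7)[OF vm(2)] by simp
  qed
qed

end

context free_differential
begin

text \<open>With the contraction \<open>s\<close>, the endomorphism \<open>e = 1 - ds - sd\<close> is an idempotent chain map that is
  homotopic to the identity. Its image is minimal because \<open>de = d - dsd\<close> has values in \<open>\<mm>M\<close>. It is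
  free because, for a suitable part \<open>Y\<close> of \<open>B\<close>, the restriction of \<open>e\<close> to the span of \<open>Y\<close> is bijective
  modulo \<open>\<mm>M\<close>, hence an isomorphism onto the image.\<close>

lemma minimal_summand:
  obtains e s where "e \<in> deg_hom R 0 M M" and "s \<in> deg_hom R (- a) M M"
    and "\<forall>x \<in> carrier M. e x = x \<ominus>\<^bsub>M\<^esub> (d (s x) \<oplus>\<^bsub>M\<^esub> s (d x))"
    and "\<forall>x \<in> carrier M. e (e x) = e x" and "\<forall>x \<in> carrier M. e (d x) = d (e x)"
    and "free_graded_module R (restrict_module M (e ` carrier M))"
    and "\<forall>x \<in> e ` carrier M. d x \<in> max_ideal_times R (restrict_module M (e ` carrier M))"
proof -
  obtain s where sh: "s \<in> deg_hom R (- a) M M" and sds: "\<forall>x \<in> carrier M. s (d (s x)) = s x"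
    and ss: "\<forall>x \<in> carrier M. s (s x) = \<zero>\<^bsub>M\<^esub>" and dsd: "\<forall>x \<in> carrier M. d x \<ominus>\<^bsub>M\<^esub> d (s (d x)) \<in> mM"
    by (rule contraction)
  interpret s: graded_linear R "- a" M M s by unfold_locales (rule sh)
  define p where "p x = d (s x) \<oplus>\<^bsub>M\<^esub> s (d x)" for x
  define e where "e x = x \<ominus>\<^bsub>M\<^esub> p x" for x
  have "(\<lambda>x. d (s x)) \<in> deg_hom R 0 M M" "(\<lambda>x. s (d x)) \<in> deg_hom R 0 M M"
    by (rule deg_hom_comp[OF sh d_hom], simp, rule deg_hom_comp[OF d_hom sh], simp)
  then have ph: "p \<in> deg_hom R 0 M M"
    unfolding p_def[abs_def] by (rule deg_hom_add[OF graded_module_M])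
  have eh: "e \<in> deg_hom R 0 M M"
    unfolding e_def[abs_def] by (rule deg_hom_minus[OF graded_module_M deg_hom_id ph])
  interpret p: graded_linear R 0 M M p by unfold_locales (rule ph)
  interpret e: graded_linear R 0 M M e by unfold_locales (rule eh)
  have pp: "p (p x) = p x" if x: "x \<in> carrier M" for x
  proof -
    have "s (p x) = s x" using x sds ss by (simp add: p_def s.add)
    moreover have "d (p x) = d (s (d x))" using x by (simp add: p_def d.add)
    ultimately show ?thesis using x sds by (simp add: p_def[of "p x"]) (simp add: p_def)
  qed
  have pd: "p (d x) = d (s (d x))" "d (p x) = d (s (d x))" if "x \<in> carrier M" for x
    using that by (simp_all add: p_def d.add)
  have ee: "e (e x) = e x" if x: "x \<in> carrier M" for x
    using x pp by (simp add: e_def[of "e x"]) (simp add: e_def p.minus)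
  have ed: "e (d x) = d x \<ominus>\<^bsub>M\<^esub> d (s (d x))" "d (e x) = d x \<ominus>\<^bsub>M\<^esub> d (s (d x))" if "x \<in> carrier M" for x
    using that by (simp_all add: e_def d.minus pd)
  let ?H = "e ` carrier M"
  have H: "graded_submodule R M ?H" by (rule e.graded_submodule_image[OF carrier_graded_submodule])
  have Hc: "?H \<subseteq> carrier M" by auto
  have fixed: "\<forall>x \<in> ?H. e x = x" using ee by auto
  have mH: "max_ideal_times R (restrict_module M ?H) = mM \<inter> ?H"
    by (rule retract_max_ideal_times[OF H eh subset_refl fixed])
  have minimal: "d x \<in> max_ideal_times R (restrict_module M ?H)" if "x \<in> ?H" for x
  proof -
    have xc: "x \<in> carrier M" "e x = x" using subsetD[OF Hc that] bspec[OF fixed that] by blast+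
    have "d x = e (d x)" using ed[OF xc(1)] xc(2) by simp
    then have "d x \<in> ?H" by (rule image_eqI) (rule d.closed[OF xc(1)])
    moreover have "d x \<in> mM" using dsd[rule_format, OF xc(1)] ed(2)[OF xc(1)] xc(2) by simp
    ultimately show ?thesis using mH by blast
  qed
  interpret N: graded_module R "restrict_module M ?H" by (rule restrict_graded_module[OF H])
  interpret N: module_over_local R "restrict_module M ?H" by unfold_locales
  obtain Y where Y: "Y \<subseteq> B" and Y_ind: "\<And>z. z \<in> submodule_span R M Y \<Longrightarrow> e z \<in> mM \<Longrightarrow> z \<in> mM"
    and Y_span: "\<And>b. b \<in> B \<Longrightarrow> e b \<in> e ` submodule_span R M Y <+>\<^bsub>M\<^esub> mM"
    by (rule basis_selection[OF graded_module_M eh mM_submodule subset_refl]) (simp only: )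
  let ?F = "submodule_span R M Y"
  have F: "graded_submodule R M ?F" by (rule subbasis_graded[OF Y])
  note FD = submoduleD[OF graded_submoduleD(1)[OF F]]
  have Fc: "?F \<subseteq> carrier M" using FD(2) by blast
  interpret F: free_over_local R "restrict_module M ?F" Y by (rule subbasis_free[OF Y])
  obtain T where T: "locally_finite_generators R (restrict_module M ?F) T"
    by (rule subbasis_locally_finite_generators[OF Y gens])
  have eH: "e \<in> deg_hom R 0 M (restrict_module M ?H)"
    by (rule deg_hom_restrict_cod[OF eh]) (use parts.part_carrier in auto)
  have \<theta>: "e \<in> deg_hom R 0 (restrict_module M ?F) (restrict_module M ?H)"
    by (rule deg_hom_restrict_dom[OF eH Fc])
  interpret \<theta>: graded_linear R 0 "restrict_module M ?F" "restrict_module M ?H" e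
    by unfold_locales (rule \<theta>)
  have eFm: "submodule (e ` ?F <+>\<^bsub>M\<^esub> mM) R M"
    by (rule submodule_set_add[OF e.submodule_image[OF graded_submoduleD(1)[OF F]] mM_submodule])
  have "e ` ?F = carrier (restrict_module M ?H)"
  proof (rule N.graded_nakayama)
    show "locally_finite_generators R (restrict_module M ?H) (e ` S)"
      by (rule retract_locally_finite_generators[OF H eh subset_refl fixed gens])
    show "graded_submodule R (restrict_module M ?H) (e ` ?F)"
      using \<theta>.graded_submodule_image[OF F.carrier_graded_submodule] by simp
    fix x assume "x \<in> carrier (restrict_module M ?H)"
    then have xH: "x \<in> ?H" by simp
    have x: "x \<in> carrier M" "e x = x" using subsetD[OF Hc xH] bspec[OF fixed xH] by blast+
    have "e x \<in> e ` ?F <+>\<^bsub>M\<^esub> mM"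
      using submodule_of_basis[OF e.submodule_preimage[OF eFm] _ x(1)] Y_span basis_carrier by blast
    then obtain v m where vm: "v \<in> e ` ?F" "m \<in> mM" "e x = v \<oplus>\<^bsub>M\<^esub> m" by (rule set_addE)
    obtain z where z: "z \<in> ?F" "v = e z" using vm(1) by blast
    have zc: "z \<in> carrier M" using z(1) by (rule FD(2))
    have c: "m \<in> carrier M" "v \<in> carrier M" "e v = v" using mM_closed[OF vm(2)] zc z(2) ee[OF zc] by simp_all
    have "x = v \<oplus>\<^bsub>M\<^esub> e m" using arg_cong[OF vm(3), of e] x c by (simp add: e.add)
    moreover have "e m \<in> max_ideal_times R (restrict_module M ?H)"
      using mH e.max_ideal_times_image[OF vm(2)] mm_closed c(1) by blast
    ultimately show "x \<in> e ` ?F <+>\<^bsub>restrict_module M ?H\<^esub> max_ideal_times R (restrict_module M ?H)"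
      using set_addI[OF vm(1), of "e m" _ "restrict_module M ?H"] by simp
  qed
  then have surj: "carrier (restrict_module M ?H) \<subseteq> e ` carrier (restrict_module M ?F)" by simp
  obtain f where f: "f \<in> deg_hom R 0 M (restrict_module M ?F)" "\<forall>x \<in> carrier M. e (f x) = e x"
    by (rule lift_along_surjection[OF F.graded_module_M N.graded_module_axioms \<theta> surj eH])
  have bij: "bij_betw e (carrier (restrict_module M ?F)) (carrier (restrict_module M ?H))"
  proof (rule F.split_surjection_bijective(1)[OF T N.graded_module_axioms \<theta> deg_hom_restrict_dom[OF f(1) Hc]])
    show "e (f y) = y" if "y \<in> carrier (restrict_module M ?H)" for y
      using that f(2) subsetD[OF Hc, of y] bspec[OF fixed, of y] by simp
    show "x \<in> max_ideal_times R (restrict_module M ?F)"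
      if "x \<in> carrier (restrict_module M ?F)" "e x = \<zero>\<^bsub>restrict_module M ?H\<^esub>" for x
      using that Y_ind[of x] submoduleD(3)[OF mM_submodule] subbasis_max_ideal_times[OF Y] by simp
  qed
  have "free_graded_module R (restrict_module M ?F)"
    using F.graded_module_M F.basis F.homogeneous_basis unfolding free_graded_module_def by blast
  then have free: "free_graded_module R (restrict_module M ?H)"
    by (rule F.free_transport[OF _ N.graded_module_axioms \<theta> bij])
  show ?thesis
    by (rule that[OF eh sh _ _ _ free]) (use ee ed minimal in \<open>auto simp: e_def p_def\<close>)
qed

end

section \<open>Homology and quasi-isomorphisms\<close>

locale diff_mod =
  fixes R :: "'a gr_ring" and a :: int and D :: "('a, 'b) diff_module"
  assumes diff: "differential_module R a D"

sublocale diff_mod \<subseteq> graded_module R D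
  using diff by (simp add: differential_module_def)

sublocale diff_mod \<subseteq> d: graded_linear R a D D "differential D"
  using diff by unfold_locales (simp add: differential_module_def graded_hom_twist)

context diff_mod
begin

lemma d_d [simp]: "x \<in> carrier D \<Longrightarrow> differential D (differential D x) = \<zero>\<^bsub>D\<^esub>"
  using diff by (simp add: differential_module_def)

lemma boundaries_submodule: "submodule (boundaries D) R D"
  unfolding boundaries_def by (rule d.submodule_image[OF submodule_carrier])

lemma boundaries_closed: "x \<in> boundaries D \<Longrightarrow> x \<in> carrier D"
  by (rule submoduleD(2)[OF boundaries_submodule])

lemma boundaries_abelian_subgroup: "abelian_subgroup (boundaries D) D"
  by (rule abelian_subgroupI3[OF submoduleD(1)[OF boundaries_submodule] M.abelian_group_axioms])

lemma boundary: "x \<in> carrier D \<Longrightarrow> differential D x \<in> boundaries D"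
  by (simp add: boundaries_def)

lemma boundary_homogeneous:
  assumes "x \<in> boundaries D" and "x \<in> mpart D j"
  obtains y where "y \<in> mpart D (j - a)" and "x = differential D y"
proof -
  obtain y where y: "y \<in> carrier D" "x = differential D y" using assms(1) by (auto simp: boundaries_def)
  have "x = mcomp D j x" using parts.component_homogeneous[OF assms(2), of j] by simp
  then have "x = differential D (mcomp D (j - a) y)" using d.mcomp_image[OF y(1), of j] y(2) by simp
  then show ?thesis using that parts.component_props(1)[OF y(1)] by blast
qed

lemma cycles_closed: "x \<in> cycles D \<Longrightarrow> x \<in> carrier D"
  by (simp add: cycles_def)

lemma cycles_mcomp: "x \<in> cycles D \<Longrightarrow> mcomp D j x \<in> cycles D"
  using d.mcomp_image[of x "j + a"] by (simp add: cycles_def)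

abbreviation cls :: "'b \<Rightarrow> 'b set" where "cls z \<equiv> boundaries D +>\<^bsub>D\<^esub> z"

lemma mem_cls: "x \<in> cls z \<longleftrightarrow> (\<exists>b \<in> boundaries D. x = b \<oplus>\<^bsub>D\<^esub> z)"
  by (auto simp: a_r_coset_def')

lemma cls_self: "z \<in> carrier D \<Longrightarrow> z \<in> cls z"
  unfolding mem_cls using submoduleD(3)[OF boundaries_submodule] by (intro bexI[of _ "\<zero>\<^bsub>D\<^esub>"]) auto

lemma cls_eq_iff:
  assumes "x \<in> carrier D" and "y \<in> carrier D"
  shows "cls x = cls y \<longleftrightarrow> x \<ominus>\<^bsub>D\<^esub> y \<in> boundaries D"
proof
  assume "cls x = cls y"
  then obtain b where "b \<in> boundaries D" "x = b \<oplus>\<^bsub>D\<^esub> y" using cls_self[OF assms(1)] mem_cls by blast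
  then show "x \<ominus>\<^bsub>D\<^esub> y \<in> boundaries D" using assms(2) boundaries_closed by (simp add: M.add_diff_cancel)
next
  assume *: "x \<ominus>\<^bsub>D\<^esub> y \<in> boundaries D"
  have "x \<in> cls y"
    unfolding mem_cls by (rule bexI[OF _ *]) (simp add: M.add_minus_cancel assms)
  then show "cls x = cls y"
    using abelian_subgroup.a_repr_independence'[OF boundaries_abelian_subgroup _ assms(2)] by blast
qed

lemma cls_closed: "x \<in> cls z \<Longrightarrow> z \<in> carrier D \<Longrightarrow> x \<in> carrier D"
  unfolding mem_cls using boundaries_closed by auto

lemma cls_mem_eq: "x \<in> cls z \<Longrightarrow> z \<in> carrier D \<Longrightarrow> x \<ominus>\<^bsub>D\<^esub> z \<in> boundaries D"
  unfolding mem_cls using boundaries_closed by (auto simp: M.add_diff_cancel)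

lemma cls_add:
  "x \<in> carrier D \<Longrightarrow> y \<in> carrier D \<Longrightarrow> cls x <+>\<^bsub>D\<^esub> cls y = cls (x \<oplus>\<^bsub>D\<^esub> y)"
  by (rule abelian_subgroup.a_rcos_sum[OF boundaries_abelian_subgroup])

lemma homology_smult:
  assumes "r \<in> carrier R" and "z \<in> carrier D"
  shows "smult (homology D) r (cls z) = cls (r \<odot>\<^bsub>D\<^esub> z)"
proof -
  have "cls (r \<odot>\<^bsub>D\<^esub> x) = cls (r \<odot>\<^bsub>D\<^esub> z)" if x: "x \<in> cls z" for x
  proof -
    have xc: "x \<in> carrier D" using cls_closed x assms(2) by blast
    have "r \<odot>\<^bsub>D\<^esub> (x \<ominus>\<^bsub>D\<^esub> z) \<in> boundaries D"
      by (rule submoduleD(5)[OF boundaries_submodule assms(1) cls_mem_eq[OF x assms(2)]])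
    then show ?thesis
      using assms xc by (subst cls_eq_iff) (auto simp: M.minus_eq smult_r_distr smult_neg_right)
  qed
  then have "(\<Union>x\<in>cls z. cls (r \<odot>\<^bsub>D\<^esub> x)) = (\<Union>x\<in>cls z. cls (r \<odot>\<^bsub>D\<^esub> z))"
    by (intro SUP_cong refl)
  moreover have "cls z \<noteq> {}" using cls_self[OF assms(2)] by blast
  ultimately show ?thesis by (simp add: homology_def)
qed

end

lemma homology_simps:
  "carrier (homology D) = (\<lambda>z. boundaries D +>\<^bsub>D\<^esub> z) ` cycles D"
  "add (homology D) X Y = X <+>\<^bsub>D\<^esub> Y"
  "mpart (homology D) j = (\<lambda>z. boundaries D +>\<^bsub>D\<^esub> z) ` (cycles D \<inter> mpart D j)"
  by (simp_all add: homology_def)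

locale diff_morph = D: diff_mod R a D + E: diff_mod R a E
  for R :: "'a gr_ring" and a :: int and D :: "('a, 'b) diff_module" and E :: "('a, 'c) diff_module" +
  fixes f :: "'b \<Rightarrow> 'c"
  assumes morphism: "f \<in> diff_morphism R D E"

sublocale diff_morph \<subseteq> graded_linear R 0 D E f
  using morphism by unfold_locales (simp add: diff_morphism_def graded_hom_deg_hom)

context diff_morph
begin

lemma commute: "x \<in> carrier D \<Longrightarrow> f (differential D x) = differential E (f x)"
  using morphism by (simp add: diff_morphism_def)

lemma cycle_image: "z \<in> cycles D \<Longrightarrow> f z \<in> cycles E"
  using commute[of z] by (simp add: cycles_def)

lemma boundary_image: "b \<in> boundaries D \<Longrightarrow> f b \<in> boundaries E"
  using commute by (auto simp: boundaries_def)

lemma homology_map_cls: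
  assumes "z \<in> carrier D"
  shows "homology_map E f (D.cls z) = E.cls (f z)"
proof -
  have "E.cls (f x) = E.cls (f z)" if x: "x \<in> D.cls z" for x
  proof -
    have xc: "x \<in> carrier D" using D.cls_closed x assms by blast
    have "f (x \<ominus>\<^bsub>D\<^esub> z) \<in> boundaries E" by (rule boundary_image[OF D.cls_mem_eq[OF x assms]])
    then show ?thesis using E.cls_eq_iff[of "f x" "f z"] xc assms by (simp add: minus)
  qed
  then show ?thesis unfolding homology_map_def using D.cls_self[OF assms] by blast
qed

lemma homology_map_graded_hom: "homology_map E f \<in> graded_hom R (homology D) (homology E)"
  unfolding graded_hom_def
proof (intro CollectI conjI ballI allI)
  show "homology_map E f \<in> carrier (homology D) \<rightarrow> carrier (homology E)"
    using cycle_image D.cycles_closed by (auto simp: homology_simps homology_map_cls)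
  show "homology_map E f ` mpart (homology D) j \<subseteq> mpart (homology E) j" for j
    using cycle_image D.cycles_closed part by (fastforce simp: homology_simps homology_map_cls)
  fix X Y assume "X \<in> carrier (homology D)" "Y \<in> carrier (homology D)"
  then obtain x y where "x \<in> cycles D" "y \<in> cycles D" and XY: "X = D.cls x" "Y = D.cls y"
    by (auto simp: homology_simps)
  then have "x \<in> carrier D" "y \<in> carrier D" using D.cycles_closed by auto
  then show "homology_map E f (X \<oplus>\<^bsub>homology D\<^esub> Y) =
      homology_map E f X \<oplus>\<^bsub>homology E\<^esub> homology_map E f Y"
    unfolding XY by (simp add: homology_simps D.cls_add E.cls_add homology_map_cls add)
next
  fix r X assume r: "r \<in> carrier R" and "X \<in> carrier (homology D)"
  then obtain x where "x \<in> cycles D" and X: "X = D.cls x" by (auto simp: homology_simps)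
  then have "x \<in> carrier D" using D.cycles_closed by auto
  then show "homology_map E f (r \<odot>\<^bsub>homology D\<^esub> X) = r \<odot>\<^bsub>homology E\<^esub> homology_map E f X"
    unfolding X using r by (simp add: D.homology_smult E.homology_smult homology_map_cls smult)
qed

lemma quasi_isomorphismI:
  assumes surj: "\<And>y. y \<in> cycles E \<Longrightarrow> \<exists>z \<in> cycles D. f z \<ominus>\<^bsub>E\<^esub> y \<in> boundaries E"
    and inj: "\<And>z. z \<in> cycles D \<Longrightarrow> f z \<in> boundaries E \<Longrightarrow> z \<in> boundaries D"
  shows "quasi_isomorphism R D E f"
proof -
  have "inj_on (homology_map E f) (carrier (homology D))"
  proof (rule inj_onI)
    fix X Y assume "X \<in> carrier (homology D)" "Y \<in> carrier (homology D)"
      and eq: "homology_map E f X = homology_map E f Y"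
    then obtain x y where xy: "x \<in> cycles D" "y \<in> cycles D" and XY: "X = D.cls x" "Y = D.cls y"
      by (auto simp: homology_simps)
    have c: "x \<in> carrier D" "y \<in> carrier D" using xy D.cycles_closed by auto
    have "f (x \<ominus>\<^bsub>D\<^esub> y) \<in> boundaries E"
      using eq c E.cls_eq_iff[of "f x" "f y"] unfolding XY by (simp add: homology_map_cls minus)
    moreover have "x \<ominus>\<^bsub>D\<^esub> y \<in> cycles D" using xy c by (simp add: cycles_def D.d.minus)
    ultimately show "X = Y" unfolding XY D.cls_eq_iff[OF c] by (intro inj)
  qed
  moreover have "carrier (homology E) \<subseteq> homology_map E f ` carrier (homology D)"
  proof
    fix Y assume "Y \<in> carrier (homology E)"
    then obtain y where y: "y \<in> cycles E" "Y = E.cls y" by (auto simp: homology_simps)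
    obtain z where z: "z \<in> cycles D" "f z \<ominus>\<^bsub>E\<^esub> y \<in> boundaries E" using surj[OF y(1)] by blast
    have "z \<in> carrier D" using z(1) by (rule D.cycles_closed)
    then have "Y = homology_map E f (D.cls z)"
      using z(2) y E.cycles_closed[OF y(1)] E.cls_eq_iff[of "f z" y] by (simp add: homology_map_cls)
    then show "Y \<in> homology_map E f ` carrier (homology D)" using z(1) by (auto simp: homology_simps)
  qed
  moreover have "homology_map E f ` carrier (homology D) \<subseteq> carrier (homology E)"
    using homology_map_graded_hom by (auto simp: graded_hom_def)
  ultimately show ?thesis
    using homology_map_graded_hom morphism
    by (simp add: quasi_isomorphism_def graded_iso_def bij_betw_def subset_antisym)
qed

lemma quasi_isomorphism_surj:
  assumes "quasi_isomorphism R D E f" and "y \<in> cycles E"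
  shows "\<exists>z \<in> cycles D. f z \<ominus>\<^bsub>E\<^esub> y \<in> boundaries E"
proof -
  have "homology_map E f ` carrier (homology D) = carrier (homology E)"
    using assms(1) by (simp add: quasi_isomorphism_def graded_iso_def bij_betw_def)
  moreover have "E.cls y \<in> carrier (homology E)" using assms(2) by (auto simp: homology_simps)
  ultimately have "E.cls y \<in> homology_map E f ` carrier (homology D)" by simp
  then obtain z where z: "z \<in> cycles D" "E.cls y = homology_map E f (D.cls z)"
    unfolding homology_simps by blast
  have "z \<in> carrier D" using z(1) by (rule D.cycles_closed)
  then show ?thesis
    using z E.cls_eq_iff[of "f z" y] E.cycles_closed[OF assms(2)] by (auto simp: homology_map_cls)
qed

lemma quasi_isomorphism_inj:
  assumes "quasi_isomorphism R D E f" and "z \<in> cycles D" and "f z \<in> boundaries E"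
  shows "z \<in> boundaries D"
proof -
  have inj: "inj_on (homology_map E f) (carrier (homology D))"
    using assms(1) by (simp add: quasi_isomorphism_def graded_iso_def bij_betw_def)
  have z0: "\<zero>\<^bsub>D\<^esub> \<in> cycles D" by (simp add: cycles_def)
  have zc: "z \<in> carrier D" using assms(2) by (rule D.cycles_closed)
  have "homology_map E f (D.cls z) = homology_map E f (D.cls \<zero>\<^bsub>D\<^esub>)"
    using zc assms(3) E.cls_eq_iff[of "f z" "\<zero>\<^bsub>E\<^esub>"] by (simp add: homology_map_cls)
  then have "D.cls z = D.cls \<zero>\<^bsub>D\<^esub>"
    by (rule inj_onD[OF inj]) (use assms(2) z0 in \<open>auto simp: homology_simps\<close>)
  then show ?thesis using D.cls_eq_iff[of z "\<zero>\<^bsub>D\<^esub>"] zc by simp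
qed

text \<open>The mapping cone of a quasi-isomorphism is acyclic, spelled out in homogeneous elements.\<close>

lemma quasi_isomorphism_cone_acyclic:
  assumes q: "quasi_isomorphism R D E f" and x: "x \<in> mpart D (a + j)" "differential D x = \<zero>\<^bsub>D\<^esub>"
    and y: "y \<in> mpart E j" "differential E y = f x"
  obtains x' y' where "x' \<in> mpart D j" and "y' \<in> mpart E (j - a)" and "x = differential D x'"
    and "y = f x' \<oplus>\<^bsub>E\<^esub> differential E y'"
proof -
  have c: "x \<in> carrier D" "y \<in> carrier E" using x(1) y(1) D.parts.part_carrier E.parts.part_carrier by auto
  have "x \<in> boundaries D"
    by (rule quasi_isomorphism_inj[OF q]) (use c x(2) E.boundary[OF c(2)] y(2) in \<open>auto simp: cycles_def\<close>)
  then obtain x1 where "x1 \<in> mpart D (a + j - a)" and x1: "x = differential D x1"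
    using D.boundary_homogeneous x(1) by blast
  then have x1j: "x1 \<in> mpart D j" by simp
  have x1c: "x1 \<in> carrier D" using D.parts.part_carrier[OF x1j] .
  let ?w = "y \<ominus>\<^bsub>E\<^esub> f x1"
  have w: "?w \<in> mpart E j"
    using y(1) part[OF x1j] E.parts.part_add E.parts.part_neg by (simp add: E.M.minus_eq)
  have wc: "?w \<in> cycles E"
    using c(2) x1c y(2) x1 by (simp add: cycles_def E.d.minus commute)
  obtain z where z: "z \<in> cycles D" "f z \<ominus>\<^bsub>E\<^esub> ?w \<in> boundaries E"
    using quasi_isomorphism_surj[OF q wc] by blast
  have zc: "z \<in> carrier D" using z(1) by (rule D.cycles_closed)
  let ?z = "mcomp D j z"
  have zj: "?z \<in> mpart D j" using D.parts.component_props(1)[OF zc] .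
  have fz: "mcomp E j (f z) = f ?z" using mcomp_image[OF zc, of j] by simp
  have wcl: "?w \<in> carrier E" using E.parts.part_carrier[OF w] .
  have "mcomp E j (f z \<ominus>\<^bsub>E\<^esub> ?w) \<in> boundaries E"
    using z(2) E.d.graded_submodule_image[of "carrier E"] E.submodule_carrier
    unfolding boundaries_def graded_submodule_def by auto
  then have "f ?z \<ominus>\<^bsub>E\<^esub> ?w \<in> boundaries E"
    using zc wcl fz E.parts.component_homogeneous[OF w, of j] by (simp add: E.parts.component_minus)
  then have "\<ominus>\<^bsub>E\<^esub> (f ?z \<ominus>\<^bsub>E\<^esub> ?w) \<in> boundaries E"
    by (rule E.submoduleD(6)[OF E.boundaries_submodule])
  moreover have "\<ominus>\<^bsub>E\<^esub> (f ?z \<ominus>\<^bsub>E\<^esub> ?w) = ?w \<ominus>\<^bsub>E\<^esub> f ?z"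
    using zc wcl by (simp add: E.M.minus_eq E.M.minus_add E.M.a_comm)
  ultimately have "?w \<ominus>\<^bsub>E\<^esub> f ?z \<in> boundaries E" by simp
  moreover have "?w \<ominus>\<^bsub>E\<^esub> f ?z \<in> mpart E j"
    using w part[OF zj] E.parts.part_add E.parts.part_neg by (simp add: E.M.minus_eq)
  ultimately obtain y' where y': "y' \<in> mpart E (j - a)" "?w \<ominus>\<^bsub>E\<^esub> f ?z = differential E y'"
    using E.boundary_homogeneous by blast
  have y'c: "y' \<in> carrier E" using E.parts.part_carrier[OF y'(1)] .
  have "y = f x1 \<oplus>\<^bsub>E\<^esub> (f ?z \<oplus>\<^bsub>E\<^esub> differential E y')"
    unfolding y'(2)[symmetric] using c(2) x1c zc wcl by (simp add: E.M.add_minus_cancel)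
  then have "y = f (x1 \<oplus>\<^bsub>D\<^esub> ?z) \<oplus>\<^bsub>E\<^esub> differential E y'"
    using x1c zc y'c by (simp add: add E.M.a_assoc)
  moreover have "x = differential D (x1 \<oplus>\<^bsub>D\<^esub> ?z)"
    using x1 x1c zc c(1) D.cycles_mcomp[OF z(1), of j] by (simp add: D.d.add cycles_def)
  moreover have "x1 \<oplus>\<^bsub>D\<^esub> ?z \<in> mpart D j" using x1j zj by (rule D.parts.part_add)
  ultimately show ?thesis using that y'(1) by blast
qed

end

section \<open>Lifting along quasi-isomorphisms\<close>

text \<open>A basis adapted to a free flag. Only the layering of the differential is recorded, so that the
  structure also covers the flag with the negated differential.\<close>

locale layered_basis = free_module R G "\<Union>i. \<beta> i"
  for R :: "('a, 'x) gr_ring_scheme" (structure) and G :: "('a, 'g, 'y) gr_module_scheme" (structure)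
    and \<beta> :: "nat \<Rightarrow> 'g set" +
  fixes a :: int and d :: "'g \<Rightarrow> 'g"
  assumes layers_disjoint: "b \<in> \<beta> i \<Longrightarrow> b \<in> \<beta> j \<Longrightarrow> i = j"
    and d_hom: "d \<in> deg_hom R a G G" and d_d: "x \<in> carrier G \<Longrightarrow> d (d x) = \<zero>\<^bsub>G\<^esub>"
    and d_lowers: "b \<in> \<beta> i \<Longrightarrow> d b \<in> submodule_span R G (\<Union>j<i. \<beta> j)"

sublocale layered_basis \<subseteq> d: graded_linear R a G G d
  by unfold_locales (rule d_hom)

text \<open>The pair \<open>(u, g)\<close> is a chain map of degree \<open>t\<close> from \<open>G\<close> into the mapping cone of \<open>q\<close>, whose
  differential is \<open>(x, y) \<mapsto> (\<partial>x, qx - \<partial>y)\<close>. The cone is acyclic, so the pair is null-homotopic, and a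
  null-homotopy is a pair \<open>(w, -k)\<close>. With \<open>u = 0\<close> and the negated differential on \<open>G\<close>
  this lifts \<open>g\<close> along \<open>q\<close> up to homotopy; with \<open>g\<close> a null-homotopy of \<open>qu\<close> it contracts \<open>u\<close>.\<close>

locale lifting_problem = layered_basis R G \<beta> a d + q: diff_morph R a A D q
  for R :: "'a gr_ring" (structure) and G :: "('a, 'g, 'y) gr_module_scheme" (structure)
    and \<beta> :: "nat \<Rightarrow> 'g set" and a :: int and d :: "'g \<Rightarrow> 'g"
    and A :: "('a, 'b) diff_module" and D :: "('a, 'c) diff_module" and q :: "'b \<Rightarrow> 'c" +
  fixes t :: int and u :: "'g \<Rightarrow> 'b" and g :: "'g \<Rightarrow> 'c"
  assumes quasi_iso: "quasi_isomorphism R A D q"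
    and u_hom: "u \<in> deg_hom R t G A" and g_hom: "g \<in> deg_hom R (t - a) G D"
    and u_commute: "x \<in> carrier G \<Longrightarrow> u (d x) = differential A (u x)"
    and qu: "x \<in> carrier G \<Longrightarrow> q (u x) = differential D (g x) \<oplus>\<^bsub>D\<^esub> g (d x)"

sublocale lifting_problem \<subseteq> u: graded_linear R t G A u
  by unfold_locales (rule u_hom)

sublocale lifting_problem \<subseteq> g: graded_linear R "t - a" G D g
  by unfold_locales (rule g_hom)

context lifting_problem
begin

definition lift_at :: "('g \<Rightarrow> 'b) \<Rightarrow> ('g \<Rightarrow> 'c) \<Rightarrow> 'g \<Rightarrow> bool" where
  "lift_at w k x \<longleftrightarrow> u x = differential A (w x) \<oplus>\<^bsub>A\<^esub> w (d x) \<and>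
     g x = (q (w x) \<oplus>\<^bsub>D\<^esub> differential D (k x)) \<ominus>\<^bsub>D\<^esub> k (d x)"

definition lift_maps :: "('g \<Rightarrow> 'b) \<Rightarrow> ('g \<Rightarrow> 'c) \<Rightarrow> bool" where
  "lift_maps w k \<longleftrightarrow> w \<in> deg_hom R (t - a) G A \<and> k \<in> deg_hom R (t - 2 * a) G D"

lemma G_module: "graded_module R G" and A_module: "graded_module R A" and D_module: "graded_module R D"
  by unfold_locales

lemma lift_at_submodule:
  assumes "lift_maps w k"
  shows "submodule {x \<in> carrier G. lift_at w k x} R G"
proof -
  have w: "w \<in> deg_hom R (t - a) G A" and k: "k \<in> deg_hom R (t - 2 * a) G D"
    using assms by (auto simp: lift_maps_def)
  have 1: "(\<lambda>x. differential A (w x) \<oplus>\<^bsub>A\<^esub> w (d x)) \<in> deg_hom R t G A"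
    by (rule deg_hom_add[OF A_module deg_hom_comp[OF w q.D.d.hom] deg_hom_comp[OF d_hom w]]) simp_all
  have "(\<lambda>x. q (w x) \<oplus>\<^bsub>D\<^esub> differential D (k x)) \<in> deg_hom R (t - a) G D"
    by (rule deg_hom_add[OF D_module deg_hom_comp[OF w q.hom] deg_hom_comp[OF k q.E.d.hom]]) simp_all
  then have 2: "(\<lambda>x. (q (w x) \<oplus>\<^bsub>D\<^esub> differential D (k x)) \<ominus>\<^bsub>D\<^esub> k (d x)) \<in> deg_hom R (t - a) G D"
    by (rule deg_hom_minus[OF D_module _ deg_hom_comp[OF d_hom k]]) simp
  have "{x \<in> carrier G. lift_at w k x} =
      {x \<in> carrier G. u x = differential A (w x) \<oplus>\<^bsub>A\<^esub> w (d x)} \<inter>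
      {x \<in> carrier G. g x = (q (w x) \<oplus>\<^bsub>D\<^esub> differential D (k x)) \<ominus>\<^bsub>D\<^esub> k (d x)}"
    by (auto simp: lift_at_def)
  then show ?thesis
    using equalizer_submodule[OF G_module A_module u_hom 1] equalizer_submodule[OF G_module D_module g_hom 2]
    by (auto simp: submodule_iff)
qed

lemma layer_carrier: "(\<Union>j<i. \<beta> j) \<subseteq> carrier G"
  using basis_carrier by blast

lemma agree_on_layers:
  assumes "lift_maps w k" and "lift_maps w' k'"
    and "\<And>j b. j < i \<Longrightarrow> b \<in> \<beta> j \<Longrightarrow> w' b = w b \<and> k' b = k b"
    and "x \<in> submodule_span R G (\<Union>j<i. \<beta> j)"
  shows "w' x = w x" and "k' x = k x"
proof -
  have w: "w \<in> deg_hom R (t - a) G A" "w' \<in> deg_hom R (t - a) G A"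
    and k: "k \<in> deg_hom R (t - 2 * a) G D" "k' \<in> deg_hom R (t - 2 * a) G D"
    using assms(1,2) by (auto simp: lift_maps_def)
  have "(\<Union>j<i. \<beta> j) \<subseteq> {x \<in> carrier G. w' x = w x}" "(\<Union>j<i. \<beta> j) \<subseteq> {x \<in> carrier G. k' x = k x}"
    using assms(3) layer_carrier[of i] by auto
  then have "x \<in> {x \<in> carrier G. w' x = w x}" "x \<in> {x \<in> carrier G. k' x = k x}"
    using span_minimal[OF equalizer_submodule[OF G_module A_module w(2,1)] _ assms(4)]
      span_minimal[OF equalizer_submodule[OF G_module D_module k(2,1)] _ assms(4)] by simp_all
  then show "w' x = w x" and "k' x = k x" by simp_all
qed

text \<open>One basis element: \<open>(u b - w(db), g b + k(db))\<close> is a cycle of the acyclic mapping cone of \<open>q\<close>.\<close>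

lemma lift_basis_element:
  assumes wk: "lift_maps w k" and b: "b \<in> carrier G" "b \<in> mpart G j" and low: "lift_at w k (d b)"
  obtains x' y' where "x' \<in> mpart A (t - a + j)" and "y' \<in> mpart D (t - 2 * a + j)"
    and "u b = differential A x' \<oplus>\<^bsub>A\<^esub> w (d b)"
    and "g b = (q x' \<oplus>\<^bsub>D\<^esub> differential D y') \<ominus>\<^bsub>D\<^esub> k (d b)"
proof -
  interpret w: graded_linear R "t - a" G A w by unfold_locales (use wk lift_maps_def in simp)
  interpret k: graded_linear R "t - 2 * a" G D k by unfold_locales (use wk lift_maps_def in simp)
  have db: "d b \<in> mpart G (a + j)" "d b \<in> carrier G" using d.part[OF b(2)] b by auto
  let ?x = "u b \<ominus>\<^bsub>A\<^esub> w (d b)" and ?y = "g b \<oplus>\<^bsub>D\<^esub> k (d b)"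
  have "w (d b) \<in> mpart A (t + j)" "k (d b) \<in> mpart D (t - a + j)"
    using w.part[OF db(1)] k.part[OF db(1)] by (simp_all add: algebra_simps)
  then have x: "?x \<in> mpart A (t + j)" and y: "?y \<in> mpart D (t - a + j)"
    using u.part[OF b(2)] g.part[OF b(2)]
    by (simp_all add: q.D.M.minus_eq q.D.parts.part_add q.D.parts.part_neg q.E.parts.part_add)
  have x': "?x \<in> mpart A (a + (t - a + j))" using x by (simp add: algebra_simps)
  have udb: "u (d b) = differential A (w (d b))"
    and gdb: "g (d b) = q (w (d b)) \<oplus>\<^bsub>D\<^esub> differential D (k (d b))"
    using low b db by (simp_all add: lift_at_def d_d)
  have dx: "differential A ?x = \<zero>\<^bsub>A\<^esub>"
    using b db udb u_commute[OF b(1)] by (simp add: q.D.d.minus)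
  have "q ?x = (differential D (g b) \<oplus>\<^bsub>D\<^esub> g (d b)) \<ominus>\<^bsub>D\<^esub> q (w (d b))"
    using b db qu[OF b(1)] by (simp add: q.minus)
  also have "\<dots> = differential D (g b) \<oplus>\<^bsub>D\<^esub> differential D (k (d b))"
    unfolding gdb using b db q.E.M.add_diff_cancel(1)[of "differential D (g b) \<oplus>\<^bsub>D\<^esub> differential D (k (d b))" "q (w (d b))"]
    by (simp add: q.E.M.a_ac)
  finally have dy: "differential D ?y = q ?x" using b db by (simp add: q.E.d.add)
  obtain x1 y1 where 1: "x1 \<in> mpart A (t - a + j)" "y1 \<in> mpart D (t - a + j - a)"
    "?x = differential A x1" "?y = q x1 \<oplus>\<^bsub>D\<^esub> differential D y1"
    by (rule q.quasi_isomorphism_cone_acyclic[OF quasi_iso x' dx y dy])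
  have "u b = differential A x1 \<oplus>\<^bsub>A\<^esub> w (d b)"
    unfolding 1(3)[symmetric] using b db by (simp add: q.D.M.add_minus_cancel)
  moreover have "g b = (q x1 \<oplus>\<^bsub>D\<^esub> differential D y1) \<ominus>\<^bsub>D\<^esub> k (d b)"
    unfolding 1(4)[symmetric] using b db by (simp add: q.E.M.add_diff_cancel)
  moreover have "y1 \<in> mpart D (t - 2 * a + j)" using 1(2) by (simp add: algebra_simps)
  ultimately show ?thesis using that 1(1) by blast
qed

lemma lift_next_layer:
  assumes wk: "lift_maps w k" and low: "\<And>j b. j < i \<Longrightarrow> b \<in> \<beta> j \<Longrightarrow> lift_at w k b"
  obtains w' k' where "lift_maps w' k'" and "\<forall>j<Suc i. \<forall>b \<in> \<beta> j. lift_at w' k' b"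
    and "\<forall>b \<in> (\<Union>j. \<beta> j) - \<beta> i. w' b = w b \<and> k' b = k b"
proof -
  interpret w: graded_linear R "t - a" G A w by unfold_locales (use wk lift_maps_def in simp)
  interpret k: graded_linear R "t - 2 * a" G D k by unfold_locales (use wk lift_maps_def in simp)
  have low_span: "lift_at w k x" if "x \<in> submodule_span R G (\<Union>j<i. \<beta> j)" for x
    using span_minimal[OF lift_at_submodule[OF wk] _ that] low layer_carrier[of i] by auto
  have "\<exists>x' y'. (\<forall>j. b \<in> mpart G j \<longrightarrow> x' \<in> mpart A (t - a + j) \<and> y' \<in> mpart D (t - 2 * a + j)) \<and>
      u b = differential A x' \<oplus>\<^bsub>A\<^esub> w (d b) \<and> g b = (q x' \<oplus>\<^bsub>D\<^esub> differential D y') \<ominus>\<^bsub>D\<^esub> k (d b)"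
    if b: "b \<in> \<beta> i" for b
  proof -
    have bB: "b \<in> (\<Union>j. \<beta> j)" using b by blast
    then obtain j where j: "b \<in> mpart G j" using homogeneous_basis by blast
    obtain x' y' where "x' \<in> mpart A (t - a + j)" "y' \<in> mpart D (t - 2 * a + j)"
      "u b = differential A x' \<oplus>\<^bsub>A\<^esub> w (d b)" "g b = (q x' \<oplus>\<^bsub>D\<^esub> differential D y') \<ominus>\<^bsub>D\<^esub> k (d b)"
      by (rule lift_basis_element[OF wk basis_carrier[OF bB] j low_span[OF d_lowers[OF b]]])
    then show ?thesis using basis_degree_unique[OF bB j] by metis
  qed
  then obtain X Y where XY: "\<And>b j. b \<in> \<beta> i \<Longrightarrow> b \<in> mpart G j \<Longrightarrow> X b \<in> mpart A (t - a + j)"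
    "\<And>b j. b \<in> \<beta> i \<Longrightarrow> b \<in> mpart G j \<Longrightarrow> Y b \<in> mpart D (t - 2 * a + j)"
    "\<And>b. b \<in> \<beta> i \<Longrightarrow> u b = differential A (X b) \<oplus>\<^bsub>A\<^esub> w (d b)"
    "\<And>b. b \<in> \<beta> i \<Longrightarrow> g b = (q (X b) \<oplus>\<^bsub>D\<^esub> differential D (Y b)) \<ominus>\<^bsub>D\<^esub> k (d b)"
    by metis
  obtain w' where w': "w' \<in> deg_hom R (t - a) G A"
    "\<forall>b \<in> (\<Union>j. \<beta> j). w' b = (if b \<in> \<beta> i then X b else w b)"
    by (rule free_extension[OF A_module, of "\<lambda>b. if b \<in> \<beta> i then X b else w b" "t - a"])
      (simp add: XY(1) w.part)
  obtain k' where k': "k' \<in> deg_hom R (t - 2 * a) G D"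
    "\<forall>b \<in> (\<Union>j. \<beta> j). k' b = (if b \<in> \<beta> i then Y b else k b)"
    by (rule free_extension[OF D_module, of "\<lambda>b. if b \<in> \<beta> i then Y b else k b" "t - 2 * a"])
      (simp add: XY(2) k.part)
  have wk': "lift_maps w' k'" using w'(1) k'(1) by (simp add: lift_maps_def)
  have old: "w' b = w b \<and> k' b = k b" if "b \<in> \<beta> j" "j \<noteq> i" for b j
    using that w'(2) k'(2) layers_disjoint[of b j i] by auto
  have agree: "w' (d b) = w (d b)" "k' (d b) = k (d b)" if "b \<in> \<beta> j" "j \<le> i" for b j
    using agree_on_layers[OF wk wk', of j "d b"] old that d_lowers[OF that(1)] by auto
  have new: "lift_at w' k' b" if b: "j < Suc i" "b \<in> \<beta> j" for j b
  proof (cases "j = i")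
    case True
    then have "w' b = X b" "k' b = Y b" using w'(2) k'(2) b by auto
    then show ?thesis using XY(3,4)[of b] agree[of b j] b True by (simp add: lift_at_def)
  next
    case False
    then show ?thesis using low[of j b] old[of b j] agree[of b j] b by (simp add: lift_at_def)
  qed
  show ?thesis
  proof (rule that[OF wk'])
    show "\<forall>j<Suc i. \<forall>b \<in> \<beta> j. lift_at w' k' b" using new by blast
    show "\<forall>b \<in> (\<Union>j. \<beta> j) - \<beta> i. w' b = w b \<and> k' b = k b"
    proof
      fix b assume "b \<in> (\<Union>j. \<beta> j) - \<beta> i"
      then show "w' b = w b \<and> k' b = k b" using bspec[OF w'(2), of b] bspec[OF k'(2), of b] by simp
    qed
  qed
qed

text \<open>The maps of the successive layers are glued: on \<open>\<beta> i\<close> they no longer change after stage \<open>i + 1\<close>.\<close>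

lemma lift:
  obtains w k where "w \<in> deg_hom R (t - a) G A" and "k \<in> deg_hom R (t - 2 * a) G D"
    and "\<forall>x \<in> carrier G. u x = differential A (w x) \<oplus>\<^bsub>A\<^esub> w (d x)"
    and "\<forall>x \<in> carrier G. g x = (q (w x) \<oplus>\<^bsub>D\<^esub> differential D (k x)) \<ominus>\<^bsub>D\<^esub> k (d x)"
proof -
  let ?P = "\<lambda>i wk. lift_maps (fst wk) (snd wk) \<and> (\<forall>j<i. \<forall>b \<in> \<beta> j. lift_at (fst wk) (snd wk) b)"
  let ?Q = "\<lambda>i wk wk'. \<forall>b \<in> (\<Union>j. \<beta> j) - \<beta> i. fst wk' b = fst wk b \<and> snd wk' b = snd wk b"
  have "\<exists>f. \<forall>n. ?P n (f n) \<and> ?Q n (f n) (f (Suc n))"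
  proof (rule dependent_nat_choice)
    have "?P 0 (\<lambda>x. \<zero>\<^bsub>A\<^esub>, \<lambda>x. \<zero>\<^bsub>D\<^esub>)"
      by (simp add: lift_maps_def deg_hom_zero[OF A_module] deg_hom_zero[OF D_module])
    then show "\<exists>wk. ?P 0 wk" by blast
    fix wk i assume P: "?P i wk"
    obtain w' k' where "lift_maps w' k'" "\<forall>j<Suc i. \<forall>b \<in> \<beta> j. lift_at w' k' b"
      "\<forall>b \<in> (\<Union>j. \<beta> j) - \<beta> i. w' b = fst wk b \<and> k' b = snd wk b"
      by (rule lift_next_layer[of "fst wk" "snd wk" i]) (use P in auto)
    then show "\<exists>wk'. ?P (Suc i) wk' \<and> ?Q i wk wk'" by (intro exI[of _ "(w', k')"]) simp
  qed
  then obtain f where f: "\<forall>n. ?P n (f n) \<and> ?Q n (f n) (f (Suc n))" by (rule exE)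
  have P: "?P n (f n)" and Q: "?Q n (f n) (f (Suc n))" for n
    using spec[OF f, of n] by (rule conjunct1, rule conjunct2)
  have stable: "fst (f (Suc i + n)) b = fst (f (Suc i)) b \<and> snd (f (Suc i + n)) b = snd (f (Suc i)) b"
    if "b \<in> \<beta> i" for b i n
  proof (induction n)
    case (Suc n)
    have "b \<in> (\<Union>j. \<beta> j) - \<beta> (Suc i + n)" using that layers_disjoint[OF that, of "Suc i + n"] by auto
    then show ?case using Q[of "Suc i + n"] Suc by simp
  qed simp
  define layer where "layer b = (THE i. b \<in> \<beta> i)" for b
  have layer: "layer b = i" if "b \<in> \<beta> i" for b i
    unfolding layer_def using that layers_disjoint by blast
  have hw: "fst (f n) \<in> deg_hom R (t - a) G A" and hk: "snd (f n) \<in> deg_hom R (t - 2 * a) G D" for n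
    using P[of n] by (auto simp: lift_maps_def)
  obtain w where w: "w \<in> deg_hom R (t - a) G A" "\<forall>b \<in> (\<Union>j. \<beta> j). w b = fst (f (Suc (layer b))) b"
    by (rule free_extension[OF A_module, of "\<lambda>b. fst (f (Suc (layer b))) b" "t - a"])
      (use hw in \<open>auto simp: deg_hom_def\<close>)
  obtain k where k: "k \<in> deg_hom R (t - 2 * a) G D" "\<forall>b \<in> (\<Union>j. \<beta> j). k b = snd (f (Suc (layer b))) b"
    by (rule free_extension[OF D_module, of "\<lambda>b. snd (f (Suc (layer b))) b" "t - 2 * a"])
      (use hk in \<open>auto simp: deg_hom_def\<close>)
  have wk: "lift_maps w k" using w(1) k(1) by (simp add: lift_maps_def)
  have same: "w b = fst (f n) b \<and> k b = snd (f n) b" if "b \<in> \<beta> i" "i < n" for b i n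
  proof -
    have "n = Suc i + (n - Suc i)" using that(2) by simp
    then show ?thesis using stable[OF that(1), of "n - Suc i"] w(2) k(2) that(1) layer[OF that(1)] by auto
  qed
  have "lift_at w k b" if b: "b \<in> \<beta> i" for b i
  proof -
    have Pi: "lift_maps (fst (f (Suc i))) (snd (f (Suc i)))" using P by blast
    have "w (d b) = fst (f (Suc i)) (d b)" "k (d b) = snd (f (Suc i)) (d b)"
      using agree_on_layers[OF Pi wk, of i "d b"] same[of _ _ "Suc i"] d_lowers[OF b] by auto
    moreover have "lift_at (fst (f (Suc i))) (snd (f (Suc i))) b" using P[of "Suc i"] b by blast
    ultimately show ?thesis using same[OF b, of "Suc i"] by (simp add: lift_at_def)
  qed
  then have "(\<Union>j. \<beta> j) \<subseteq> {x \<in> carrier G. lift_at w k x}" using basis_carrier by auto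
  then have "lift_at w k x" if "x \<in> carrier G" for x
    using span_minimal[OF lift_at_submodule[OF wk], of "\<Union>j. \<beta> j" x] that basis_span by simp
  then show ?thesis using that[OF w(1) k(1)] by (simp add: lift_at_def)
qed

end

text \<open>The union of homogeneous bases of the \<open>\<Phi> i\<close>. The projections onto the \<open>\<Phi> i\<close> are linear, so linear
  independence is tested in one layer at a time.\<close>

lemma free_flag_layered_basis:
  assumes "local_graded_ring R" and flag: "free_flag R a F \<Phi>"
  obtains \<beta> where "layered_basis R F \<beta> a (differential F)"
proof -
  interpret local_graded_ring R by fact
  interpret F: diff_mod R a F using flag by unfold_locales (simp add: free_flag_def)
  interpret P: decomposed_group F \<Phi> using flag by unfold_locales (simp add: free_flag_def)
  have "\<exists>b. b \<subseteq> (\<Union>j. mpart (restrict_module F (\<Phi> i)) j) \<and> module_basis R (restrict_module F (\<Phi> i)) b" for i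
    using flag by (auto simp: free_flag_def free_graded_module_def)
  then obtain \<beta> where \<beta>_hom: "\<And>i. \<beta> i \<subseteq> (\<Union>j. mpart (restrict_module F (\<Phi> i)) j)"
    and \<beta>_basis: "\<And>i. module_basis R (restrict_module F (\<Phi> i)) (\<beta> i)" by metis
  have \<Phi>_module: "graded_module R (restrict_module F (\<Phi> i))" for i
    using flag by (simp add: free_flag_def free_graded_module_def)
  have based: "based_module R (restrict_module F (\<Phi> i)) (\<beta> i)" for i
    using graded_module.axioms(2)[OF \<Phi>_module] \<beta>_basis
    by (simp add: based_module_def based_module_axioms_def)
  have \<Phi>_smult: "r \<odot>\<^bsub>F\<^esub> x \<in> \<Phi> i" if "r \<in> carrier R" "x \<in> \<Phi> i" for r x i
    using left_module.smult_closed[OF graded_module.axioms(2)[OF \<Phi>_module[of i]], of r x] that by simp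
  have \<beta>\<Phi>: "b \<in> \<Phi> i" if "b \<in> \<beta> i" for b i
    using based_module.basis_carrier[OF based that] by simp
  have \<beta>c: "b \<in> carrier F" if "b \<in> \<beta> i" for b i
    using P.part_carrier[OF \<beta>\<Phi>[OF that]] .
  have Bc: "(\<Union>i\<in>I. \<beta> i) \<subseteq> carrier F" for I using \<beta>c by blast
  have \<Phi>_span: "x \<in> submodule_span R F (\<Union>i\<in>I. \<beta> i)" if x: "x \<in> \<Phi> i" "i \<in> I" for x i I
  proof -
    interpret b: based_module R "restrict_module F (\<Phi> i)" "\<beta> i" by (rule based)
    let ?c = "coord R (restrict_module F (\<Phi> i)) (\<beta> i) x"
    note s = F.submodule_span_submodule[OF Bc[of I]]
    have xc: "x \<in> carrier (restrict_module F (\<Phi> i))" using x by simp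
    have supp: "{b. ?c b \<noteq> \<zero>\<^bsub>R\<^esub>} \<subseteq> \<beta> i" by (rule b.coord_support[OF xc])
    have cR: "?c b \<in> carrier R" for b by (rule b.coord_closed[OF xc])
    have "x = (\<Oplus>\<^bsub>restrict_module F (\<Phi> i)\<^esub>b\<in>{b. ?c b \<noteq> \<zero>\<^bsub>R\<^esub>}. ?c b \<odot>\<^bsub>F\<^esub> b)"
      using b.coord_sum[OF xc] by simp
    also have "\<dots> = (\<Oplus>\<^bsub>F\<^esub>b\<in>{b. ?c b \<noteq> \<zero>\<^bsub>R\<^esub>}. ?c b \<odot>\<^bsub>F\<^esub> b)"
      by (rule F.restrict_finsum[OF P.part_subgroup]) (use supp \<Phi>_smult[OF cR \<beta>\<Phi>] in blast)
    also have "\<dots> \<in> submodule_span R F (\<Union>i\<in>I. \<beta> i)"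
      by (rule F.submodule_finsum[OF s], rule F.submoduleD(5)[OF s cR], rule F.span_subset)
        (use supp x(2) in blast)
    finally show ?thesis .
  qed
  have comp_smult: "component F \<Phi> i (c \<odot>\<^bsub>F\<^esub> b) = (if j = i then c \<odot>\<^bsub>F\<^esub> b else \<zero>\<^bsub>F\<^esub>)"
    if "c \<in> carrier R" "b \<in> \<beta> j" for c b i j
    using P.component_homogeneous[OF \<Phi>_smult[OF that(1) \<beta>\<Phi>[OF that(2)]], of i] by auto
  have disj: "i = j" if "b \<in> \<beta> i" "b \<in> \<beta> j" for b i j
  proof -
    have "b \<noteq> \<zero>\<^bsub>F\<^esub>" using based_module.basis_nonzero[OF based that(1) one_neq_zero] by simp
    then show ?thesis
      using P.component_homogeneous[OF \<beta>\<Phi>[OF that(1)], of i] P.component_homogeneous[OF \<beta>\<Phi>[OF that(2)], of i]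
      by (auto split: if_splits)
  qed
  have basis: "module_basis R F (\<Union>i. \<beta> i)"
  proof (rule F.module_basisI[OF Bc])
    note s = F.submodule_span_submodule[OF Bc[of UNIV]]
    show "carrier F \<subseteq> submodule_span R F (\<Union>i. \<beta> i)"
    proof
      fix x assume "x \<in> carrier F"
      then show "x \<in> submodule_span R F (\<Union>i. \<beta> i)"
      proof (induction rule: P.homogeneous_induct)
        case zero
        then show ?case by (rule F.submoduleD(3)[OF s])
      next
        case (add x y)
        then show ?case by (intro F.submoduleD(4)[OF s])
      next
        case (part i x)
        then show ?case by (rule \<Phi>_span) simp
      qed
    qed
    fix A c b
    assume A: "finite A" "A \<subseteq> (\<Union>i. \<beta> i)" "\<And>b. b \<in> A \<Longrightarrow> c b \<in> carrier R"
      and z: "(\<Oplus>\<^bsub>F\<^esub>b\<in>A. c b \<odot>\<^bsub>F\<^esub> b) = \<zero>\<^bsub>F\<^esub>" and b: "b \<in> A"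
    obtain i where i: "b \<in> \<beta> i" using A(2) b by blast
    have Ac: "b' \<in> A \<Longrightarrow> b' \<in> carrier F" for b' using A(2) \<beta>c by blast
    have term_eq: "component F \<Phi> i (c b' \<odot>\<^bsub>F\<^esub> b') = (if b' \<in> \<beta> i then c b' \<odot>\<^bsub>F\<^esub> b' else \<zero>\<^bsub>F\<^esub>)"
      if b': "b' \<in> A" for b'
    proof -
      obtain j where j: "b' \<in> \<beta> j" using A(2) b' by blast
      then show ?thesis using comp_smult[OF A(3)[OF b'] j, of i] disj[OF j, of i] by auto
    qed
    have "\<zero>\<^bsub>F\<^esub> = component F \<Phi> i (\<Oplus>\<^bsub>F\<^esub>b\<in>A. c b \<odot>\<^bsub>F\<^esub> b)" using z by simp
    also have "\<dots> = (\<Oplus>\<^bsub>F\<^esub>b\<in>A. component F \<Phi> i (c b \<odot>\<^bsub>F\<^esub> b))"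
      by (rule abelian_group_hom.hom_finsum[OF P.component_hom]) (use A(3) Ac in auto)
    also have "\<dots> = (\<Oplus>\<^bsub>F\<^esub>b\<in>A \<inter> \<beta> i. component F \<Phi> i (c b \<odot>\<^bsub>F\<^esub> b))"
      by (rule F.M.finsum_superset[symmetric, OF A(1)]) (use A(3) Ac term_eq in auto)
    also have "\<dots> = (\<Oplus>\<^bsub>F\<^esub>b\<in>A \<inter> \<beta> i. c b \<odot>\<^bsub>F\<^esub> b)"
      by (rule F.M.finsum_cong') (use A(3) Ac term_eq in auto)
    also have "\<dots> = (\<Oplus>\<^bsub>restrict_module F (\<Phi> i)\<^esub>b\<in>A \<inter> \<beta> i. c b \<odot>\<^bsub>F\<^esub> b)"
      by (rule F.restrict_finsum[symmetric, OF P.part_subgroup]) (use A(3) \<Phi>_smult \<beta>\<Phi> in blast)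
    finally have "(\<Oplus>\<^bsub>restrict_module F (\<Phi> i)\<^esub>b\<in>A \<inter> \<beta> i. c b \<odot>\<^bsub>restrict_module F (\<Phi> i)\<^esub> b) =
        \<zero>\<^bsub>restrict_module F (\<Phi> i)\<^esub>" by simp
    then show "c b = \<zero>\<^bsub>R\<^esub>"
      using based_module.basis_independent[OF based[of i], of "A \<inter> \<beta> i" c b] A b i by blast
  qed
  have hom: "(\<Union>i. \<beta> i) \<subseteq> (\<Union>j. mpart F j)" using \<beta>_hom by fastforce
  have lowers: "differential F b \<in> submodule_span R F (\<Union>j<i. \<beta> j)" if b: "b \<in> \<beta> i" for b i
  proof -
    note s = F.submodule_span_submodule[OF Bc[of "{..<i}"]]
    have "differential F b \<in> {(\<Oplus>\<^bsub>F\<^esub>j\<in>{..<i}. f j) | f. \<forall>j<i. f j \<in> \<Phi> j}"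
      using flag \<beta>\<Phi>[OF b] unfolding free_flag_def by blast
    then obtain f where f: "differential F b = (\<Oplus>\<^bsub>F\<^esub>j\<in>{..<i}. f j)" "\<forall>j<i. f j \<in> \<Phi> j" by blast
    show ?thesis unfolding f(1)
      by (rule F.submodule_finsum[OF s], rule \<Phi>_span) (use f(2) in auto)
  qed
  have "layered_basis R F \<beta> a (differential F)"
    by unfold_locales (use basis hom one_neq_zero disj F.d.hom F.d_d lowers in blast)+
  then show ?thesis by (rule that)
qed

section \<open>Summands of free flags up to homotopy\<close>

definition homotopic ::
    "'a gr_ring \<Rightarrow> int \<Rightarrow> ('a, 'b) diff_module \<Rightarrow> ('a, 'c) diff_module \<Rightarrow> ('b \<Rightarrow> 'c) \<Rightarrow> ('b \<Rightarrow> 'c) \<Rightarrow> bool" where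
  "homotopic R a M D f g \<longleftrightarrow> (\<exists>k \<in> deg_hom R (- a) M D. \<forall>x \<in> carrier M.
     f x = g x \<oplus>\<^bsub>D\<^esub> (differential D (k x) \<oplus>\<^bsub>D\<^esub> k (differential M x)))"

lemma homotopicI:
  assumes "k \<in> deg_hom R (- a) M D"
    and "\<And>x. x \<in> carrier M \<Longrightarrow> f x = g x \<oplus>\<^bsub>D\<^esub> (differential D (k x) \<oplus>\<^bsub>D\<^esub> k (differential M x))"
  shows "homotopic R a M D f g"
  unfolding homotopic_def by (rule bexI[OF _ assms(1)]) (use assms(2) in blast)

lemma homotopic_trans:
  assumes "diff_mod R a M" and "diff_mod R a D" and "homotopic R a M D f g" and "homotopic R a M D g h"
    and h: "h \<in> carrier M \<rightarrow> carrier D"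
  shows "homotopic R a M D f h"
proof -
  interpret M: diff_mod R a M by fact
  interpret D: diff_mod R a D by fact
  obtain k where k: "k \<in> deg_hom R (- a) M D"
    "\<forall>x\<in>carrier M. f x = g x \<oplus>\<^bsub>D\<^esub> (differential D (k x) \<oplus>\<^bsub>D\<^esub> k (differential M x))"
    using assms(3) by (auto simp: homotopic_def)
  obtain l where l: "l \<in> deg_hom R (- a) M D"
    "\<forall>x\<in>carrier M. g x = h x \<oplus>\<^bsub>D\<^esub> (differential D (l x) \<oplus>\<^bsub>D\<^esub> l (differential M x))"
    using assms(4) by (auto simp: homotopic_def)
  interpret k: graded_linear R "- a" M D k by unfold_locales (rule k(1))
  interpret l: graded_linear R "- a" M D l by unfold_locales (rule l(1))
  have "f x = h x \<oplus>\<^bsub>D\<^esub> (differential D (l x \<oplus>\<^bsub>D\<^esub> k x) \<oplus>\<^bsub>D\<^esub> (l (differential M x) \<oplus>\<^bsub>D\<^esub> k (differential M x)))"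
    if x: "x \<in> carrier M" for x
  proof -
    have c: "h x \<in> carrier D" using h x by auto
    have "f x = (h x \<oplus>\<^bsub>D\<^esub> (differential D (l x) \<oplus>\<^bsub>D\<^esub> l (differential M x))) \<oplus>\<^bsub>D\<^esub>
        (differential D (k x) \<oplus>\<^bsub>D\<^esub> k (differential M x))" using k(2) l(2) x by simp
    then show ?thesis using c x by (simp add: D.d.add D.M.a_ac)
  qed
  then show ?thesis by (rule homotopicI[OF deg_hom_add[OF D.graded_module_axioms l(1) k(1)]])
qed

lemma homotopic_precomp:
  assumes "diff_morph R a N M f" and "homotopic R a M D g h"
  shows "homotopic R a N D (\<lambda>x. g (f x)) (\<lambda>x. h (f x))"
proof -
  interpret f: diff_morph R a N M f by fact
  obtain k where k: "k \<in> deg_hom R (- a) M D"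
    "\<forall>x\<in>carrier M. g x = h x \<oplus>\<^bsub>D\<^esub> (differential D (k x) \<oplus>\<^bsub>D\<^esub> k (differential M x))"
    using assms(2) by (auto simp: homotopic_def)
  have "(\<lambda>x. k (f x)) \<in> deg_hom R (- a) N D" by (rule deg_hom_comp[OF f.hom k(1)]) simp
  then show ?thesis by (rule homotopicI) (use k(2) f.commute in auto)
qed

text \<open>A direct summand, as a differential module, of a free flag.\<close>

locale flag_summand = diff_mod R a M
  for R :: "'a gr_ring" and a :: int and M :: "('a, 'b) diff_module" +
  fixes G :: "('a, 'g) diff_module" and \<Phi> :: "nat \<Rightarrow> 'g set" and \<iota> :: "'b \<Rightarrow> 'g" and p :: "'g \<Rightarrow> 'b"
  assumes local: "local_graded_ring R" and flag: "free_flag R a G \<Phi>"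
    and \<iota>_morphism: "\<iota> \<in> diff_morphism R M G" and p_morphism: "p \<in> diff_morphism R G M"
    and p_\<iota>: "x \<in> carrier M \<Longrightarrow> p (\<iota> x) = x"

sublocale flag_summand \<subseteq> G: diff_mod R a G
  using flag by unfold_locales (simp add: free_flag_def)

sublocale flag_summand \<subseteq> \<iota>: diff_morph R a M G \<iota>
  by unfold_locales (rule \<iota>_morphism)

sublocale flag_summand \<subseteq> p: diff_morph R a G M p
  by unfold_locales (rule p_morphism)

context flag_summand
begin

text \<open>For the negated differential on \<open>G\<close> and \<open>u = 0\<close> the first lifting equation says that \<open>w\<close> is a
  chain map, and the second that \<open>g p\<close> and \<open>q w\<close> are homotopic.\<close>

lemma lift_up_to_homotopy:
  assumes "diff_morph R a A D q" and q: "quasi_isomorphism R A D q" and "diff_morph R a M D g"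
  obtains f where "diff_morph R a M A f" and "homotopic R a M D g (\<lambda>x. q (f x))"
proof -
  interpret q: diff_morph R a A D q by fact
  interpret g: diff_morph R a M D g by fact
  obtain \<beta> where "layered_basis R G \<beta> a (differential G)" by (rule free_flag_layered_basis[OF local flag])
  then interpret L: layered_basis R G \<beta> a "differential G" .
  let ?d = "\<lambda>x. \<ominus>\<^bsub>G\<^esub> differential G x"
  have gp: "(\<lambda>x. g (p x)) \<in> deg_hom R 0 G D" by (rule deg_hom_comp[OF p.hom g.hom]) simp
  \<comment> \<open>Kept opaque: as a literal constant function it would give simplification rules with a free premise.\<close>
  define z where "z = (\<lambda>x :: 'g. \<zero>\<^bsub>A\<^esub>)"
  have z: "z x = \<zero>\<^bsub>A\<^esub>" for x by (simp add: z_def)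
  interpret P: lifting_problem R G \<beta> a ?d A D q a z "\<lambda>x. g (p x)"
  proof unfold_locales
    show "?d \<in> deg_hom R a G G" by (rule deg_hom_neg[OF G.graded_module_axioms L.d_hom])
    show "?d (?d x) = \<zero>\<^bsub>G\<^esub>" if "x \<in> carrier G" for x using that by (simp add: G.d.neg)
    show "?d b \<in> submodule_span R G (\<Union>j<i. \<beta> j)" if "b \<in> \<beta> i" for b i
    proof -
      have "(\<Union>j<i. \<beta> j) \<subseteq> carrier G" using L.basis_carrier by auto
      then show ?thesis by (rule G.submoduleD(6)[OF G.submodule_span_submodule L.d_lowers[OF that]])
    qed
    show "z \<in> deg_hom R a G A" unfolding z_def by (rule deg_hom_zero[OF q.D.graded_module_axioms])
    show "(\<lambda>x. g (p x)) \<in> deg_hom R (a - a) G D" using gp by simp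
    show "q (z x) = differential D (g (p x)) \<oplus>\<^bsub>D\<^esub> g (p (?d x))" if "x \<in> carrier G" for x
      using that by (simp add: z p.neg g.neg p.commute g.commute q.E.M.r_neg)
  qed (use L.layers_disjoint q in \<open>auto simp: z\<close>)
  obtain w k where w: "w \<in> deg_hom R (a - a) G A" and k: "k \<in> deg_hom R (a - 2 * a) G D"
    and eq1: "\<forall>x \<in> carrier G. z x = differential A (w x) \<oplus>\<^bsub>A\<^esub> w (?d x)"
    and eq2: "\<forall>x \<in> carrier G. g (p x) = (q (w x) \<oplus>\<^bsub>D\<^esub> differential D (k x)) \<ominus>\<^bsub>D\<^esub> k (?d x)"
    by (rule P.lift)
  have w0: "w \<in> deg_hom R 0 G A" and ka: "k \<in> deg_hom R (- a) G D" using w k by simp_all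
  interpret w: graded_linear R 0 G A w
    by (rule graded_linear.intro[OF G.graded_module_axioms q.D.graded_module_axioms w0])
  interpret k: graded_linear R "- a" G D k
    by (rule graded_linear.intro[OF G.graded_module_axioms q.E.graded_module_axioms ka])
  have chain: "w (differential G x) = differential A (w x)" if x: "x \<in> carrier G" for x
  proof -
    have "differential A (w x) \<ominus>\<^bsub>A\<^esub> w (differential G x) = \<zero>\<^bsub>A\<^esub>"
      using bspec[OF eq1 x, symmetric] x by (simp add: z w.neg q.D.M.minus_eq)
    then show ?thesis
      using x q.D.M.add_minus_cancel(1)[of "differential A (w x)" "w (differential G x)"] by simp
  qed
  have w\<iota>: "(\<lambda>x. w (\<iota> x)) \<in> deg_hom R 0 M A" by (rule deg_hom_comp[OF \<iota>.hom w0]) simp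
  have k\<iota>: "(\<lambda>x. k (\<iota> x)) \<in> deg_hom R (- a) M D" by (rule deg_hom_comp[OF \<iota>.hom ka]) simp
  have "(\<lambda>x. w (\<iota> x)) \<in> diff_morphism R M A"
    using w\<iota> chain \<iota>.commute by (auto simp: diff_morphism_def graded_hom_deg_hom)
  then have morph: "diff_morph R a M A (\<lambda>x. w (\<iota> x))" by unfold_locales
  have "g x = q (w (\<iota> x)) \<oplus>\<^bsub>D\<^esub> (differential D (k (\<iota> x)) \<oplus>\<^bsub>D\<^esub> k (\<iota> (differential M x)))"
    if x: "x \<in> carrier M" for x
    using bspec[OF eq2 \<iota>.closed[OF x]] x p_\<iota>[OF x]
    by (simp add: k.neg \<iota>.commute q.E.M.minus_eq q.E.M.a_assoc)
  then have "homotopic R a M D g (\<lambda>x. q (w (\<iota> x)))" by (rule homotopicI[OF k\<iota>])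
  then show ?thesis using that morph by blast
qed

lemma null_homotopic_if_composite:
  assumes "diff_morph R a A D q" and q: "quasi_isomorphism R A D q" and "diff_morph R a M A u"
    and null: "homotopic R a M D (\<lambda>x. q (u x)) (\<lambda>x. \<zero>\<^bsub>D\<^esub>)"
  shows "homotopic R a M A u (\<lambda>x. \<zero>\<^bsub>A\<^esub>)"
proof -
  interpret q: diff_morph R a A D q by fact
  interpret u: diff_morph R a M A u by fact
  obtain \<beta> where "layered_basis R G \<beta> a (differential G)" by (rule free_flag_layered_basis[OF local flag])
  then interpret L: layered_basis R G \<beta> a "differential G" .
  obtain h where h: "h \<in> deg_hom R (- a) M D"
    "\<forall>x\<in>carrier M. q (u x) = \<zero>\<^bsub>D\<^esub> \<oplus>\<^bsub>D\<^esub> (differential D (h x) \<oplus>\<^bsub>D\<^esub> h (differential M x))"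
    using null by (auto simp: homotopic_def)
  interpret h: graded_linear R "- a" M D h by unfold_locales (rule h(1))
  interpret P: lifting_problem R G \<beta> a "differential G" A D q 0 "\<lambda>x. u (p x)" "\<lambda>x. h (p x)"
  proof unfold_locales
    show "(\<lambda>x. u (p x)) \<in> deg_hom R 0 G A" by (rule deg_hom_comp[OF p.hom u.hom]) simp
    show "(\<lambda>x. h (p x)) \<in> deg_hom R (0 - a) G D" by (rule deg_hom_comp[OF p.hom h(1)]) simp
    show "u (p (differential G x)) = differential A (u (p x))" if "x \<in> carrier G" for x
      using that by (simp add: p.commute u.commute)
    show "q (u (p x)) = differential D (h (p x)) \<oplus>\<^bsub>D\<^esub> h (p (differential G x))" if "x \<in> carrier G" for x
      using that h(2) by (simp add: p.commute)
  qed (rule q)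
  obtain w k where w: "w \<in> deg_hom R (0 - a) G A"
    and eq: "\<forall>x \<in> carrier G. u (p x) = differential A (w x) \<oplus>\<^bsub>A\<^esub> w (differential G x)"
    by (rule P.lift)
  interpret w: graded_linear R "0 - a" G A w
    by (rule graded_linear.intro[OF G.graded_module_axioms q.D.graded_module_axioms w])
  have w\<iota>: "(\<lambda>x. w (\<iota> x)) \<in> deg_hom R (- a) M A" by (rule deg_hom_comp[OF \<iota>.hom w]) simp
  have "u x = \<zero>\<^bsub>A\<^esub> \<oplus>\<^bsub>A\<^esub> (differential A (w (\<iota> x)) \<oplus>\<^bsub>A\<^esub> w (\<iota> (differential M x)))"
    if x: "x \<in> carrier M" for x
    using bspec[OF eq \<iota>.closed[OF x]] x p_\<iota>[OF x] by (simp add: \<iota>.commute)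
  then show ?thesis by (rule homotopicI[OF w\<iota>])
qed

text \<open>On a minimal module a null-homotopic map has values in \<open>\<mm>M\<close>, so a self-map over \<open>D\<close> is the
  identity modulo \<open>\<mm>M\<close>.\<close>

lemma self_map_over_quasi_isomorphism:
  assumes "diff_morph R a M D \<mu>" and q: "quasi_isomorphism R M D \<mu>" and "diff_morph R a M M e"
    and over: "homotopic R a M D \<mu> (\<lambda>x. \<mu> (e x))"
    and minimal: "differential M ` carrier M \<subseteq> max_ideal_times R M" and x: "x \<in> carrier M"
  shows "x \<ominus>\<^bsub>M\<^esub> e x \<in> max_ideal_times R M"
proof -
  interpret \<mu>: diff_morph R a M D \<mu> by fact
  interpret e: diff_morph R a M M e by fact
  interpret R: local_graded_ring R by (rule local)
  interpret M: module_over_local R M by unfold_locales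
  let ?u = "\<lambda>x. x \<ominus>\<^bsub>M\<^esub> e x"
  have "?u \<in> deg_hom R 0 M M" by (rule deg_hom_minus[OF graded_module_axioms deg_hom_id e.hom])
  then have "?u \<in> diff_morphism R M M"
    by (simp add: diff_morphism_def graded_hom_deg_hom d.minus e.commute)
  then have u: "diff_morph R a M M ?u" by unfold_locales
  obtain k where k: "k \<in> deg_hom R (- a) M D"
    "\<forall>x\<in>carrier M. \<mu> x = \<mu> (e x) \<oplus>\<^bsub>D\<^esub> (differential D (k x) \<oplus>\<^bsub>D\<^esub> k (differential M x))"
    using over by (auto simp: homotopic_def)
  interpret k: graded_linear R "- a" M D k by unfold_locales (rule k(1))
  have "\<mu> (?u x) = \<zero>\<^bsub>D\<^esub> \<oplus>\<^bsub>D\<^esub> (differential D (k x) \<oplus>\<^bsub>D\<^esub> k (differential M x))" if x: "x \<in> carrier M" for x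
  proof -
    have "\<mu> (?u x) = \<mu> x \<ominus>\<^bsub>D\<^esub> \<mu> (e x)" using x by (simp add: \<mu>.minus)
    also have "\<dots> = differential D (k x) \<oplus>\<^bsub>D\<^esub> k (differential M x)"
      unfolding bspec[OF k(2) x] using x by (intro \<mu>.E.M.add_diff_cancel(2)) auto
    finally show ?thesis using x by simp
  qed
  then have "homotopic R a M D (\<lambda>x. \<mu> (?u x)) (\<lambda>x. \<zero>\<^bsub>D\<^esub>)"
    by (rule homotopicI[OF k(1)])
  then have "homotopic R a M M ?u (\<lambda>x. \<zero>\<^bsub>M\<^esub>)"
    by (rule null_homotopic_if_composite[OF assms(1) q u])
  then obtain w where w: "w \<in> deg_hom R (- a) M M"
    "\<forall>x\<in>carrier M. ?u x = \<zero>\<^bsub>M\<^esub> \<oplus>\<^bsub>M\<^esub> (differential M (w x) \<oplus>\<^bsub>M\<^esub> w (differential M x))"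
    by (auto simp: homotopic_def)
  interpret w: graded_linear R "- a" M M w by unfold_locales (rule w(1))
  have "differential M (w x) \<in> max_ideal_times R M" "differential M x \<in> max_ideal_times R M"
    using minimal x by auto
  then have "differential M (w x) \<oplus>\<^bsub>M\<^esub> w (differential M x) \<in> max_ideal_times R M"
    using w.max_ideal_times_image R.mm_closed submoduleD(4)[OF M.mM_submodule] by blast
  then show ?thesis using bspec[OF w(2) x] x by simp
qed

end

section \<open>Minimal free resolutions\<close>

text \<open>If \<open>M\<close> is covered modulo \<open>\<mm>M\<close> by \<open>F\<close>, each basis element \<open>b\<close> of degree \<open>j\<close> has a nonzero coordinate in
  \<open>g s\<close> for a generator \<open>s\<close> of the same degree: otherwise all coordinates at \<open>b\<close> of elements of
  \<open>g F\<close> would lie in \<open>\<mm>\<close>, and so would the coordinate \<open>1\<close> of \<open>b\<close> itself. Supports are finite.\<close>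

lemma (in free_over_local) locally_finite_basis:
  fixes F :: "('a, 'c, 'z) gr_module_scheme"
  assumes "graded_module R F" and S: "locally_finite_generators R F S" and g: "g \<in> deg_hom R 0 F M"
    and cover: "\<And>x. x \<in> carrier M \<Longrightarrow> \<exists>y \<in> carrier F. x \<ominus>\<^bsub>M\<^esub> g y \<in> mM"
  shows "locally_finite_generators R M B"
proof -
  interpret F: graded_module R F by fact
  interpret g: graded_linear R 0 F M g by unfold_locales (rule g)
  have S_hom: "S \<subseteq> (\<Union>j. mpart F j)" and S_span: "submodule_span R F S = carrier F"
    and S_fin: "\<And>j. finite (S \<inter> mpart F j)" using S by (auto simp: locally_finite_generators_def)
  obtain j0 where j0: "\<And>j. j < j0 \<Longrightarrow> S \<inter> mpart F j \<subseteq> {\<zero>\<^bsub>F\<^esub>}"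
    using S by (auto simp: locally_finite_generators_def)
  have Sc: "S \<subseteq> carrier F" using S_hom F.parts.part_carrier by blast
  let ?c = "\<lambda>s. coord R M B (g s)"
  have used: "\<exists>s \<in> S \<inter> mpart F j. ?c s b \<noteq> \<zero>" if b: "b \<in> B" "b \<in> mpart M j" for b j
  proof (rule ccontr)
    assume none: "\<not> (\<exists>s \<in> S \<inter> mpart F j. ?c s b \<noteq> \<zero>)"
    have "submodule {y \<in> carrier F. ?c y b \<in> mm} R F"
      by (rule F.submoduleI)
        (auto simp: g.add g.smult coord_zero coord_add coord_smult mm_zero mm_add mm_mult_left)
    moreover have "S \<subseteq> {y \<in> carrier F. ?c y b \<in> mm}"
    proof
      fix s assume s: "s \<in> S"
      then obtain i where i: "s \<in> mpart F i" using S_hom by blast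
      have "g s \<in> mpart M i" using g.part[OF i] by simp
      then have h: "if j \<le> i then ?c s b \<in> rpart R (nat (i - j)) else ?c s b = \<zero>"
        by (rule coord_homogeneous[OF _ b])
      have "?c s b \<in> mm"
      proof (cases "i = j")
        case True
        then show ?thesis using none s i mm_zero by auto
      next
        case False
        then show ?thesis
          using h mm_zero rpart_pos_subset_mm[of "?c s b" "nat (i - j)"] by (auto split: if_splits)
      qed
      then show "s \<in> {y \<in> carrier F. ?c y b \<in> mm}" using s Sc by auto
    qed
    ultimately have all: "?c y b \<in> mm" if "y \<in> carrier F" for y
      using F.span_minimal[of "{y \<in> carrier F. ?c y b \<in> mm}" S y] S_span that by simp
    have bc: "b \<in> carrier M" by (rule basis_carrier[OF b(1)])
    obtain y where y: "y \<in> carrier F" "b \<ominus>\<^bsub>M\<^esub> g y \<in> mM" using cover[OF bc] by blast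
    have "coord R M B ((b \<ominus>\<^bsub>M\<^esub> g y) \<oplus>\<^bsub>M\<^esub> g y) b \<in> mm"
      using coord_in_mm[OF y(2), of b] all[OF y(1)] bc y(1) by (subst coord_add) (auto intro: mm_add)
    then show False
      using bc y(1) coord_basis[OF b(1), of b] one_notin_mm by (simp add: M.add_minus_cancel)
  qed
  have fin: "finite (B \<inter> mpart M j)" for j
  proof (rule finite_subset)
    show "B \<inter> mpart M j \<subseteq> (\<Union>s\<in>S \<inter> mpart F j. {b. ?c s b \<noteq> \<zero>})" using used[of _ j] by blast
    show "finite (\<Union>s\<in>S \<inter> mpart F j. {b. ?c s b \<noteq> \<zero>})"
      using S_fin[of j] coord_finite Sc by (intro finite_UN_I) auto
  qed
  have "B \<inter> mpart M j \<subseteq> {\<zero>\<^bsub>M\<^esub>}" if "j < j0" for j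
  proof
    fix b assume "b \<in> B \<inter> mpart M j"
    then obtain s where "s \<in> S \<inter> mpart F j" "?c s b \<noteq> \<zero>" using used[of b j] by blast
    moreover from this have "s = \<zero>\<^bsub>F\<^esub>" using j0[OF that] by blast
    ultimately show "b \<in> {\<zero>\<^bsub>M\<^esub>}" by (simp add: coord_zero)
  qed
  then show ?thesis
    using homogeneous_basis basis_span fin unfolding locally_finite_generators_def by blast
qed

lemma diff_morph_comp:
  assumes "diff_morph R a L M f" and "diff_morph R a M N g"
  shows "diff_morph R a L N (\<lambda>x. g (f x))"
proof -
  interpret f: diff_morph R a L M f by fact
  interpret g: diff_morph R a M N g by fact
  have "(\<lambda>x. g (f x)) \<in> deg_hom R 0 L N" by (rule deg_hom_comp[OF f.hom g.hom]) simp
  then have "(\<lambda>x. g (f x)) \<in> diff_morphism R L N"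
    by (simp add: diff_morphism_def graded_hom_deg_hom f.commute g.commute)
  then show ?thesis by unfold_locales
qed

lemma free_flag_summand:
  assumes "local_graded_ring R" and "free_flag R a F \<Phi>"
  shows "flag_summand R a F F \<Phi> (\<lambda>x. x) (\<lambda>x. x)"
  using assms
  by (auto simp: flag_summand_def flag_summand_axioms_def diff_mod_def free_flag_def
      diff_morphism_def graded_hom_deg_hom deg_hom_id)

lemma comparison:
  assumes M: "flag_summand R a M G \<Phi> \<iota> p" and N: "flag_summand R a N G' \<Phi>' \<iota>' p'"
    and \<mu>: "diff_morph R a M D \<mu>" "quasi_isomorphism R M D \<mu>"
    and \<nu>: "diff_morph R a N D \<nu>" "quasi_isomorphism R N D \<nu>"
  obtains f g where "diff_morph R a M N f" and "diff_morph R a N M g"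
    and "differential M ` carrier M \<subseteq> max_ideal_times R M \<longrightarrow>
      (\<forall>x \<in> carrier M. x \<ominus>\<^bsub>M\<^esub> g (f x) \<in> max_ideal_times R M)"
    and "differential N ` carrier N \<subseteq> max_ideal_times R N \<longrightarrow>
      (\<forall>y \<in> carrier N. y \<ominus>\<^bsub>N\<^esub> f (g y) \<in> max_ideal_times R N)"
proof -
  interpret M: flag_summand R a M G \<Phi> \<iota> p by fact
  interpret N: flag_summand R a N G' \<Phi>' \<iota>' p' by fact
  interpret \<mu>: diff_morph R a M D \<mu> by fact
  interpret \<nu>: diff_morph R a N D \<nu> by fact
  obtain f where f: "diff_morph R a M N f" "homotopic R a M D \<mu> (\<lambda>x. \<nu> (f x))"
    by (rule M.lift_up_to_homotopy[OF \<nu> \<mu>(1)])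
  obtain g where g: "diff_morph R a N M g" "homotopic R a N D \<nu> (\<lambda>x. \<mu> (g x))"
    by (rule N.lift_up_to_homotopy[OF \<mu> \<nu>(1)])
  interpret f: diff_morph R a M N f by (rule f(1))
  interpret g: diff_morph R a N M g by (rule g(1))
  have gf: "homotopic R a M D \<mu> (\<lambda>x. \<mu> (g (f x)))"
    by (rule homotopic_trans[OF M.diff_mod_axioms \<mu>.E.diff_mod_axioms f(2) homotopic_precomp[OF f(1) g(2)]]) simp
  have fg: "homotopic R a N D \<nu> (\<lambda>x. \<nu> (f (g x)))"
    by (rule homotopic_trans[OF N.diff_mod_axioms \<mu>.E.diff_mod_axioms g(2) homotopic_precomp[OF g(1) f(2)]]) simp
  show ?thesis
  proof (rule that[OF f(1) g(1)]; intro impI ballI)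
    show "x \<ominus>\<^bsub>M\<^esub> g (f x) \<in> max_ideal_times R M"
      if "differential M ` carrier M \<subseteq> max_ideal_times R M" "x \<in> carrier M" for x
      by (rule M.self_map_over_quasi_isomorphism[OF \<mu> diff_morph_comp[OF f(1) g(1)] gf that])
    show "y \<ominus>\<^bsub>N\<^esub> f (g y) \<in> max_ideal_times R N"
      if "differential N ` carrier N \<subseteq> max_ideal_times R N" "y \<in> carrier N" for y
      by (rule N.self_map_over_quasi_isomorphism[OF \<nu> diff_morph_comp[OF g(1) f(1)] fg that])
  qed
qed

lemma minimal_free_resolutionE:
  fixes M :: "('a, 'b) diff_module" and T :: "'t itself"
  assumes "local_graded_ring R" and D: "differential_module R a D"
    and res: "minimal_free_resolution T R a D M \<mu>"
  obtains G :: "('a, 't) diff_module" and \<Phi> \<iota> p B where "flag_summand R a M G \<Phi> \<iota> p"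
    and "diff_morph R a M D \<mu>" and "quasi_isomorphism R M D \<mu>" and "free_over_local R M B"
    and "differential M ` carrier M \<subseteq> max_ideal_times R M"
proof -
  have dM: "differential_module R a M" and free: "free_graded_module R M" and q: "quasi_isomorphism R M D \<mu>"
    and minimal: "differential M ` carrier M \<subseteq> max_ideal_times R M"
    using res by (auto simp: minimal_free_resolution_def free_resolution_def)
  obtain G :: "('a, 't) diff_module" and \<Phi> \<eta> \<iota> where G: "free_flag_resolution R a D G \<Phi> \<eta>" "split_injection R M G \<iota>"
    using res unfolding minimal_free_resolution_def free_resolution_def by blast
  then obtain p where p: "\<iota> \<in> diff_morphism R M G" "p \<in> diff_morphism R G M" "\<forall>x \<in> carrier M. p (\<iota> x) = x"
    unfolding split_injection_def by blast
  interpret M: diff_mod R a M by unfold_locales (rule dM)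
  interpret D: diff_mod R a D by unfold_locales (rule D)
  interpret local_graded_ring R by fact
  have summand: "flag_summand R a M G \<Phi> \<iota> p"
    using p G(1) assms(1) by unfold_locales (auto simp: free_flag_resolution_def)
  have \<mu>: "diff_morph R a M D \<mu>" using q by unfold_locales (simp add: quasi_isomorphism_def)
  obtain B where "B \<subseteq> (\<Union>j. mpart M j)" "module_basis R M B"
    using free unfolding free_graded_module_def by blast
  then have "free_over_local R M B" by unfold_locales
  then show ?thesis using that summand \<mu> q minimal by blast
qed

lemma minimal_summand_locally_finite:
  assumes M: "flag_summand R a M G \<Phi>' \<iota> p" "diff_morph R a M D \<mu>" "quasi_isomorphism R M D \<mu>"
    and B: "free_over_local R M B" and minimal: "differential M ` carrier M \<subseteq> max_ideal_times R M"
    and F: "free_flag_resolution R a D F \<Phi> \<epsilon>" and S: "locally_finite_generators R F S"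
  shows "locally_finite_generators R M B"
proof -
  have flag: "free_flag R a F \<Phi>" and q: "quasi_isomorphism R F D \<epsilon>"
    using F by (auto simp: free_flag_resolution_def)
  interpret M: free_over_local R M B by (rule B)
  interpret F: diff_mod R a F using flag by unfold_locales (simp add: free_flag_def)
  interpret \<mu>: diff_morph R a M D \<mu> by (rule M(2))
  have \<epsilon>: "diff_morph R a F D \<epsilon>" using q by unfold_locales (simp add: quasi_isomorphism_def)
  have loc: "local_graded_ring R" by unfold_locales
  obtain f g where fg: "diff_morph R a M F f" "diff_morph R a F M g"
    and "differential M ` carrier M \<subseteq> max_ideal_times R M \<longrightarrow>
      (\<forall>x \<in> carrier M. x \<ominus>\<^bsub>M\<^esub> g (f x) \<in> max_ideal_times R M)"
    by (rule comparison[OF M(1) free_flag_summand[OF loc flag] M(2,3) \<epsilon> q])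
  then have gf: "\<forall>x \<in> carrier M. x \<ominus>\<^bsub>M\<^esub> g (f x) \<in> max_ideal_times R M"
    using minimal by (elim mp)
  interpret f: diff_morph R a M F f by (rule fg(1))
  interpret g: diff_morph R a F M g by (rule fg(2))
  show ?thesis
    by (rule M.locally_finite_basis[OF F.graded_module_axioms S g.hom])
      (use gf f.closed in \<open>blast intro: bexI[of _ "f _"]\<close>)
qed

text \<open>The comparison map \<open>f\<close> is onto by the lemma of Nakayama, splits because \<open>M\<^sub>2\<close> is free, and has its
  kernel in \<open>\<mm>M\<^sub>1\<close>.\<close>

lemma minimal_free_resolution_unique:
  fixes M\<^sub>1 :: "('a, 'm) diff_module" and M\<^sub>2 :: "('a, 'n) diff_module"
  assumes loc: "local_graded_ring R" and D: "differential_module R a D"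
    and F: "free_flag_resolution R a D F \<Phi> \<epsilon>" and S: "locally_finite_generators R F S"
    and M1: "minimal_free_resolution (T\<^sub>1 :: 's itself) R a D M\<^sub>1 \<mu>\<^sub>1"
    and M2: "minimal_free_resolution (T\<^sub>2 :: 't itself) R a D M\<^sub>2 \<mu>\<^sub>2"
  shows "diff_isomorphic R M\<^sub>1 M\<^sub>2"
proof -
  obtain G1 :: "('a, 's) diff_module" and \<Phi>1 \<iota>1 p1 B1 where s1: "flag_summand R a M\<^sub>1 G1 \<Phi>1 \<iota>1 p1"
    and m1: "diff_morph R a M\<^sub>1 D \<mu>\<^sub>1" "quasi_isomorphism R M\<^sub>1 D \<mu>\<^sub>1" and f1: "free_over_local R M\<^sub>1 B1"
    and min1: "differential M\<^sub>1 ` carrier M\<^sub>1 \<subseteq> max_ideal_times R M\<^sub>1"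
    by (rule minimal_free_resolutionE[OF loc D M1])
  obtain G2 :: "('a, 't) diff_module" and \<Phi>2 \<iota>2 p2 B2 where s2: "flag_summand R a M\<^sub>2 G2 \<Phi>2 \<iota>2 p2"
    and m2: "diff_morph R a M\<^sub>2 D \<mu>\<^sub>2" "quasi_isomorphism R M\<^sub>2 D \<mu>\<^sub>2" and f2: "free_over_local R M\<^sub>2 B2"
    and min2: "differential M\<^sub>2 ` carrier M\<^sub>2 \<subseteq> max_ideal_times R M\<^sub>2"
    by (rule minimal_free_resolutionE[OF loc D M2])
  interpret M1: free_over_local R M\<^sub>1 B1 by (rule f1)
  interpret M2: free_over_local R M\<^sub>2 B2 by (rule f2)
  have lfg1: "locally_finite_generators R M\<^sub>1 B1"
    by (rule minimal_summand_locally_finite[OF s1 m1 f1 min1 F S])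
  have lfg2: "locally_finite_generators R M\<^sub>2 B2"
    by (rule minimal_summand_locally_finite[OF s2 m2 f2 min2 F S])
  obtain f g where fg: "diff_morph R a M\<^sub>1 M\<^sub>2 f" "diff_morph R a M\<^sub>2 M\<^sub>1 g"
    and inv: "differential M\<^sub>1 ` carrier M\<^sub>1 \<subseteq> max_ideal_times R M\<^sub>1 \<longrightarrow>
      (\<forall>x \<in> carrier M\<^sub>1. x \<ominus>\<^bsub>M\<^sub>1\<^esub> g (f x) \<in> max_ideal_times R M\<^sub>1)"
    "differential M\<^sub>2 ` carrier M\<^sub>2 \<subseteq> max_ideal_times R M\<^sub>2 \<longrightarrow>
      (\<forall>y \<in> carrier M\<^sub>2. y \<ominus>\<^bsub>M\<^sub>2\<^esub> f (g y) \<in> max_ideal_times R M\<^sub>2)"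
    by (rule comparison[OF s1 s2 m1 m2])
  interpret f: diff_morph R a M\<^sub>1 M\<^sub>2 f by (rule fg(1))
  interpret g: diff_morph R a M\<^sub>2 M\<^sub>1 g by (rule fg(2))
  have "f ` carrier M\<^sub>1 = carrier M\<^sub>2"
  proof (rule M2.graded_nakayama[OF lfg2 f.graded_submodule_image[OF M1.carrier_graded_submodule]])
    fix y assume y: "y \<in> carrier M\<^sub>2"
    show "y \<in> f ` carrier M\<^sub>1 <+>\<^bsub>M\<^sub>2\<^esub> max_ideal_times R M\<^sub>2"
      using set_addI[OF imageI[OF g.closed[OF y], of f] bspec[OF mp[OF inv(2) min2] y], of M\<^sub>2] y
      by (simp add: M2.M.add_minus_cancel)
  qed
  then have surj: "carrier M\<^sub>2 \<subseteq> f ` carrier M\<^sub>1" by simp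
  obtain \<sigma> where \<sigma>: "\<sigma> \<in> deg_hom R 0 M\<^sub>2 M\<^sub>1" "\<forall>y \<in> carrier M\<^sub>2. f (\<sigma> y) = y"
    by (rule M2.lift_along_surjection[OF M1.graded_module_M M2.graded_module_M f.hom surj deg_hom_id])
  have "bij_betw f (carrier M\<^sub>1) (carrier M\<^sub>2)"
  proof (rule M1.split_surjection_bijective(1)[OF lfg1 M2.graded_module_M f.hom \<sigma>(1)])
    show "x \<in> max_ideal_times R M\<^sub>1" if "x \<in> carrier M\<^sub>1" "f x = \<zero>\<^bsub>M\<^sub>2\<^esub>" for x
      using bspec[OF mp[OF inv(1) min1] that(1)] that by simp
  qed (use \<sigma>(2) in blast)
  then show ?thesis using f.morphism unfolding diff_isomorphic_def by blast
qed

text \<open>The minimal summand of the flag is a resolution because the projection onto it is homotopic to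
  the identity.\<close>

lemma minimal_free_resolution_exists:
  fixes F :: "('a, 'f) diff_module"
  assumes loc: "local_graded_ring R" and D: "differential_module R a D"
    and res: "free_flag_resolution R a D F \<Phi> \<epsilon>" and S: "locally_finite_generators R F S"
  obtains e where "e \<in> deg_hom R 0 F F" and "\<forall>x \<in> carrier F. e (e x) = e x"
    and "minimal_free_resolution TYPE('f) R a D (restrict_module F (e ` carrier F)) \<epsilon>"
proof -
  have flag: "free_flag R a F \<Phi>" and q: "quasi_isomorphism R F D \<epsilon>"
    using res by (auto simp: free_flag_resolution_def)
  interpret R: local_graded_ring R by (rule loc)
  interpret F: diff_mod R a F using flag by unfold_locales (simp add: free_flag_def)
  interpret D: diff_mod R a D by unfold_locales (rule D)
  interpret \<epsilon>: diff_morph R a F D \<epsilon> using q by unfold_locales (simp add: quasi_isomorphism_def)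
  obtain \<beta> where "layered_basis R F \<beta> a (differential F)" by (rule free_flag_layered_basis[OF loc flag])
  then interpret L: layered_basis R F \<beta> a "differential F" .
  interpret FD: free_differential R F "\<Union>i. \<beta> i" a "differential F" S
    by unfold_locales (rule L.basis L.homogeneous_basis F.d.hom F.d_d S; assumption?)+
  obtain e s where eh: "e \<in> deg_hom R 0 F F" and sh: "s \<in> deg_hom R (- a) F F"
    and e_def: "\<forall>x \<in> carrier F. e x = x \<ominus>\<^bsub>F\<^esub> (differential F (s x) \<oplus>\<^bsub>F\<^esub> s (differential F x))"
    and ee: "\<forall>x \<in> carrier F. e (e x) = e x" and ed: "\<forall>x \<in> carrier F. e (differential F x) = differential F (e x)"
    and free: "free_graded_module R (restrict_module F (e ` carrier F))"
    and minimal: "\<forall>x \<in> e ` carrier F. differential F x \<in> max_ideal_times R (restrict_module F (e ` carrier F))"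
    by (rule FD.minimal_summand)
  interpret e: graded_linear R 0 F F e by (rule graded_linear.intro[OF F.graded_module_axioms F.graded_module_axioms eh])
  interpret s: graded_linear R "- a" F F s by (rule graded_linear.intro[OF F.graded_module_axioms F.graded_module_axioms sh])
  let ?H = "e ` carrier F" and ?M = "restrict_module F (e ` carrier F)"
  have H: "graded_submodule R F ?H" by (rule e.graded_submodule_image[OF FD.carrier_graded_submodule])
  have Hc: "x \<in> carrier F" if "x \<in> ?H" for x using that by auto
  have Hc': "?H \<subseteq> carrier F" using Hc by blast
  have fixed: "e x = x" if "x \<in> ?H" for x using that ee by auto
  have dM_eq: "differential ?M = differential F" by (simp add: restrict_module_def)
  have dH: "differential F x \<in> ?H" if "x \<in> ?H" for x
    using bspec[OF ed Hc[OF that]] fixed[OF that] F.d.closed[OF Hc[OF that]] by (metis imageI)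
  have gM: "graded_module R ?M" by (rule F.restrict_graded_module[OF H])
  have "differential F \<in> deg_hom R a ?M F" by (rule deg_hom_restrict_dom[OF F.d.hom Hc'])
  then have "differential F \<in> deg_hom R a ?M ?M"
    by (rule deg_hom_restrict_cod) (use dH in auto)
  then have dM: "differential_module R a ?M"
    using gM Hc by (simp add: differential_module_def graded_hom_twist dM_eq)
  interpret M: diff_mod R a ?M by unfold_locales (rule dM)
  have e_morph: "e \<in> diff_morphism R F ?M"
    using deg_hom_restrict_cod[OF eh, of ?H] F.parts.part_carrier ed
    by (auto simp: diff_morphism_def graded_hom_deg_hom dM_eq)
  have i_morph: "(\<lambda>x. x) \<in> diff_morphism R ?M F"
    using deg_hom_restrict_dom[OF deg_hom_id Hc'] by (simp add: diff_morphism_def graded_hom_deg_hom dM_eq)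
  have "\<epsilon> \<in> diff_morphism R ?M D"
    using deg_hom_restrict_dom[OF \<epsilon>.hom Hc'] \<epsilon>.commute Hc
    by (auto simp: diff_morphism_def graded_hom_deg_hom dM_eq)
  then interpret \<epsilon>M: diff_morph R a ?M D \<epsilon> by unfold_locales
  have cyc: "cycles ?M = cycles F \<inter> ?H" using Hc by (auto simp: cycles_def dM_eq)
  have bnd: "boundaries ?M = differential F ` ?H" by (simp add: boundaries_def dM_eq)
  have qM: "quasi_isomorphism R ?M D \<epsilon>"
  proof (rule \<epsilon>M.quasi_isomorphismI)
    fix y assume y: "y \<in> cycles D"
    then obtain z where z: "z \<in> cycles F" "\<epsilon> z \<ominus>\<^bsub>D\<^esub> y \<in> boundaries D"
      using \<epsilon>.quasi_isomorphism_surj[OF q] by blast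
    have c: "z \<in> carrier F" "y \<in> carrier D" using z(1) y F.cycles_closed D.cycles_closed by auto
    have dz: "differential F z = \<zero>\<^bsub>F\<^esub>" using z(1) by (simp add: cycles_def)
    have ez: "e z = z \<ominus>\<^bsub>F\<^esub> differential F (s z)" using bspec[OF e_def c(1)] c(1) dz by simp
    have "\<epsilon> (e z) \<ominus>\<^bsub>D\<^esub> y = (\<epsilon> z \<ominus>\<^bsub>D\<^esub> y) \<ominus>\<^bsub>D\<^esub> differential D (\<epsilon> (s z))"
      unfolding ez using c by (simp add: \<epsilon>.minus \<epsilon>.commute D.M.minus_eq D.M.a_ac)
    also have "\<dots> \<in> boundaries D"
      using D.submoduleD(7)[OF D.boundaries_submodule z(2) D.boundary] c(1) by simp
    finally have "\<epsilon> (e z) \<ominus>\<^bsub>D\<^esub> y \<in> boundaries D" .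
    moreover have "differential F (e z) = \<zero>\<^bsub>F\<^esub>" using bspec[OF ed c(1), symmetric] dz by simp
    then have "e z \<in> cycles ?M" using c(1) unfolding cyc by (simp add: cycles_def)
    ultimately show "\<exists>z \<in> cycles ?M. \<epsilon> z \<ominus>\<^bsub>D\<^esub> y \<in> boundaries D" by blast
  next
    fix z assume z: "z \<in> cycles ?M" "\<epsilon> z \<in> boundaries D"
    then have zH: "z \<in> cycles F" "z \<in> ?H" using cyc by auto
    then obtain y where y: "y \<in> carrier F" "z = differential F y"
      using \<epsilon>.quasi_isomorphism_inj[OF q _ z(2)] by (auto simp: boundaries_def)
    have "z = differential F (e y)" using fixed[OF zH(2)] y(2) bspec[OF ed y(1)] by simp
    then show "z \<in> boundaries ?M" using y(1) bnd by blast
  qed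
  have "split_injection R ?M F (\<lambda>x. x)"
    unfolding split_injection_def
  proof (intro conjI bexI[OF _ e_morph] ballI)
    show "e x = x" if "x \<in> carrier ?M" for x
      using that unfolding restrict_module_simps by (rule fixed)
  qed (rule i_morph)
  then have "free_resolution TYPE('f) R a D ?M \<epsilon>"
    unfolding free_resolution_def
    using dM free qM res by (intro conjI exI[of _ F] exI[of _ \<Phi>] exI[of _ \<epsilon>] exI[of _ "\<lambda>x. x"]) simp_all
  then have "minimal_free_resolution TYPE('f) R a D ?M \<epsilon>"
    unfolding minimal_free_resolution_def dM_eq using minimal by (simp add: image_subset_iff)
  then show ?thesis using that eh ee by blast
qed

section \<open>Locally finite generators under the two finiteness hypotheses\<close>

lemma (in graded_module) finitely_generated_locally_finite:
  assumes "finitely_generated R M"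
  obtains S where "locally_finite_generators R M S"
proof -
  obtain T where T: "T \<subseteq> carrier M" "finite T" "carrier M = submodule_span R M T"
    using assms by (auto simp: finitely_generated_def)
  let ?S = "\<Union>x\<in>T. (\<lambda>j. mcomp M j x) ` {j. mcomp M j x \<noteq> \<zero>\<^bsub>M\<^esub>}"
  have fin: "finite ?S" using T(1,2) parts.component_props(2) by blast
  have hom: "?S \<subseteq> (\<Union>j. mpart M j)" using T(1) parts.component_props(1) by blast
  have Sc: "?S \<subseteq> carrier M" using T(1) by auto
  note s = submodule_span_submodule[OF Sc]
  have "T \<subseteq> submodule_span R M ?S"
  proof
    fix x assume x: "x \<in> T"
    then have xc: "x \<in> carrier M" using T(1) by blast
    have "mcomp M j x \<in> submodule_span R M ?S" for j
    proof (cases "mcomp M j x = \<zero>\<^bsub>M\<^esub>")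
      case True
      then show ?thesis using submoduleD(3)[OF s] by simp
    next
      case False
      then show ?thesis using x by (intro span_subset) blast
    qed
    then show "x \<in> submodule_span R M ?S"
      by (rule parts.additive_in_subgroup[OF xc submoduleD(1)[OF s]])
  qed
  then have "carrier M \<subseteq> submodule_span R M ?S" using span_minimal[OF s] T(3) by blast
  then have span: "submodule_span R M ?S = carrier M" using span_closed[OF Sc] by blast
  have "\<forall>x \<in> ?S. \<exists>j. x \<in> mpart M j" using hom by blast
  then obtain dg where dg: "\<forall>x \<in> ?S. x \<in> mpart M (dg x)" by (rule bchoice[THEN exE])
  have "?S \<inter> mpart M j \<subseteq> {\<zero>\<^bsub>M\<^esub>}" if j: "j < Min (insert 0 (dg ` ?S))" for j
  proof
    fix x assume x: "x \<in> ?S \<inter> mpart M j"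
    then have "Min (insert 0 (dg ` ?S)) \<le> dg x" using fin by (intro Min_le) auto
    then have "dg x \<noteq> j" using j by simp
    then show "x \<in> {\<zero>\<^bsub>M\<^esub>}"
      using x parts.component_homogeneous[OF bspec[OF dg, of x], of j] parts.component_homogeneous[of x j j]
      by simp
  qed
  then have "locally_finite_generators R M ?S"
    using hom span fin unfolding locally_finite_generators_def by blast
  then show ?thesis by (rule that)
qed

lemma (in graded_module) finite_dimensional_parts_locally_finite:
  assumes fd: "\<And>j. finite_dimensional (deg_zero R) (M\<lparr>carrier := mpart M j\<rparr>)"
    and low: "\<And>j. j < j\<^sub>0 \<Longrightarrow> mpart M j = {\<zero>\<^bsub>M\<^esub>}"
  obtains S where "locally_finite_generators R M S"
proof -
  let ?V = "\<lambda>j. M\<lparr>carrier := mpart M j\<rparr>"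
  have lm: "left_module (deg_zero R) (?V j)" for j using fd by (simp add: finite_dimensional_def)
  have "\<exists>b. finite b \<and> module_basis (deg_zero R) (?V j) b" for j using fd by (simp add: finite_dimensional_def)
  then obtain \<beta> where \<beta>: "\<And>j. finite (\<beta> j)" "\<And>j. module_basis (deg_zero R) (?V j) (\<beta> j)" by metis
  have \<beta>part: "\<beta> j \<subseteq> mpart M j" for j using \<beta>(2)[of j] by (simp add: module_basis_def)
  let ?S = "\<Union>j. \<beta> j"
  have Sc: "?S \<subseteq> carrier M" using \<beta>part parts.part_carrier by blast
  note s = submodule_span_submodule[OF Sc]
  have part_span: "x \<in> submodule_span R M ?S" if x: "x \<in> mpart M j" for x j
  proof -
    interpret V: left_module "deg_zero R" "?V j" by (rule lm)
    have \<beta>c: "\<beta> j \<subseteq> carrier (?V j)" using \<beta>part by simp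
    have "based_module (deg_zero R) (?V j) (\<beta> j)"
      using lm \<beta>(2) by (simp add: based_module_def based_module_axioms_def)
    then have "submodule_span (deg_zero R) (?V j) (\<beta> j) = carrier (?V j)" by (rule based_module.basis_span)
    then have "x \<in> submodule_span (deg_zero R) (?V j) (\<beta> j)" using x by simp
    then obtain A c where A: "finite A" "A \<subseteq> \<beta> j" "c \<in> A \<rightarrow> carrier (deg_zero R)"
      "x = (\<Oplus>\<^bsub>?V j\<^esub>s\<in>A. c s \<odot>\<^bsub>?V j\<^esub> s)"
      by (rule V.in_spanE[OF \<beta>c])
    have c0: "c b \<in> rpart R 0" if "b \<in> A" for b using that A(3) by auto
    have c: "c b \<in> rpart R 0" "c b \<in> carrier R" "b \<in> mpart M j" if "b \<in> A" for b
      using c0[OF that] ring_parts.part_carrier[OF c0[OF that]] that A(2) \<beta>part by auto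
    have "(\<Oplus>\<^bsub>?V j\<^esub>s\<in>A. c s \<odot>\<^bsub>M\<^esub> s) = (\<Oplus>\<^bsub>M\<^esub>s\<in>A. c s \<odot>\<^bsub>M\<^esub> s)"
      by (rule finsum_in_subgroup[OF M.abelian_monoid_axioms V.M.abelian_monoid_axioms])
        (use c smult_mpart[of _ 0 _ j] parts.part_carrier in auto)
    then have "x = (\<Oplus>\<^bsub>M\<^esub>s\<in>A. c s \<odot>\<^bsub>M\<^esub> s)" using A(4) by simp
    also have "\<dots> \<in> submodule_span R M ?S"
      by (rule submodule_finsum[OF s], rule submoduleD(5)[OF s c(2)], assumption, rule span_subset)
        (use A(2) in blast)
    finally show ?thesis .
  qed
  have "x \<in> submodule_span R M ?S" if "x \<in> carrier M" for x
    by (rule parts.additive_in_subgroup[OF that submoduleD(1)[OF s]])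
      (rule part_span[OF parts.component_props(1)[OF that]])
  then have span: "submodule_span R M ?S = carrier M" using span_closed[OF Sc] by blast
  have "?S \<inter> mpart M j \<subseteq> insert \<zero>\<^bsub>M\<^esub> (\<beta> j)" for j
  proof
    fix x assume x: "x \<in> ?S \<inter> mpart M j"
    then obtain i where i: "x \<in> \<beta> i" "x \<in> mpart M i" using \<beta>part by blast
    show "x \<in> insert \<zero>\<^bsub>M\<^esub> (\<beta> j)"
      using i x parts.component_homogeneous[OF i(2), of j] parts.component_homogeneous[of x j j]
      by (cases "i = j") auto
  qed
  then have "finite (?S \<inter> mpart M j)" for j
    using \<beta>(1)[of j] finite_subset[of "?S \<inter> mpart M j" "insert \<zero>\<^bsub>M\<^esub> (\<beta> j)"] by simp
  then have "locally_finite_generators R M ?S"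
    using span \<beta>part low unfolding locally_finite_generators_def by blast
  then show ?thesis by (rule that)
qed

lemma (in graded_module) finitely_generated_retract:
  assumes "finitely_generated R M" and e: "e \<in> deg_hom R 0 M M"
    and ee: "\<forall>x \<in> carrier M. e (e x) = e x"
  shows "finitely_generated R (restrict_module M (e ` carrier M))"
proof -
  interpret e: graded_linear R 0 M M e by unfold_locales (rule e)
  obtain T where T: "T \<subseteq> carrier M" "finite T" "carrier M = submodule_span R M T"
    using assms(1) by (auto simp: finitely_generated_def)
  have "graded_submodule R M (carrier M)" by (auto simp: graded_submodule_def submodule_carrier)
  then have H: "graded_submodule R M (e ` carrier M)" by (rule e.graded_submodule_image)
  have eT: "e ` T \<subseteq> e ` carrier M" using T(1) by blast
  have "submodule_span R (restrict_module M (e ` carrier M)) (e ` T) = e ` carrier M"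
    using span_restrict[OF H eT] e.image_span[OF T(1)] T(3) by simp
  then show ?thesis unfolding finitely_generated_def using eT T(2) by (intro exI[of _ "e ` T"]) simp
qed

section \<open>Existence and uniqueness of minimal free resolutions\<close>

theorem theorem4p2:
  fixes R :: "'a gr_ring" and a :: int and D :: "('a, 'd) diff_module"
  assumes "graded_local_ring R" and "differential_module R a D"
  shows
    "((\<exists>(F :: ('a, 'f) diff_module) \<Phi> \<epsilon>.
           free_flag_resolution R a D F \<Phi> \<epsilon> \<and> finitely_generated R F)
        \<longrightarrow>
        (\<exists>(M :: ('a, 'f) diff_module) \<mu>.
           minimal_free_resolution TYPE('f) R a D M \<mu> \<and> finitely_generated R M) \<and>
        (\<forall>(M\<^sub>1 :: ('a, 'm) diff_module) \<mu>\<^sub>1 (M\<^sub>2 :: ('a, 'n) diff_module) \<mu>\<^sub>2.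
           minimal_free_resolution TYPE('s) R a D M\<^sub>1 \<mu>\<^sub>1 \<longrightarrow>
           minimal_free_resolution TYPE('t) R a D M\<^sub>2 \<mu>\<^sub>2 \<longrightarrow>
           diff_isomorphic R M\<^sub>1 M\<^sub>2))
     \<and>
     (field (deg_zero R) \<and>
      (\<exists>(F :: ('a, 'f) diff_module) \<Phi> \<epsilon>.
           free_flag_resolution R a D F \<Phi> \<epsilon> \<and>
           (\<forall>i. finitely_generated R (restrict_module F (\<Phi> i))) \<and>
           (\<forall>j. finite_dimensional (deg_zero R) (F\<lparr>carrier := mpart F j\<rparr>)) \<and>
           (\<exists>j\<^sub>0. \<forall>j<j\<^sub>0. mpart F j = {\<zero>\<^bsub>F\<^esub>}))
        \<longrightarrow>
        (\<exists>(M :: ('a, 'f) diff_module) \<mu>. minimal_free_resolution TYPE('f) R a D M \<mu>) \<and>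
        (\<forall>(M\<^sub>1 :: ('a, 'm) diff_module) \<mu>\<^sub>1 (M\<^sub>2 :: ('a, 'n) diff_module) \<mu>\<^sub>2.
           minimal_free_resolution TYPE('s) R a D M\<^sub>1 \<mu>\<^sub>1 \<longrightarrow>
           minimal_free_resolution TYPE('t) R a D M\<^sub>2 \<mu>\<^sub>2 \<longrightarrow>
           diff_isomorphic R M\<^sub>1 M\<^sub>2))"
proof -
  have loc: "local_graded_ring R"
    using assms(1) by (simp add: graded_local_ring_def local_graded_ring_def local_graded_ring_axioms_def)
  have flag_module: "graded_module R F" if "free_flag_resolution R a D F \<Phi> \<epsilon>"
    for F :: "('a, 'f) diff_module" and \<Phi> \<epsilon>
    using that by (simp add: free_flag_resolution_def free_flag_def differential_module_def)
  show ?thesis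
  proof (intro conjI impI allI)
    assume "\<exists>(F :: ('a, 'f) diff_module) \<Phi> \<epsilon>. free_flag_resolution R a D F \<Phi> \<epsilon> \<and> finitely_generated R F"
    then obtain F :: "('a, 'f) diff_module" and \<Phi> \<epsilon>
      where F: "free_flag_resolution R a D F \<Phi> \<epsilon>" "finitely_generated R F" by blast
    obtain S where S: "locally_finite_generators R F S"
      by (rule graded_module.finitely_generated_locally_finite[OF flag_module[OF F(1)] F(2)])
    obtain e where e: "e \<in> deg_hom R 0 F F" "\<forall>x \<in> carrier F. e (e x) = e x"
      "minimal_free_resolution TYPE('f) R a D (restrict_module F (e ` carrier F)) \<epsilon>"
      by (rule minimal_free_resolution_exists[OF loc assms(2) F(1) S])
    then show "\<exists>(M :: ('a, 'f) diff_module) \<mu>.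
        minimal_free_resolution TYPE('f) R a D M \<mu> \<and> finitely_generated R M"
      using graded_module.finitely_generated_retract[OF flag_module[OF F(1)] F(2) e(1,2)] by blast
    show "diff_isomorphic R M\<^sub>1 M\<^sub>2"
      if "minimal_free_resolution TYPE('s) R a D M\<^sub>1 \<mu>\<^sub>1" "minimal_free_resolution TYPE('t) R a D M\<^sub>2 \<mu>\<^sub>2"
      for M\<^sub>1 :: "('a, 'm) diff_module" and \<mu>\<^sub>1 and M\<^sub>2 :: "('a, 'n) diff_module" and \<mu>\<^sub>2
      by (rule minimal_free_resolution_unique[OF loc assms(2) F(1) S that])
  next
    assume "field (deg_zero R) \<and>
      (\<exists>(F :: ('a, 'f) diff_module) \<Phi> \<epsilon>.
           free_flag_resolution R a D F \<Phi> \<epsilon> \<and>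
           (\<forall>i. finitely_generated R (restrict_module F (\<Phi> i))) \<and>
           (\<forall>j. finite_dimensional (deg_zero R) (F\<lparr>carrier := mpart F j\<rparr>)) \<and>
           (\<exists>j\<^sub>0. \<forall>j<j\<^sub>0. mpart F j = {\<zero>\<^bsub>F\<^esub>}))"
    then obtain F :: "('a, 'f) diff_module" and \<Phi> \<epsilon> j\<^sub>0
      where F: "free_flag_resolution R a D F \<Phi> \<epsilon>"
        and fd: "\<And>j. finite_dimensional (deg_zero R) (F\<lparr>carrier := mpart F j\<rparr>)"
        and low: "\<And>j. j < j\<^sub>0 \<Longrightarrow> mpart F j = {\<zero>\<^bsub>F\<^esub>}" by blast
    obtain S where S: "locally_finite_generators R F S"
      by (rule graded_module.finite_dimensional_parts_locally_finite[OF flag_module[OF F] fd low])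
    show "\<exists>(M :: ('a, 'f) diff_module) \<mu>. minimal_free_resolution TYPE('f) R a D M \<mu>"
      using minimal_free_resolution_exists[OF loc assms(2) F S] by blast
    show "diff_isomorphic R M\<^sub>1 M\<^sub>2"
      if "minimal_free_resolution TYPE('s) R a D M\<^sub>1 \<mu>\<^sub>1" "minimal_free_resolution TYPE('t) R a D M\<^sub>2 \<mu>\<^sub>2"
      for M\<^sub>1 :: "('a, 'm) diff_module" and \<mu>\<^sub>1 and M\<^sub>2 :: "('a, 'n) diff_module" and \<mu>\<^sub>2
      by (rule minimal_free_resolution_unique[OF loc assms(2) F S that])
  qed
qed

end
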